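(* Let $0<\alpha<d$ and $\theta\in(\alpha,\alpha+d/3)$, and write $a_0:=2-\theta\alpha^{-1}$. Consider the estimate $$(\star)\qquad \mathbb{P}(0\leftrightarrow x)\asymp\begin{cases}\zeta_n^{-1}\|x\|^{-\alpha}, & \text{if } 0<\|x\|\le \operatorname{diam}(\Lambda_n)^{a_0},\\ |\Lambda_n|^{-(d+\alpha-\theta)/d}, & \text{if } \operatorname{diam}(\Lambda_n)^{a_0}<\|x\|\le\operatorname{diam}(\Lambda_n),\end{cases}\qquad x\in\Lambda_n\setminus\{0\}.$$ (a) If $0<\alpha<d/3$ and $\alpha<\theta<2\alpha$, then $(\star)$ holds. (b) If $0<\alpha<d/3$ and $2\alpha\le\theta<\alpha+d/3$, then $$\mathbb{P}(0\leftrightarrow x)\asymp|\Lambda_n|^{-(d+\alpha-\theta)/d}\quad\text{for } x\in\Lambda_n\setminus\{0\}.$$ (c) If $d/3\le\alpha\le 5d/6$ and $\alpha<\theta<\alpha+d/3$, then $(\star)$ holds. (d) If $5d/6<\alpha<d$ and $\alpha<\theta<2d-\alpha$, then $(\star)$ holds.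
   Context: Let $d\ge 1$, $L\ge 2$ be integers. $\mathbb{H}_L^d$ is the direct sum of countably many copies of $(\mathbb{Z}/L\mathbb{Z})^d$, i.e. the set of sequences $x=(x_i)_{i\ge 1}$ with $x_i\in(\mathbb{Z}/L\mathbb{Z})^d$ and $x_i=0$ for all but finitely many $i$. Set $\|0\|=0$, and $\|x\|=L^i$ if $x_i\ne 0$ and $x_j=0$ for all $j>i$. Let $\Lambda_n=\{x\in\mathbb{H}_L^d:\|x\|\le L^n\}$, so $|\Lambda_n|=L^{nd}$ and $\operatorname{diam}(\Lambda_n)=L^n$. Let $0<A_1\le A_2$ and let $\rho:[0,\infty)\to[0,\infty)$ satisfy $\rho(0)=0$ and $A_1r^{-\alpha}\le\rho(r)\le A_2r^{-\alpha}$ for all $r\ge 1$. For $n\ge1$ with $L^{nd}>2$, $\zeta_n$ is the unique positive number satisfying $(L^d-1)\sum_{i=1}^n L^{(i-1)d}\exp(-\zeta_n^{-1}\rho(L^i))=L^{nd}-2$. Let $\rho^-(r)=\max\{\rho(r)-L^{-n\theta},0\}$ and $\kappa^{(n),-}(x,y)=\zeta_n^{-1}\rho^-(\|x-y\|)$. Let $G^-_{\Lambda_n}$ be the random graph with vertex set $\Lambda_n$ in which each pair $x\neq y$ is joined by an edge independently with probability $1-\exp(-\kappa^{(n),-}(x,y))$. $\{x\leftrightarrow y\}$ is the event that there is a path between $x$ and $y$ in $G^-_{\Lambda_n}$. Convention: for families of reals, "$a_n^{(i)}\lesssim b_n^{(i)}$ for $i\in\mathcal{I}_n$" means there exist $n_0\ge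 1$ depending only on $(A_1,A_2,L,d,\alpha,\theta)$ and $C>0$ depending only on $(A_1,A_2,L,d,\alpha)$ such that $a_n^{(i)}\le C b_n^{(i)}$ for all $n\ge n_0$ and all $i\in\mathcal{I}_n$; "$a_n^{(i)}\asymp b_n^{(i)}$" means both $a_n^{(i)}\lesssim b_n^{(i)}$ and $b_n^{(i)}\lesssim a_n^{(i)}$. *)

theory Defs
  imports "HOL-Algebra.Product_Groups" "HOL-Probability.Probability"
begin

section \<open>The hierarchical lattice\<close>

definition zmod_power :: "nat \<Rightarrow> nat \<Rightarrow> (nat \<Rightarrow> int) monoid"
  where "zmod_power L d = product_group {..<d} (\<lambda>_. integer_mod_group L)"

definition hier_group :: "nat \<Rightarrow> nat \<Rightarrow> (nat \<Rightarrow> nat \<Rightarrow> int) monoid"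
  where "hier_group L d = sum_group {1..} (\<lambda>_. zmod_power L d)"

definition hnorm :: "nat \<Rightarrow> nat \<Rightarrow> (nat \<Rightarrow> nat \<Rightarrow> int) \<Rightarrow> real"
  where "hnorm L d x =
    (if x = \<one>\<^bsub>hier_group L d\<^esub> then 0
     else real L ^ Max {i. 1 \<le> i \<and> x i \<noteq> \<one>\<^bsub>zmod_power L d\<^esub>})"

definition hdist :: "nat \<Rightarrow> nat \<Rightarrow> (nat \<Rightarrow> nat \<Rightarrow> int) \<Rightarrow> (nat \<Rightarrow> nat \<Rightarrow> int) \<Rightarrow> real"
  where "hdist L d x y = hnorm L d (x \<otimes>\<^bsub>hier_group L d\<^esub> inv\<^bsub>hier_group L d\<^esub> y)"

definition hbox :: "nat \<Rightarrow> nat \<Rightarrow> nat \<Rightarrow> (nat \<Rightarrow> nat \<Rightarrow> int) set"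
  where "hbox L d n = {x \<in> carrier (hier_group L d). hnorm L d x \<le> real L ^ n}"

definition hdiam :: "nat \<Rightarrow> nat \<Rightarrow> (nat \<Rightarrow> nat \<Rightarrow> int) set \<Rightarrow> real"
  where "hdiam L d S = (SUP (x, y) \<in> S \<times> S. hdist L d x y)"


section \<open>The kernel and the random graph\<close>

text \<open>Functions \<open>[0,\<infinity>) \<rightarrow> [0,\<infinity>)\<close> are represented by their arbitrary extensions to the reals;
  only arguments \<open>r \<ge> 0\<close> are ever used.\<close>

definition kernels :: "real \<Rightarrow> real \<Rightarrow> real \<Rightarrow> (real \<Rightarrow> real) set"
  where "kernels A1 A2 \<alpha> =
    {\<rho>. (\<forall>r\<ge>0. 0 \<le> \<rho> r) \<and> \<rho> 0 = 0 \<and>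
        (\<forall>r\<ge>1. A1 * r powr (-\<alpha>) \<le> \<rho> r \<and> \<rho> r \<le> A2 * r powr (-\<alpha>))}"

text \<open>The description determines \<open>\<zeta>\<^sub>n\<close> when \<open>n \<ge> 1\<close> and \<open>L\<^sup>n\<^sup>d > 2\<close>; see \<open>zeta_ex1\<close> below.\<close>

definition zeta :: "nat \<Rightarrow> nat \<Rightarrow> (real \<Rightarrow> real) \<Rightarrow> nat \<Rightarrow> real"
  where "zeta L d \<rho> n =
    (THE z. z > 0 \<and>
       (real L ^ d - 1) * (\<Sum>i=1..n. real L ^ ((i - 1) * d) * exp (- (inverse z * \<rho> (real L ^ i))))
       = real L ^ (n * d) - 2)"

definition rho_minus :: "nat \<Rightarrow> real \<Rightarrow> (real \<Rightarrow> real) \<Rightarrow> nat \<Rightarrow> real \<Rightarrow> real"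
  where "rho_minus L \<theta> \<rho> n r = max (\<rho> r - real L powr (- (real n * \<theta>))) 0"

definition kappa_minus ::
  "nat \<Rightarrow> nat \<Rightarrow> real \<Rightarrow> (real \<Rightarrow> real) \<Rightarrow> nat \<Rightarrow> (nat \<Rightarrow> nat \<Rightarrow> int) \<Rightarrow> (nat \<Rightarrow> nat \<Rightarrow> int) \<Rightarrow> real"
  where "kappa_minus L d \<theta> \<rho> n x y = inverse (zeta L d \<rho> n) * rho_minus L \<theta> \<rho> n (hdist L d x y)"

definition pairs :: "'v set \<Rightarrow> 'v set set"
  where "pairs V = {{x, y} | x y. x \<in> V \<and> y \<in> V \<and> x \<noteq> y}"

text \<open>The value is independent of the order of the two endpoints; see \<open>edge_prob_eq\<close> below.\<close>

definition edge_prob :: "nat \<Rightarrow> nat \<Rightarrow> real \<Rightarrow> (real \<Rightarrow> real) \<Rightarrow> nat \<Rightarrow> (nat \<Rightarrow> nat \<Rightarrow> int) set \<Rightarrow> real"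
  where "edge_prob L d \<theta> \<rho> n e =
    (THE p. \<exists>x\<in>hbox L d n. \<exists>y\<in>hbox L d n.
       e = {x, y} \<and> x \<noteq> y \<and> p = 1 - exp (- kappa_minus L d \<theta> \<rho> n x y))"

text \<open>A configuration maps each potential edge to whether it is present.\<close>

definition graph_pmf ::
  "nat \<Rightarrow> nat \<Rightarrow> real \<Rightarrow> (real \<Rightarrow> real) \<Rightarrow> nat \<Rightarrow> ((nat \<Rightarrow> nat \<Rightarrow> int) set \<Rightarrow> bool) pmf"
  where "graph_pmf L d \<theta> \<rho> n =
    Pi_pmf (pairs (hbox L d n)) False (\<lambda>e. bernoulli_pmf (edge_prob L d \<theta> \<rho> n e))"

definition connected_in :: "'v set \<Rightarrow> ('v set \<Rightarrow> bool) \<Rightarrow> 'v \<Rightarrow> 'v \<Rightarrow> bool"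
  where "connected_in V \<omega> x y \<longleftrightarrow>
    x \<in> V \<and> y \<in> V \<and> (x, y) \<in> {(u, v). {u, v} \<in> pairs V \<and> \<omega> {u, v}}\<^sup>*"

definition conn_prob ::
  "nat \<Rightarrow> nat \<Rightarrow> real \<Rightarrow> (real \<Rightarrow> real) \<Rightarrow> nat \<Rightarrow> (nat \<Rightarrow> nat \<Rightarrow> int) \<Rightarrow> (nat \<Rightarrow> nat \<Rightarrow> int) \<Rightarrow> real"
  where "conn_prob L d \<theta> \<rho> n x y =
    measure_pmf.prob (graph_pmf L d \<theta> \<rho> n) {\<omega>. connected_in (hbox L d n) \<omega> x y}"


section \<open>Asymptotic comparison\<close>

text \<open>The parameters \<open>L, d, A\<^sub>1, A\<^sub>2, \<alpha>\<close> are fixed outside, and \<open>R\<close> is the set \<open>kernels A\<^sub>1 A\<^sub>2 \<alpha>\<close>.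
  The quantifier order makes \<open>C\<close> uniform in \<open>\<theta> \<in> \<Theta>\<close>, and both \<open>C\<close> and \<open>n\<^sub>0\<close> uniform in the
  kernel \<open>\<rho> \<in> R\<close> and in the index \<open>i\<close>.\<close>

definition lesssim_unif ::
  "real set \<Rightarrow> (real \<Rightarrow> real) set \<Rightarrow> (nat \<Rightarrow> 'i set) \<Rightarrow>
   (real \<Rightarrow> (real \<Rightarrow> real) \<Rightarrow> nat \<Rightarrow> 'i \<Rightarrow> real) \<Rightarrow>
   (real \<Rightarrow> (real \<Rightarrow> real) \<Rightarrow> nat \<Rightarrow> 'i \<Rightarrow> real) \<Rightarrow> bool"
  where "lesssim_unif \<Theta> R I a b \<longleftrightarrow>
    (\<exists>C>0. \<forall>\<theta>\<in>\<Theta>. \<exists>n0\<ge>1. \<forall>\<rho>\<in>R. \<forall>n\<ge>n0. \<forall>i\<in>I n. a \<theta> \<rho> n i \<le> C * b \<theta> \<rho> n i)"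

definition asymp_unif ::
  "real set \<Rightarrow> (real \<Rightarrow> real) set \<Rightarrow> (nat \<Rightarrow> 'i set) \<Rightarrow>
   (real \<Rightarrow> (real \<Rightarrow> real) \<Rightarrow> nat \<Rightarrow> 'i \<Rightarrow> real) \<Rightarrow>
   (real \<Rightarrow> (real \<Rightarrow> real) \<Rightarrow> nat \<Rightarrow> 'i \<Rightarrow> real) \<Rightarrow> bool"
  where "asymp_unif \<Theta> R I a b \<longleftrightarrow> lesssim_unif \<Theta> R I a b \<and> lesssim_unif \<Theta> R I b a"

definition far_rate :: "nat \<Rightarrow> nat \<Rightarrow> real \<Rightarrow> real \<Rightarrow> nat \<Rightarrow> real"
  where "far_rate L d \<alpha> \<theta> n = real (card (hbox L d n)) powr (- ((real d + \<alpha> - \<theta>) / real d))"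

definition star_rate ::
  "nat \<Rightarrow> nat \<Rightarrow> real \<Rightarrow> real \<Rightarrow> (real \<Rightarrow> real) \<Rightarrow> nat \<Rightarrow> (nat \<Rightarrow> nat \<Rightarrow> int) \<Rightarrow> real"
  where "star_rate L d \<alpha> \<theta> \<rho> n x =
    (if hnorm L d x \<le> hdiam L d (hbox L d n) powr (2 - \<theta> * inverse \<alpha>)
     then inverse (zeta L d \<rho> n) * hnorm L d x powr (-\<alpha>)
     else far_rate L d \<alpha> \<theta> n)"

definition star_estimate ::
  "nat \<Rightarrow> nat \<Rightarrow> real \<Rightarrow> real \<Rightarrow> real \<Rightarrow> real set \<Rightarrow> bool"
  where "star_estimate L d A1 A2 \<alpha> \<Theta> \<longleftrightarrow>
    asymp_unif \<Theta> (kernels A1 A2 \<alpha>) (\<lambda>n. hbox L d n - {\<one>\<^bsub>hier_group L d\<^esub>})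
      (\<lambda>\<theta> \<rho> n x. conn_prob L d \<theta> \<rho> n \<one>\<^bsub>hier_group L d\<^esub> x)
      (\<lambda>\<theta> \<rho> n x. star_rate L d \<alpha> \<theta> \<rho> n x)"


section \<open>Well-definedness\<close>

lemma group_zmod_power [simp]: "group (zmod_power L d)"
  by (simp add: zmod_power_def)

lemma group_hier_group [simp]: "group (hier_group L d)"
  by (simp add: hier_group_def)

lemma carrier_zmod_power: "L \<ge> 1 \<Longrightarrow> carrier (zmod_power L d) = (\<Pi>\<^sub>E k\<in>{..<d}. {0..<int L})"
  by (simp add: zmod_power_def carrier_integer_mod_group)

lemma card_zmod_power: "L \<ge> 1 \<Longrightarrow> card (carrier (zmod_power L d)) = L ^ d"
  by (simp add: carrier_zmod_power card_PiE)

lemma one_hier_group: "\<one>\<^bsub>hier_group L d\<^esub> = (\<lambda>i\<in>{1..}. \<one>\<^bsub>zmod_power L d\<^esub>)"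
  by (simp add: hier_group_def)

lemma carrier_hier_group:
  "carrier (hier_group L d) =
   {x \<in> {1..} \<rightarrow>\<^sub>E carrier (zmod_power L d). finite {i \<in> {1..}. x i \<noteq> \<one>\<^bsub>zmod_power L d\<^esub>}}"
  by (simp add: hier_group_def carrier_sum_group)

lemma hnorm_le_iff:
  assumes L: "L \<ge> 2" and x: "x \<in> carrier (hier_group L d)"
  shows "hnorm L d x \<le> real L ^ n \<longleftrightarrow> (\<forall>i>n. x i = (\<one>\<^bsub>hier_group L d\<^esub>) i)"
proof (cases "x = \<one>\<^bsub>hier_group L d\<^esub>")
  case True
  then show ?thesis by (simp add: hnorm_def)
next
  case False
  let ?S = "{i. 1 \<le> i \<and> x i \<noteq> \<one>\<^bsub>zmod_power L d\<^esub>}"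
  have fin: "finite ?S" using x by (simp add: carrier_hier_group)
  have ne: "?S \<noteq> {}"
  proof
    assume "?S = {}"
    moreover have "x \<in> extensional {1..}" using x by (auto simp: carrier_hier_group PiE_iff)
    ultimately have "x = \<one>\<^bsub>hier_group L d\<^esub>"
      by (auto simp: one_hier_group extensional_def fun_eq_iff)
    with False show False by simp
  qed
  have "hnorm L d x \<le> real L ^ n \<longleftrightarrow> Max ?S \<le> n"
    using L False by (simp add: hnorm_def)
  also have "\<dots> \<longleftrightarrow> (\<forall>i\<in>?S. i \<le> n)" using fin ne by simp
  also have "\<dots> \<longleftrightarrow> (\<forall>i>n. 1 \<le> i \<longrightarrow> x i = \<one>\<^bsub>zmod_power L d\<^esub>)"
    by (metis (mono_tags, lifting) linorder_not_le mem_Collect_eq)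
  also have "\<dots> \<longleftrightarrow> (\<forall>i>n. x i = (\<one>\<^bsub>hier_group L d\<^esub>) i)"
    by (auto simp: one_hier_group)
  finally show ?thesis .
qed

lemma card_hbox:
  assumes L: "L \<ge> 2"
  shows "card (hbox L d n) = L ^ (n * d)" "finite (hbox L d n)"
proof -
  let ?C = "carrier (zmod_power L d)" and ?o = "\<one>\<^bsub>hier_group L d\<^esub>"
  let ?f = "\<lambda>x. restrict x {1..n}" and ?g = "\<lambda>y i. if i \<in> {1..n} then y i else ?o i"
  have o: "?o \<in> carrier (hier_group L d)" "\<one>\<^bsub>zmod_power L d\<^esub> \<in> ?C"
    using group.is_monoid[OF group_hier_group] group.is_monoid[OF group_zmod_power]
    by (auto intro: monoid.one_closed)
  have g: "?g y \<in> hbox L d n" if y: "y \<in> {1..n} \<rightarrow>\<^sub>E ?C" for y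
  proof -
    have "finite {i \<in> {1..}. ?g y i \<noteq> \<one>\<^bsub>zmod_power L d\<^esub>}"
      by (rule finite_subset[of _ "{1..n}"]) (auto simp: one_hier_group)
    moreover have "?g y \<in> {1..} \<rightarrow>\<^sub>E ?C"
      using y o(2) by (auto simp: one_hier_group PiE_iff extensional_def)
    ultimately have "?g y \<in> carrier (hier_group L d)" by (simp add: carrier_hier_group)
    then show ?thesis using hnorm_le_iff[OF L, of "?g y" d n] by (simp add: hbox_def)
  qed
  have bij: "bij_betw ?f (hbox L d n) ({1..n} \<rightarrow>\<^sub>E ?C)"
  proof (rule bij_betw_byWitness[where f' = ?g])
    show "\<forall>x\<in>hbox L d n. ?g (?f x) = x"
    proof (rule ballI, rule ext)
      fix x i assume x: "x \<in> hbox L d n"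
      then have xc: "x \<in> carrier (hier_group L d)" and "hnorm L d x \<le> real L ^ n"
        by (auto simp: hbox_def)
      then have "\<forall>i>n. x i = ?o i" using hnorm_le_iff[OF L xc] by simp
      moreover have "x 0 = ?o 0"
        using xc by (auto simp: carrier_hier_group one_hier_group PiE_iff extensional_def)
      ultimately show "?g (?f x) i = x i" by (cases "i = 0") auto
    qed
    show "\<forall>y\<in>{1..n} \<rightarrow>\<^sub>E ?C. ?f (?g y) = y"
      by (auto simp: fun_eq_iff PiE_iff extensional_def)
    show "?f ` hbox L d n \<subseteq> {1..n} \<rightarrow>\<^sub>E ?C"
      by (auto simp: hbox_def carrier_hier_group PiE_iff)
    show "?g ` ({1..n} \<rightarrow>\<^sub>E ?C) \<subseteq> hbox L d n" using g by blast
  qed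
  have C: "card ?C = L ^ d" using L by (simp add: card_zmod_power)
  have "finite ?C" using L by (simp add: carrier_zmod_power finite_PiE)
  then have "finite ({1..n} \<rightarrow>\<^sub>E ?C)" by (simp add: finite_PiE)
  then show "finite (hbox L d n)" using bij bij_betw_finite by blast
  show "card (hbox L d n) = L ^ (n * d)"
    using bij_betw_same_card[OF bij] C by (simp add: card_PiE power_mult[symmetric] mult.commute)
qed

lemma hnorm_inv:
  assumes "x \<in> carrier (hier_group L d)"
  shows "hnorm L d (inv\<^bsub>hier_group L d\<^esub> x) = hnorm L d x"
proof -
  interpret G: group "hier_group L d" by simp
  interpret Z: group "zmod_power L d" by simp
  have iv: "inv\<^bsub>hier_group L d\<^esub> x = (\<lambda>i\<in>{1..}. inv\<^bsub>zmod_power L d\<^esub> x i)"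
    using assms by (simp add: hier_group_def)
  have xi: "x i \<in> carrier (zmod_power L d)" if "1 \<le> i" for i
    using assms that by (auto simp: carrier_hier_group PiE_iff)
  have "inv\<^bsub>hier_group L d\<^esub> x = \<one>\<^bsub>hier_group L d\<^esub> \<longleftrightarrow> x = \<one>\<^bsub>hier_group L d\<^esub>"
    using assms by simp
  moreover have "{i. 1 \<le> i \<and> (inv\<^bsub>hier_group L d\<^esub> x) i \<noteq> \<one>\<^bsub>zmod_power L d\<^esub>} =
      {i. 1 \<le> i \<and> x i \<noteq> \<one>\<^bsub>zmod_power L d\<^esub>}"
    unfolding iv using xi by auto
  ultimately show ?thesis by (simp add: hnorm_def)
qed

lemma hdist_commute:
  assumes "x \<in> carrier (hier_group L d)" "y \<in> carrier (hier_group L d)"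
  shows "hdist L d x y = hdist L d y x"
proof -
  interpret G: group "hier_group L d" by simp
  have "inv\<^bsub>hier_group L d\<^esub> (x \<otimes>\<^bsub>hier_group L d\<^esub> inv\<^bsub>hier_group L d\<^esub> y)
      = y \<otimes>\<^bsub>hier_group L d\<^esub> inv\<^bsub>hier_group L d\<^esub> x"
    using assms by (simp add: G.inv_mult_group)
  then show ?thesis
    using hnorm_inv[of "x \<otimes>\<^bsub>hier_group L d\<^esub> inv\<^bsub>hier_group L d\<^esub> y" L d] assms
    by (simp add: hdist_def)
qed

lemma edge_prob_eq:
  assumes "x \<in> hbox L d n" "y \<in> hbox L d n" "x \<noteq> y"
  shows "edge_prob L d \<theta> \<rho> n {x, y} = 1 - exp (- kappa_minus L d \<theta> \<rho> n x y)"
proof -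
  have "kappa_minus L d \<theta> \<rho> n y x = kappa_minus L d \<theta> \<rho> n x y"
    using assms hdist_commute[of x L d y] by (simp add: kappa_minus_def hbox_def)
  then show ?thesis
    unfolding edge_prob_def using assms by (intro the_equality) (auto simp: doubleton_eq_iff)
qed

lemma hdiam_hbox:
  assumes L: "L \<ge> 2" and d: "d \<ge> 1" and n: "n \<ge> 1"
  shows "hdiam L d (hbox L d n) = real L ^ n"
proof -
  interpret G: group "hier_group L d" by simp
  interpret Z: group "zmod_power L d" by simp
  let ?o = "\<one>\<^bsub>hier_group L d\<^esub>"
  have le: "hdist L d x y \<le> real L ^ n" if "x \<in> hbox L d n" "y \<in> hbox L d n" for x y
  proof -
    have xy: "x \<in> carrier (hier_group L d)" "y \<in> carrier (hier_group L d)"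
      "\<forall>i>n. x i = ?o i" "\<forall>i>n. y i = ?o i"
      using that hnorm_le_iff[OF L] by (auto simp: hbox_def)
    have iv: "inv\<^bsub>hier_group L d\<^esub> y = (\<lambda>i\<in>{1..}. inv\<^bsub>zmod_power L d\<^esub> y i)"
      using xy by (simp add: hier_group_def)
    have m: "x \<otimes>\<^bsub>hier_group L d\<^esub> z = (\<lambda>i\<in>{1..}. x i \<otimes>\<^bsub>zmod_power L d\<^esub> z i)" for z
      by (simp add: hier_group_def)
    have "\<forall>i>n. (x \<otimes>\<^bsub>hier_group L d\<^esub> inv\<^bsub>hier_group L d\<^esub> y) i = ?o i"
      using xy by (simp add: m iv one_hier_group)
    then show ?thesis
      using xy hnorm_le_iff[OF L, of "x \<otimes>\<^bsub>hier_group L d\<^esub> inv\<^bsub>hier_group L d\<^esub> y" d n]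
      by (simp add: hdist_def)
  qed
  have "card {\<one>\<^bsub>zmod_power L d\<^esub>} < card (carrier (zmod_power L d))"
    using L d one_less_power[of L d] by (simp add: card_zmod_power)
  then obtain a where a: "a \<in> carrier (zmod_power L d)" "a \<noteq> \<one>\<^bsub>zmod_power L d\<^esub>"
    by (metis Z.one_closed card_mono finite.simps insert_subset leD singletonI subsetI)
  define x where "x = ?o(n := a)"
  have fin: "{i. 1 \<le> i \<and> x i \<noteq> \<one>\<^bsub>zmod_power L d\<^esub>} = {n}"
    using n a by (auto simp: x_def one_hier_group)
  have xc: "x \<in> carrier (hier_group L d)"
    using n a fin by (auto simp: carrier_hier_group x_def one_hier_group PiE_iff extensional_def)
  have "x \<noteq> ?o" using a n by (metis fun_upd_same x_def one_hier_group restrict_apply' atLeast_iff)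
  then have xn: "hnorm L d x = real L ^ n" using fin by (simp add: hnorm_def)
  have o: "?o \<in> hbox L d n" by (simp add: hbox_def hnorm_def)
  have "x \<in> hbox L d n" using xc xn by (simp add: hbox_def)
  moreover have "hdist L d x ?o = real L ^ n" using xc xn by (simp add: hdist_def)
  ultimately show ?thesis
    unfolding hdiam_def using o le by (intro cSup_eq_maximum) force+
qed

lemma zeta_ex1:
  assumes L: "L \<ge> 2" and d: "d \<ge> 1" and n: "n \<ge> 1" "real L ^ (n * d) > 2"
    and A: "0 < A1" and \<rho>: "\<rho> \<in> kernels A1 A2 \<alpha>"
  shows "\<exists>!z. z > 0 \<and>
       (real L ^ d - 1) * (\<Sum>i=1..n. real L ^ ((i - 1) * d) * exp (- (inverse z * \<rho> (real L ^ i))))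
       = real L ^ (n * d) - 2"
proof -
  define F where "F t = (real L ^ d - 1) *
    (\<Sum>i=1..n. real L ^ ((i - 1) * d) * exp (- (t * \<rho> (real L ^ i))))" for t
  have Ld: "real L ^ d > 1" using L d by (intro one_less_power) auto
  have pos: "\<rho> (real L ^ i) > 0" for i
  proof -
    have "real L ^ i \<ge> 1" using L by simp
    then have "A1 * (real L ^ i) powr (-\<alpha>) \<le> \<rho> (real L ^ i)" using \<rho> by (auto simp: kernels_def)
    moreover have "A1 * (real L ^ i) powr (-\<alpha>) > 0" using A L by simp
    ultimately show ?thesis by linarith
  qed
  have geo: "(real L ^ d - 1) * (\<Sum>i=1..m. real L ^ ((i - 1) * d)) = real L ^ (m * d) - 1" for m
    by (induction m) (auto simp: algebra_simps power_add)
  have F0: "F 0 = real L ^ (n * d) - 1" using geo by (simp add: F_def)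
  have mono: "F t < F s" if "s < t" for s t
    unfolding F_def using n that Ld pos L
    by (intro mult_strict_left_mono sum_strict_mono) auto
  have lim: "(F \<longlongrightarrow> (real L ^ d - 1) * (\<Sum>i=1..n. real L ^ ((i - 1) * d) * 0)) at_top"
    unfolding F_def
  proof (intro tendsto_intros)
    fix i
    have "filterlim (\<lambda>t. t * \<rho> (real L ^ i)) at_top at_top"
      using pos[of i] by (intro filterlim_at_top_mult_tendsto_pos[OF tendsto_const _ filterlim_ident])
    then show "((\<lambda>t. exp (- (t * \<rho> (real L ^ i)))) \<longlongrightarrow> 0) at_top"
      by (intro filterlim_compose[OF exp_at_bot]) (simp add: filterlim_uminus_at_bot)
  qed
  then have "eventually (\<lambda>t. F t < real L ^ (n * d) - 2) at_top"
    using n(2) by (intro order_tendstoD(2)) auto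
  then have "eventually (\<lambda>t. F t < real L ^ (n * d) - 2 \<and> t \<ge> 0) at_top"
    using eventually_ge_at_top[of 0] by (rule eventually_conj)
  then obtain T where T: "F T < real L ^ (n * d) - 2" "T \<ge> 0"
    by (auto dest: eventually_happens)
  have "continuous_on {0..T} F" unfolding F_def by (intro continuous_intros)
  then obtain t where t: "0 \<le> t" "F t = real L ^ (n * d) - 2"
    using IVT2'[of F T "real L ^ (n * d) - 2" 0] T F0 by auto
  have "t \<noteq> 0" using t F0 by auto
  with t have tp: "t > 0" by simp
  have inj: "s = t" if "F s = real L ^ (n * d) - 2" for s
    using mono[of s t] mono[of t s] that t by (metis less_irrefl linorder_neqE)
  show ?thesis
    unfolding F_def[symmetric]
  proof (rule ex1I[of _ "inverse t"])
    show "inverse t > 0 \<and> F (inverse (inverse t)) = real L ^ (n * d) - 2" using tp t by simp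
    fix z assume "z > 0 \<and> F (inverse z) = real L ^ (n * d) - 2"
    then show "z = inverse t" using inj[of "inverse z"] by (metis inverse_inverse_eq)
  qed
qed

end

theory Submission
  imports Defs
begin

text \<open>Write \<open>q = L ^ d\<close>, \<open>N = q ^ n\<close>, \<open>r = L powr (- \<alpha>)\<close>, and let \<open>t\<close> be the inverse of \<open>\<zeta>\<^sub>n\<close>. An edge of length
\<open>L ^ i\<close> is present with probability \<open>p\<close> of order \<open>t * r ^ i\<close>. The equation for \<open>\<zeta>\<^sub>n\<close> says that without the cutoff
every vertex has exactly one neighbour on average, and it forces \<open>t\<close> to be of order \<open>(q * r) ^ (- n)\<close>. The
cutoff lowers the mean degree to \<open>1 - \<epsilon>\<close> with \<open>\<epsilon>\<close> of order \<open>L powr (- n * (\<theta> - \<alpha>))\<close>. A cluster then looks like a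
subcritical branching process: it has about \<open>1 / \<epsilon>\<close> vertices on average, spread evenly over the box because a fixed
fraction of all edges has the maximal length. So \<open>0\<close> and \<open>x\<close> are connected either by a single edge, with
probability of order \<open>t * hnorm x powr (- \<alpha>)\<close>, or by a long path, with probability of order \<open>1 / (N * \<epsilon>)\<close>,
which is the far rate. In each of the four cases the stated rate is, up to constants, the larger of these two terms.

Upper bound. The connection probability \<open>\<tau>\<close> satisfies \<open>\<tau> \<le> 1 + p \<tau>\<close>, where \<open>1\<close> is the identity kernel, and
is therefore dominated by every \<open>h \<ge> 0\<close> with \<open>1 + p h \<le> h\<close> (lemma \<open>\<tau>_le_h\<close>). The function
\<open>h = 1 + C * t * hdist powr (- \<alpha>) + C / (N * \<epsilon>)\<close> has this property (lemma \<open>sum_p_h_le\<close>), because \<open>p\<close> acts on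
constants as \<open>1 - \<epsilon>\<close>, and on functions supported in smaller balls as a contraction with a factor bounded
away from \<open>1\<close>.

Lower bound. A single edge gives the first term. For the second one, the Bonferroni inequality over the
first edge of a path and a tree-graph inequality yield \<open>\<tau> \<ge> p \<tau> - k * (5 * S + 2 * k)\<close> off the diagonal
(lemma \<open>\<tau>_recursion\<close>), where \<open>k = h - 1\<close> and \<open>S\<close> bounds the bubble \<open>\<Sum>z. (k x z)\<^sup>2\<close>. Up to constants \<open>S\<close> is
\<open>t\<^sup>2 * (\<Sum>i\<le>n. (q * r\<^sup>2) ^ i) + 1 / (N * \<epsilon>\<^sup>2)\<close>. The conditions \<open>\<theta> < 2 * d - \<alpha>\<close> and \<open>\<theta> < \<alpha> + d / 3\<close>, which hold in all four
cases, say that \<open>S\<close> is much smaller than \<open>\<epsilon>\<close>. Summing the recursion over all vertices then shows that the mean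
cluster size is at least \<open>1 / (2 * \<epsilon>)\<close> (lemma \<open>susceptibility_ge\<close>), and evaluating it where \<open>\<tau>\<close> is minimal,
with all edge probabilities at least of order \<open>1 / N\<close>, turns this average into the pointwise bound
(lemma \<open>\<tau>_lower\<close>).

The percolation inequalities are proved by induction on the vertex set, deleting the starting vertex of a
path; the deleted edges are independent of what remains.\<close>

section \<open>Connectivity inside a vertex set\<close>

lemma doubleton_in_pairs [simp]: "{u, v} \<in> pairs A \<longleftrightarrow> u \<in> A \<and> v \<in> A \<and> u \<noteq> v"
  by (auto simp: pairs_def doubleton_eq_iff)

lemma finite_pairs: "finite A \<Longrightarrow> finite (pairs A)"
  by (rule finite_subset[of _ "Pow A"]) (auto simp: pairs_def)

lemma connected_in_refl: "x \<in> A \<Longrightarrow> connected_in A \<omega> x x"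
  by (simp add: connected_in_def)

lemma connected_in_sym: "connected_in A \<omega> x y \<Longrightarrow> connected_in A \<omega> y x"
proof -
  have "sym {(u, v). {u, v} \<in> pairs A \<and> \<omega> {u, v}}"
    by (auto simp: sym_def insert_commute)
  then show "connected_in A \<omega> x y \<Longrightarrow> connected_in A \<omega> y x"
    unfolding connected_in_def by (meson sym_rtrancl symD)
qed

lemma connected_in_commute: "connected_in A \<omega> x y \<longleftrightarrow> connected_in A \<omega> y x"
  by (meson connected_in_sym)

lemma connected_in_trans:
  "connected_in A \<omega> x y \<Longrightarrow> connected_in A \<omega> y z \<Longrightarrow> connected_in A \<omega> x z"
  unfolding connected_in_def by (meson rtrancl_trans)

lemma connected_in_edge:
  "x \<in> A \<Longrightarrow> y \<in> A \<Longrightarrow> x \<noteq> y \<Longrightarrow> \<omega> {x, y} \<Longrightarrow> connected_in A \<omega> x y"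
  by (auto simp: connected_in_def)

lemma connected_in_mono:
  assumes "connected_in A \<omega> x y" "A \<subseteq> B" shows "connected_in B \<omega> x y"
proof -
  have "{(u, v). {u, v} \<in> pairs A \<and> \<omega> {u, v}} \<subseteq> {(u, v). {u, v} \<in> pairs B \<and> \<omega> {u, v}}"
    using assms(2) by auto
  then show ?thesis
    using assms rtrancl_mono unfolding connected_in_def by blast
qed

lemma connected_in_cong:
  assumes "\<And>e. e \<in> pairs A \<Longrightarrow> \<omega> e = \<omega>' e"
  shows "connected_in A \<omega> x y = connected_in A \<omega>' x y"
proof -
  have "{(u, v). {u, v} \<in> pairs A \<and> \<omega> {u, v}} = {(u, v). {u, v} \<in> pairs A \<and> \<omega>' {u, v}}"
    using assms by blast
  then show ?thesis by (simp add: connected_in_def)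
qed

lemma connected_in_upd:
  assumes "a \<notin> A"
  shows "connected_in A (fun_upd \<omega> {a, w} b) x y = connected_in A \<omega> x y"
proof (rule connected_in_cong)
  fix e assume "e \<in> pairs A"
  with assms have "e \<noteq> {a, w}" by (metis doubleton_in_pairs)
  then show "(fun_upd \<omega> {a, w} b) e = \<omega> e" by simp
qed

text \<open>A connecting path may be assumed to visit its starting vertex only once. This is what
makes it possible to delete the starting vertex in inductions over the vertex set.\<close>

lemma connected_in_first_step:
  assumes "connected_in A \<omega> a x" "a \<noteq> x"
  obtains y where "y \<in> A - {a}" "\<omega> {a, y}" "connected_in (A - {a}) \<omega> y x"
proof -
  have a: "a \<in> A" using assms(1) by (simp add: connected_in_def)
  have "(a, x) \<in> {(u, v). {u, v} \<in> pairs A \<and> \<omega> {u, v}}\<^sup>*"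
    using assms(1) by (simp add: connected_in_def)
  then have "x = a \<or> (\<exists>y. y \<in> A - {a} \<and> \<omega> {a, y} \<and> connected_in (A - {a}) \<omega> y x)"
  proof (induction rule: rtrancl_induct)
    case base then show ?case by simp
  next
    case (step x z)
    then have xz: "x \<in> A" "z \<in> A" "x \<noteq> z" "\<omega> {x, z}" by auto
    show ?case
    proof (cases "z = a \<or> x = a")
      case True
      then show ?thesis using xz by (auto intro: connected_in_refl)
    next
      case False
      then obtain y where y: "y \<in> A - {a}" "\<omega> {a, y}" "connected_in (A - {a}) \<omega> y x"
        using step.IH by auto
      have "connected_in (A - {a}) \<omega> x z" using xz False by (intro connected_in_edge) auto
      then show ?thesis using y connected_in_trans by metis
    qed
  qed
  then show thesis using that assms(2) by auto
qed

lemma connected_in_avoid: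
  assumes "connected_in A \<omega> x c" "\<not> connected_in A \<omega> a x"
  shows "connected_in (A - {a}) \<omega> x c"
proof -
  have xA: "x \<in> A" and a: "a \<noteq> x" 
    using assms connected_in_refl by (auto simp: connected_in_def)
  have "(x, c) \<in> {(u, v). {u, v} \<in> pairs A \<and> \<omega> {u, v}}\<^sup>*"
    using assms(1) by (simp add: connected_in_def)
  then show ?thesis
  proof (induction rule: rtrancl_induct)
    case base then show ?case using xA a by (auto intro: connected_in_refl)
  next
    case (step y z)
    then have yz: "y \<in> A" "z \<in> A" "y \<noteq> z" "\<omega> {y, z}" by auto
    have "connected_in A \<omega> x y" using step.IH by (rule connected_in_mono) auto
    moreover have "connected_in A \<omega> y z" using yz by (intro connected_in_edge) auto
    ultimately have "connected_in A \<omega> x z" by (rule connected_in_trans)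
    then have "z \<noteq> a" using assms(2) connected_in_sym by metis
    moreover have "y \<noteq> a" using step.IH by (auto simp: connected_in_def)
    ultimately have "connected_in (A - {a}) \<omega> y z" using yz by (intro connected_in_edge) auto
    then show ?case using step.IH connected_in_trans by metis
  qed
qed

section \<open>Bernoulli percolation on a finite graph\<close>

text \<open>The second Bonferroni inequality; summing over ordered pairs counts each intersection twice,
which only weakens it.\<close>

lemma (in finite_measure) measure_UN_ge:
  assumes "finite I" "\<And>i. i \<in> I \<Longrightarrow> E i \<in> sets M"
  shows "(\<Sum>i\<in>I. measure M (E i)) - (\<Sum>i\<in>I. \<Sum>j\<in>I - {i}. measure M (E i \<inter> E j))
    \<le> measure M (\<Union>i\<in>I. E i)"
  using assms
proof (induction I rule: finite_induct)
  case empty then show ?case by simp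
next
  case (insert i I)
  let ?U = "\<Union>j\<in>I. E j"
  have U: "?U \<in> sets M" using insert by auto
  have Ei: "E i \<in> sets M" using insert by auto
  have "measure M (E i \<inter> ?U) = measure M (\<Union>j\<in>I. E i \<inter> E j)" by (simp only: Int_UN_distrib)
  also have "\<dots> \<le> (\<Sum>j\<in>I. measure M (E i \<inter> E j))"
    using insert by (intro finite_measure_subadditive_finite) auto
  finally have 1: "measure M (E i \<inter> ?U) \<le> (\<Sum>j\<in>I. measure M (E i \<inter> E j))" .
  have 2: "measure M (E i \<union> ?U) = measure M (E i) + measure M ?U - measure M (E i \<inter> ?U)"
    using measure_Un3[of "E i" M ?U] U Ei by (simp add: fmeasurable_eq_sets)
  have 3: "(\<Sum>j\<in>I. \<Sum>k\<in>insert i I - {j}. measure M (E j \<inter> E k)) \<ge>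
     (\<Sum>j\<in>I. \<Sum>k\<in>I - {j}. measure M (E j \<inter> E k))"
    using insert by (intro sum_mono sum_mono2) auto
  have 4: "insert i I - {i} = I" using insert by auto
  show ?case using 1 2 3 insert by (simp add: 4)
qed

lemma prob_Pi_bernoulli_edge:
  assumes fin: "finite E" and e: "e \<in> E" and pr: "0 \<le> pr e" "pr e \<le> 1"
    and Q: "\<And>\<omega> b. Q (fun_upd \<omega> e b) = Q \<omega>"
  shows "measure_pmf.prob (Pi_pmf E False (\<lambda>e. bernoulli_pmf (pr e))) {\<omega>. \<omega> e \<and> Q \<omega>} =
    pr e * measure_pmf.prob (Pi_pmf E False (\<lambda>e. bernoulli_pmf (pr e))) {\<omega>. Q \<omega>}"
proof -
  let ?M = "Pi_pmf E False (\<lambda>e. bernoulli_pmf (pr e))"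
  let ?N = "Pi_pmf (E - {e}) False (\<lambda>e. bernoulli_pmf (pr e))"
  let ?P = "pair_pmf (bernoulli_pmf (pr e)) ?N"
  \<comment> \<open>The product formula is applied to rectangles with countable sides, hence the restriction to the support.\<close>
  let ?X = "{\<omega>. Q \<omega>} \<inter> set_pmf ?N"
  have M: "?M = map_pmf (\<lambda>(y, f). fun_upd f e y) ?P"
    using Pi_pmf_insert[of "E - {e}" e False "\<lambda>e. bernoulli_pmf (pr e)"] fin e
    by (simp add: insert_absorb)
  have prod: "measure_pmf.prob ?P (A \<times> {\<omega>. Q \<omega>}) =
    measure_pmf.prob (bernoulli_pmf (pr e)) A * measure_pmf.prob ?N {\<omega>. Q \<omega>}" for A
  proof -
    have "measure_pmf.prob ?P (A \<times> {\<omega>. Q \<omega>}) = measure_pmf.prob ?P ((A \<times> {\<omega>. Q \<omega>}) \<inter> set_pmf ?P)"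
      by (rule measure_Int_set_pmf[symmetric])
    also have "\<dots> = measure_pmf.prob ?P ((A \<times> ?X) \<inter> set_pmf ?P)"
      by (rule arg_cong[where f = "measure_pmf.prob ?P"]) auto
    also have "\<dots> = measure_pmf.prob ?P (A \<times> ?X)"
      by (rule measure_Int_set_pmf)
    also have "\<dots> = measure_pmf.prob (bernoulli_pmf (pr e)) A * measure_pmf.prob ?N ?X"
      by (rule measure_pmf_prob_product) (auto simp: countable_Int2)
    finally show ?thesis by (simp add: measure_Int_set_pmf)
  qed
  have "measure_pmf.prob ?M {\<omega>. \<omega> e \<and> Q \<omega>} = measure_pmf.prob ?P ({True} \<times> {\<omega>. Q \<omega>})"
    unfolding M measure_map_pmf
    by (rule arg_cong[where f = "measure_pmf.prob ?P"]) (auto simp: Q)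
  moreover have "measure_pmf.prob ?M {\<omega>. Q \<omega>} = measure_pmf.prob ?P (UNIV \<times> {\<omega>. Q \<omega>})"
    unfolding M measure_map_pmf
    by (rule arg_cong[where f = "measure_pmf.prob ?P"]) (auto simp: Q)
  ultimately show ?thesis
    using pr unfolding prod by (simp add: measure_pmf_single)
qed

locale percolation =
  fixes V :: "'v set" and pr :: "'v set \<Rightarrow> real"
  assumes finite_V: "finite V"
    and pr_range: "e \<in> pairs V \<Longrightarrow> 0 \<le> pr e \<and> pr e \<le> 1"
begin

definition \<mu> :: "('v set \<Rightarrow> bool) pmf"
  where "\<mu> = Pi_pmf (pairs V) False (\<lambda>e. bernoulli_pmf (pr e))"

definition p :: "'v \<Rightarrow> 'v \<Rightarrow> real"
  where "p a b = (if a = b then 0 else pr {a, b})"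

definition \<tau> :: "'v set \<Rightarrow> 'v \<Rightarrow> 'v \<Rightarrow> real"
  where "\<tau> A a b = measure_pmf.prob \<mu> {\<omega>. connected_in A \<omega> a b}"

lemma p_nonneg: "a \<in> V \<Longrightarrow> b \<in> V \<Longrightarrow> 0 \<le> p a b"
  using pr_range by (auto simp: p_def)

lemma p_sym: "p a b = p b a"
  by (simp add: p_def insert_commute)

lemma prob_edge:
  assumes "a \<in> V" "y \<in> V" "a \<noteq> y" "\<And>\<omega> b. Q (fun_upd \<omega> {a, y} b) = Q \<omega>"
  shows "measure_pmf.prob \<mu> {\<omega>. \<omega> {a, y} \<and> Q \<omega>} = p a y * measure_pmf.prob \<mu> {\<omega>. Q \<omega>}"
  unfolding \<mu>_def using assms pr_range[of "{a, y}"] finite_pairs[OF finite_V]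
  by (subst prob_Pi_bernoulli_edge) (auto simp: p_def)

lemma \<tau>_nonneg: "0 \<le> \<tau> A a b" by (simp add: \<tau>_def)
lemma \<tau>_le_1: "\<tau> A a b \<le> 1" by (simp add: \<tau>_def)

lemma \<tau>_refl: "a \<in> A \<Longrightarrow> \<tau> A a a = 1"
  by (simp add: \<tau>_def connected_in_refl)

lemma \<tau>_edge:
  assumes "a \<in> V" "b \<in> V" shows "p a b \<le> \<tau> V a b"
proof (cases "a = b")
  case True then show ?thesis by (simp add: p_def \<tau>_nonneg)
next
  case False
  have "p a b = measure_pmf.prob \<mu> {\<omega>. \<omega> {a, b} \<and> True}"
    using prob_edge[of a b "\<lambda>_. True"] assms False by simp
  also have "\<dots> \<le> \<tau> V a b"
    unfolding \<tau>_def using assms False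
    by (intro measure_pmf.finite_measure_mono) (auto intro: connected_in_edge)
  finally show ?thesis .
qed

lemma prob_edge_connected:
  assumes "a \<in> V" "y \<in> V" "a \<noteq> y"
  shows "measure_pmf.prob \<mu> {\<omega>. \<omega> {a, y} \<and> connected_in (A - {a}) \<omega> y x} = p a y * \<tau> (A - {a}) y x"
  unfolding \<tau>_def using assms by (subst prob_edge) (auto simp: connected_in_upd)

end

section \<open>Majorants of the connection probability\<close>

text \<open>The assumption on \<open>h\<close> says that \<open>h\<close> is a supersolution of the equation
\<open>G = 1 + p G\<close> of the Green function of the kernel \<open>p\<close>. Every such \<open>h\<close> can replace the
Green function in the classical path-counting bounds.\<close>

locale percolation_majorant = percolation +
  fixes h :: "'a \<Rightarrow> 'a \<Rightarrow> real"
  assumes h_nonneg: "a \<in> V \<Longrightarrow> b \<in> V \<Longrightarrow> 0 \<le> h a b"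
    and h_sym: "a \<in> V \<Longrightarrow> b \<in> V \<Longrightarrow> h a b = h b a"
    and h_super: "a \<in> V \<Longrightarrow> b \<in> V \<Longrightarrow> (if a = b then 1 else 0) + (\<Sum>y\<in>V. p a y * h y b) \<le> h a b"
begin

definition ph :: "'a \<Rightarrow> 'a \<Rightarrow> real"
  where "ph a b = (\<Sum>y\<in>V. p a y * h y b)"

lemma ph_nonneg: "a \<in> V \<Longrightarrow> b \<in> V \<Longrightarrow> 0 \<le> ph a b"
  unfolding ph_def by (intro sum_nonneg mult_nonneg_nonneg p_nonneg h_nonneg)

lemma ph_le_h: "a \<in> V \<Longrightarrow> b \<in> V \<Longrightarrow> ph a b \<le> h a b"
  using h_super[of a b] by (simp add: ph_def split: if_splits)

lemma h_diag: "a \<in> V \<Longrightarrow> 1 \<le> h a a"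
  using h_super[of a a] ph_nonneg[of a a] by (simp add: ph_def)

lemma sum_le_ph:
  assumes "a \<in> V" "b \<in> V" "A \<subseteq> V"
  shows "(\<Sum>y\<in>A. p a y * h y b) \<le> ph a b"
  unfolding ph_def using assms finite_V
  by (intro sum_mono2) (auto intro!: mult_nonneg_nonneg p_nonneg h_nonneg)

text \<open>Union bound over the first edge of a path from \<open>a\<close>: that edge is independent of the
connection from its other end inside \<open>A - {a}\<close>, to which the induction hypothesis applies.\<close>

lemma \<tau>_le_h:
  assumes "A \<subseteq> V" "a \<in> V" "x \<in> V"
  shows "\<tau> A a x \<le> h a x"
proof -
  have "finite A" using assms finite_V finite_subset by blast
  then show ?thesis using assms
  proof (induction A arbitrary: a rule: finite_psubset_induct)
    case (psubset A)
    show ?case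
    proof (cases "a = x")
      case True
      then show ?thesis using h_diag[of a] psubset.prems \<tau>_le_1[of A a x] by simp
    next
      case ax: False
      show ?thesis
      proof (cases "a \<in> A")
        case False
        then have "\<tau> A a x = 0" by (simp add: \<tau>_def connected_in_def)
        then show ?thesis using h_nonneg psubset.prems by simp
      next
        case True
        have "\<tau> A a x \<le> measure_pmf.prob \<mu> (\<Union>y\<in>A - {a}. {\<omega>. \<omega> {a, y} \<and> connected_in (A - {a}) \<omega> y x})"
          unfolding \<tau>_def using ax
          by (intro measure_pmf.finite_measure_mono) (auto elim: connected_in_first_step)
        also have "\<dots> \<le> (\<Sum>y\<in>A - {a}. measure_pmf.prob \<mu> {\<omega>. \<omega> {a, y} \<and> connected_in (A - {a}) \<omega> y x})"
          using psubset.hyps by (intro measure_pmf.finite_measure_subadditive_finite) auto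
        also have "\<dots> = (\<Sum>y\<in>A - {a}. p a y * \<tau> (A - {a}) y x)"
          using psubset.prems by (intro sum.cong refl prob_edge_connected) auto
        also have "\<dots> \<le> (\<Sum>y\<in>A - {a}. p a y * h y x)"
          using psubset.prems True
          by (intro sum_mono mult_left_mono psubset.IH p_nonneg) auto
        also have "\<dots> \<le> ph a x" using psubset.prems by (intro sum_le_ph) auto
        also have "\<dots> \<le> h a x" using psubset.prems by (intro ph_le_h) auto
        finally show ?thesis .
      qed
    qed
  qed
qed

text \<open>Connections in different clusters use disjoint edges, so their probabilities multiply as in
the van den Berg--Kesten inequality. The induction again deletes \<open>a\<close>: since \<open>a'\<close> is not in the
cluster of \<open>a\<close>, its connection to \<open>c\<close> survives the deletion.\<close>

lemma disjoint_clusters_le: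
  assumes "A \<subseteq> V" "a \<in> V" "b \<in> V" "a' \<in> V" "c \<in> V"
  shows "measure_pmf.prob \<mu> {\<omega>. connected_in A \<omega> a b \<and> connected_in A \<omega> a' c \<and> \<not> connected_in A \<omega> a a'}
    \<le> h a b * h a' c"
proof -
  have "finite A" using assms finite_V finite_subset by blast
  then show ?thesis using assms
  proof (induction A arbitrary: a rule: finite_psubset_induct)
    case (psubset A)
    let ?D = "\<lambda>A \<omega> a. connected_in A \<omega> a b \<and> connected_in A \<omega> a' c \<and> \<not> connected_in A \<omega> a a'"
    show ?case
    proof (cases "a = b")
      case True
      have "measure_pmf.prob \<mu> {\<omega>. ?D A \<omega> a} \<le> \<tau> A a' c"
        unfolding \<tau>_def by (intro measure_pmf.finite_measure_mono) auto
      also have "\<dots> \<le> h a' c" using psubset.prems by (intro \<tau>_le_h) auto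
      also have "\<dots> \<le> h a b * h a' c"
        using h_diag[of a] h_nonneg[of a' c] psubset.prems True
          mult_right_mono[of 1 "h a b" "h a' c"] by simp
      finally show ?thesis .
    next
      case ab: False
      show ?thesis
      proof (cases "a \<in> A")
        case False
        then have "{\<omega>. ?D A \<omega> a} = {}" by (auto simp: connected_in_def)
        then have "measure_pmf.prob \<mu> {\<omega>. ?D A \<omega> a} = 0" by (simp only: measure_empty)
        then show ?thesis using h_nonneg psubset.prems by simp
      next
        case True
        have sub: "{\<omega>. ?D A \<omega> a} \<subseteq> (\<Union>y\<in>A - {a}. {\<omega>. \<omega> {a, y} \<and> ?D (A - {a}) \<omega> y})"
        proof
          fix \<omega> assume "\<omega> \<in> {\<omega>. ?D A \<omega> a}"
          then have D: "connected_in A \<omega> a b" "connected_in A \<omega> a' c" "\<not> connected_in A \<omega> a a'"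
            by auto
          obtain y where y: "y \<in> A - {a}" "\<omega> {a, y}" "connected_in (A - {a}) \<omega> y b"
            using connected_in_first_step[OF D(1) ab] .
          have "connected_in A \<omega> a y" using y True by (intro connected_in_edge) auto
          then have "\<not> connected_in (A - {a}) \<omega> y a'"
            using D(3) connected_in_trans[of A \<omega> a y a'] connected_in_mono[of "A - {a}" \<omega> y a' A] by auto
          then show "\<omega> \<in> (\<Union>y\<in>A - {a}. {\<omega>. \<omega> {a, y} \<and> ?D (A - {a}) \<omega> y})"
            using y connected_in_avoid[OF D(2,3)] by auto
        qed
        have "measure_pmf.prob \<mu> {\<omega>. ?D A \<omega> a} \<le>
            measure_pmf.prob \<mu> (\<Union>y\<in>A - {a}. {\<omega>. \<omega> {a, y} \<and> ?D (A - {a}) \<omega> y})"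
          by (intro measure_pmf.finite_measure_mono sub) auto
        also have "\<dots> \<le> (\<Sum>y\<in>A - {a}. measure_pmf.prob \<mu> {\<omega>. \<omega> {a, y} \<and> ?D (A - {a}) \<omega> y})"
          using psubset.hyps by (intro measure_pmf.finite_measure_subadditive_finite) auto
        also have "\<dots> = (\<Sum>y\<in>A - {a}. p a y * measure_pmf.prob \<mu> {\<omega>. ?D (A - {a}) \<omega> y})"
          using psubset.prems by (intro sum.cong refl prob_edge) (auto simp: connected_in_upd)
        also have "\<dots> \<le> (\<Sum>y\<in>A - {a}. p a y * (h y b * h a' c))"
          using psubset.prems True
          by (intro sum_mono mult_left_mono psubset.IH p_nonneg) auto
        also have "\<dots> = (\<Sum>y\<in>A - {a}. p a y * h y b) * h a' c"
          by (simp add: sum_distrib_right mult.assoc)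
        also have "\<dots> \<le> h a b * h a' c"
          using psubset.prems 
          by (intro mult_right_mono h_nonneg order_trans[OF sum_le_ph ph_le_h]) auto
        finally show ?thesis .
      qed
    qed
  qed
qed

text \<open>The tree-graph inequality: paths from \<open>a\<close> to \<open>b\<close> and to \<open>c\<close> separate at some vertex
\<open>z\<close>. If both can start with the same edge, the branching point moves on and the induction
hypothesis applies; otherwise they separate at \<open>a\<close> itself and lie in different clusters of
\<open>A - {a}\<close>. The supersolution property adds the two contributions up to one sum over \<open>z\<close>.\<close>

lemma tree_graph_le:
  assumes "A \<subseteq> V" "a \<in> V" "b \<in> V" "c \<in> V"
  shows "measure_pmf.prob \<mu> {\<omega>. connected_in A \<omega> a b \<and> connected_in A \<omega> a c}
    \<le> (\<Sum>z\<in>V. h a z * h b z * h c z)"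
proof -
  have "finite A" using assms finite_V finite_subset by blast
  then show ?thesis using assms
  proof (induction A arbitrary: a rule: finite_psubset_induct)
    case (psubset A)
    let ?T = "\<lambda>A \<omega> a. connected_in A \<omega> a b \<and> connected_in A \<omega> a c"
    let ?D = "\<lambda>A \<omega> y y'. connected_in A \<omega> y b \<and> connected_in A \<omega> y' c \<and> \<not> connected_in A \<omega> y y'"
    have trm: "h a a * h b a * h c a \<le> (\<Sum>z\<in>V. h a z * h b z * h c z)"
      using psubset.prems finite_V
      by (intro member_le_sum[of a V "\<lambda>z. h a z * h b z * h c z"]) (auto intro!: mult_nonneg_nonneg h_nonneg)
    consider "a = b" | "a = c" | "a \<noteq> b" "a \<noteq> c" "a \<notin> A" | "a \<noteq> b" "a \<noteq> c" "a \<in> A" by blast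
    then show ?case
    proof cases
      case 1
      have "measure_pmf.prob \<mu> {\<omega>. ?T A \<omega> a} \<le> \<tau> A a c"
        unfolding \<tau>_def by (intro measure_pmf.finite_measure_mono) auto
      also have "\<dots> \<le> h a c" using psubset.prems by (intro \<tau>_le_h) auto
      also have "\<dots> \<le> h a a * h b a * h c a"
        using h_diag[of a] h_nonneg[of a c] psubset.prems 1 h_sym[of a c]
          mult_right_mono[of 1 "h a a * h b a" "h a c"] mult_mono[of 1 "h a a" 1 "h a a"] by simp
      finally show ?thesis using trm by simp
    next
      case 2
      have "measure_pmf.prob \<mu> {\<omega>. ?T A \<omega> a} \<le> \<tau> A a b"
        unfolding \<tau>_def by (intro measure_pmf.finite_measure_mono) auto
      also have "\<dots> \<le> h a b" using psubset.prems by (intro \<tau>_le_h) auto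
      also have "\<dots> \<le> h a a * h b a * h c a"
        using h_diag[of a] h_nonneg[of a b] psubset.prems 2 h_sym[of a b]
          mult_right_mono[of 1 "h a a * h c a" "h a b"] mult_mono[of 1 "h a a" 1 "h a a"]
        by (simp add: mult_ac)
      finally show ?thesis using trm by simp
    next
      case 3
      then have "{\<omega>. ?T A \<omega> a} = {}" by (auto simp: connected_in_def)
      then have "measure_pmf.prob \<mu> {\<omega>. ?T A \<omega> a} = 0" by (simp only: measure_empty)
      then show ?thesis using h_nonneg psubset.prems by (auto intro!: sum_nonneg mult_nonneg_nonneg)
    next
      case 4
      let ?U1 = "\<Union>y\<in>A - {a}. {\<omega>. \<omega> {a, y} \<and> ?T (A - {a}) \<omega> y}"
      let ?U2 = "\<Union>(y, y')\<in>{(y, y'). y \<in> A - {a} \<and> y' \<in> A - {a} \<and> y \<noteq> y'}.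
        {\<omega>. \<omega> {a, y} \<and> \<omega> {a, y'} \<and> ?D (A - {a}) \<omega> y y'}"
      have fin: "finite {(y, y'). y \<in> A - {a} \<and> y' \<in> A - {a} \<and> y \<noteq> y'}"
        using psubset.hyps by (rule_tac finite_subset[of _ "A \<times> A"]) auto
      have sub: "{\<omega>. ?T A \<omega> a} \<subseteq> ?U1 \<union> ?U2"
      proof
        fix \<omega> assume "\<omega> \<in> {\<omega>. ?T A \<omega> a}"
        then have D: "connected_in A \<omega> a b" "connected_in A \<omega> a c" by auto
        obtain y where y: "y \<in> A - {a}" "\<omega> {a, y}" "connected_in (A - {a}) \<omega> y b"
          using connected_in_first_step[OF D(1)] 4 by blast
        obtain y' where y': "y' \<in> A - {a}" "\<omega> {a, y'}" "connected_in (A - {a}) \<omega> y' c"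
          using connected_in_first_step[OF D(2)] 4 by blast
        show "\<omega> \<in> ?U1 \<union> ?U2"
        proof (cases "connected_in (A - {a}) \<omega> y y'")
          case True
          then have "connected_in (A - {a}) \<omega> y c" using y' connected_in_trans by metis
          then show ?thesis using y by auto
        next
          case False
          then have "y \<noteq> y'" using y(1) connected_in_refl by metis
          then show ?thesis using y y' False by auto
        qed
      qed
      have U1: "measure_pmf.prob \<mu> ?U1 \<le> (\<Sum>z\<in>V. ph a z * h b z * h c z)"
      proof -
        have "measure_pmf.prob \<mu> ?U1 \<le> (\<Sum>y\<in>A - {a}. measure_pmf.prob \<mu> {\<omega>. \<omega> {a, y} \<and> ?T (A - {a}) \<omega> y})"
          using psubset.hyps by (intro measure_pmf.finite_measure_subadditive_finite) auto
        also have "\<dots> = (\<Sum>y\<in>A - {a}. p a y * measure_pmf.prob \<mu> {\<omega>. ?T (A - {a}) \<omega> y})"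
          using psubset.prems by (intro sum.cong refl prob_edge) (auto simp: connected_in_upd)
        also have "\<dots> \<le> (\<Sum>y\<in>A - {a}. p a y * (\<Sum>z\<in>V. h y z * h b z * h c z))"
          using psubset.prems 4
          by (intro sum_mono mult_left_mono psubset.IH p_nonneg) auto
        also have "\<dots> \<le> (\<Sum>y\<in>V. p a y * (\<Sum>z\<in>V. h y z * h b z * h c z))"
          using psubset.prems finite_V
          by (intro sum_mono2) (auto intro!: mult_nonneg_nonneg sum_nonneg p_nonneg h_nonneg)
        also have "\<dots> = (\<Sum>z\<in>V. ph a z * h b z * h c z)"
          unfolding ph_def sum_distrib_left sum_distrib_right
          by (subst sum.swap) (simp add: mult_ac)
        finally show ?thesis .
      qed
      have U2: "measure_pmf.prob \<mu> ?U2 \<le> ph a b * ph a c"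
      proof -
        have "measure_pmf.prob \<mu> ?U2 \<le> (\<Sum>(y, y')\<in>{(y, y'). y \<in> A - {a} \<and> y' \<in> A - {a} \<and> y \<noteq> y'}.
            measure_pmf.prob \<mu> {\<omega>. \<omega> {a, y} \<and> \<omega> {a, y'} \<and> ?D (A - {a}) \<omega> y y'})"
          using fin by (intro order_trans[OF measure_pmf.finite_measure_subadditive_finite])
             (auto simp: case_prod_unfold)
        also have "\<dots> \<le> (\<Sum>(y, y')\<in>{(y, y'). y \<in> A - {a} \<and> y' \<in> A - {a} \<and> y \<noteq> y'}.
            (p a y * h y b) * (p a y' * h y' c))"
        proof (intro sum_mono)
          fix v assume "v \<in> {(y, y'). y \<in> A - {a} \<and> y' \<in> A - {a} \<and> y \<noteq> y'}"
          then obtain y y' where v: "v = (y, y')" and yy: "y \<in> A" "y' \<in> A" "y \<noteq> y'" 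
            and nin: "y \<noteq> a" "y' \<noteq> a" by auto
          have "measure_pmf.prob \<mu> {\<omega>. \<omega> {a, y} \<and> (\<omega> {a, y'} \<and> ?D (A - {a}) \<omega> y y')} =
            p a y * measure_pmf.prob \<mu> {\<omega>. \<omega> {a, y'} \<and> ?D (A - {a}) \<omega> y y'}"
            using yy nin psubset.prems
            by (intro prob_edge) (auto simp: connected_in_upd doubleton_eq_iff)
          also have "measure_pmf.prob \<mu> {\<omega>. \<omega> {a, y'} \<and> ?D (A - {a}) \<omega> y y'} =
            p a y' * measure_pmf.prob \<mu> {\<omega>. ?D (A - {a}) \<omega> y y'}"
            using yy nin psubset.prems
            by (intro prob_edge) (auto simp: connected_in_upd doubleton_eq_iff)
          also have "p a y * (p a y' * measure_pmf.prob \<mu> {\<omega>. ?D (A - {a}) \<omega> y y'}) \<le>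
            p a y * (p a y' * (h y b * h y' c))"
            using yy nin psubset.prems
            by (intro mult_left_mono disjoint_clusters_le p_nonneg) auto
          finally show "(case v of (y, y') \<Rightarrow>
              measure_pmf.prob \<mu> {\<omega>. \<omega> {a, y} \<and> \<omega> {a, y'} \<and> ?D (A - {a}) \<omega> y y'})
            \<le> (case v of (y, y') \<Rightarrow> (p a y * h y b) * (p a y' * h y' c))"
            unfolding v by (simp add: mult_ac)
        qed
        also have "\<dots> \<le> (\<Sum>(y, y')\<in>V \<times> V. (p a y * h y b) * (p a y' * h y' c))"
          using psubset.prems finite_V
          by (intro sum_mono2) (auto intro!: mult_nonneg_nonneg p_nonneg h_nonneg)
        also have "\<dots> = ph a b * ph a c"
          unfolding ph_def sum_product by (simp add: sum.cartesian_product)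
        finally show ?thesis .
      qed
      have "measure_pmf.prob \<mu> {\<omega>. ?T A \<omega> a} \<le> measure_pmf.prob \<mu> (?U1 \<union> ?U2)"
        by (intro measure_pmf.finite_measure_mono sub) auto
      also have "\<dots> \<le> measure_pmf.prob \<mu> ?U1 + measure_pmf.prob \<mu> ?U2"
        by (intro measure_Un_le) auto
      also have "\<dots> \<le> (\<Sum>z\<in>V. ph a z * h b z * h c z) + h b a * h c a"
        using U1 U2 psubset.prems ph_le_h[of a b] ph_le_h[of a c] h_sym[of a b] h_sym[of a c]
          mult_mono[of "ph a b" "h b a" "ph a c" "h c a"] ph_nonneg[of a c] h_nonneg[of b a] by simp
      also have "\<dots> = (\<Sum>z\<in>V. ((if a = z then 1 else 0) + ph a z) * h b z * h c z)"
        using finite_V psubset.prems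
        by (simp add: distrib_right sum.distrib if_distrib[of "\<lambda>u. u * _"] cong: if_cong)
      also have "\<dots> \<le> (\<Sum>z\<in>V. h a z * h b z * h c z)"
        using psubset.prems h_super unfolding ph_def
        by (intro sum_mono mult_right_mono h_nonneg) auto
      finally show ?thesis .
    qed
  qed
qed

text \<open>The reverse of the union bound over the first edge. Two corrections appear, and the tree-graph
inequality bounds both: connections from \<open>y\<close> to \<open>x\<close> that pass through \<open>a\<close> (first sum), and pairs of
first edges that both lead to \<open>x\<close> (second sum, from the Bonferroni inequality).\<close>

lemma \<tau>_ge:
  assumes a: "a \<in> V" and x: "x \<in> V" and ax: "a \<noteq> x"
  shows "\<tau> V a x \<ge> (\<Sum>y\<in>V. p a y * \<tau> V y x)
    - (\<Sum>z\<in>V. ph a z * h a z * h x z) - (\<Sum>z\<in>V. (ph a z)\<^sup>2 * h x z)"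
proof -
  define E where "E y = {\<omega>. \<omega> {a, y} \<and> connected_in (V - {a}) \<omega> y x}" for y
  let ?I = "V - {a}"
  have UN: "(\<Union>y\<in>?I. E y) \<subseteq> {\<omega>. connected_in V \<omega> a x}"
  proof (clarsimp simp: E_def)
    fix \<omega> y assume "y \<in> V" "y \<noteq> a" "\<omega> {a, y}" "connected_in (V - {a}) \<omega> y x"
    then show "connected_in V \<omega> a x"
      using connected_in_edge[of a V y \<omega>] a connected_in_mono[of "V - {a}" \<omega> y x V]
        connected_in_trans[of V \<omega> a y x] by auto
  qed
  have single: "measure_pmf.prob \<mu> (E y) \<ge> p a y * \<tau> V y x - p a y * (\<Sum>z\<in>V. h y z * h a z * h x z)"
    if y: "y \<in> ?I" for y
  proof -
    have "\<tau> V y x \<le> measure_pmf.prob \<mu> ({\<omega>. connected_in (V - {a}) \<omega> y x} \<union>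
        {\<omega>. connected_in V \<omega> y a \<and> connected_in V \<omega> y x})"
      unfolding \<tau>_def using connected_in_avoid[of V _ y x a] connected_in_sym[of V _ a y]
      by (intro measure_pmf.finite_measure_mono) auto
    also have "\<dots> \<le> \<tau> (V - {a}) y x +
        measure_pmf.prob \<mu> {\<omega>. connected_in V \<omega> y a \<and> connected_in V \<omega> y x}"
      unfolding \<tau>_def by (intro measure_Un_le) auto
    also have "\<dots> \<le> \<tau> (V - {a}) y x + (\<Sum>z\<in>V. h y z * h a z * h x z)"
      using y a x by (intro add_left_mono tree_graph_le) auto
    finally have "p a y * \<tau> V y x \<le> p a y * (\<tau> (V - {a}) y x + (\<Sum>z\<in>V. h y z * h a z * h x z))"
      using y a by (intro mult_left_mono p_nonneg) auto
    then show ?thesis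
      unfolding E_def using y a by (subst prob_edge_connected) (auto simp: algebra_simps)
  qed
  have double: "measure_pmf.prob \<mu> (E y \<inter> E y') \<le> p a y * p a y' * (\<Sum>z\<in>V. h x z * h y z * h y' z)"
    if y: "y \<in> ?I" "y' \<in> ?I - {y}" for y y'
  proof -
    let ?T = "\<lambda>\<omega>. connected_in (V - {a}) \<omega> y x \<and> connected_in (V - {a}) \<omega> y' x"
    have "E y \<inter> E y' = {\<omega>. \<omega> {a, y} \<and> (\<omega> {a, y'} \<and> ?T \<omega>)}"
      by (auto simp: E_def)
    then have "measure_pmf.prob \<mu> (E y \<inter> E y') = p a y * measure_pmf.prob \<mu> {\<omega>. \<omega> {a, y'} \<and> ?T \<omega>}"
      using y a by (simp, intro prob_edge) (auto simp: connected_in_upd doubleton_eq_iff)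
    also have "measure_pmf.prob \<mu> {\<omega>. \<omega> {a, y'} \<and> ?T \<omega>} = p a y' * measure_pmf.prob \<mu> {\<omega>. ?T \<omega>}"
      using y a by (intro prob_edge) (auto simp: connected_in_upd doubleton_eq_iff)
    also have "{\<omega>. ?T \<omega>} = {\<omega>. connected_in (V - {a}) \<omega> x y \<and> connected_in (V - {a}) \<omega> x y'}"
      by (simp only: connected_in_commute[of _ _ x])
    finally have *: "measure_pmf.prob \<mu> (E y \<inter> E y') = p a y * (p a y' *
        measure_pmf.prob \<mu> {\<omega>. connected_in (V - {a}) \<omega> x y \<and> connected_in (V - {a}) \<omega> x y'})" .
    show ?thesis unfolding * mult.assoc[of "p a y"]
      using y a x by (intro mult_left_mono tree_graph_le p_nonneg) auto
  qed
  have "(\<Sum>y\<in>?I. \<Sum>y'\<in>?I - {y}. measure_pmf.prob \<mu> (E y \<inter> E y')) \<le>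
      (\<Sum>y\<in>?I. \<Sum>y'\<in>?I - {y}. p a y * p a y' * (\<Sum>z\<in>V. h x z * h y z * h y' z))"
    using double by (intro sum_mono) auto
  also have "\<dots> \<le> (\<Sum>y\<in>V. \<Sum>y'\<in>V. p a y * p a y' * (\<Sum>z\<in>V. h x z * h y z * h y' z))"
  proof -
    have "(\<Sum>y\<in>?I. \<Sum>y'\<in>?I - {y}. p a y * p a y' * (\<Sum>z\<in>V. h x z * h y z * h y' z)) \<le>
      (\<Sum>y\<in>?I. \<Sum>y'\<in>V. p a y * p a y' * (\<Sum>z\<in>V. h x z * h y z * h y' z))"
      using finite_V a x
      by (intro sum_mono sum_mono2) (auto intro!: mult_nonneg_nonneg sum_nonneg p_nonneg h_nonneg)
    also have "\<dots> \<le> (\<Sum>y\<in>V. \<Sum>y'\<in>V. p a y * p a y' * (\<Sum>z\<in>V. h x z * h y z * h y' z))"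
      using finite_V a x
      by (intro sum_mono2) (auto intro!: mult_nonneg_nonneg sum_nonneg p_nonneg h_nonneg)
    finally show ?thesis .
  qed
  also have "\<dots> = (\<Sum>y\<in>V. \<Sum>y'\<in>V. \<Sum>z\<in>V. (p a y * h y z) * (p a y' * h y' z) * h x z)"
    by (simp add: sum_distrib_left mult_ac)
  also have "\<dots> = (\<Sum>y\<in>V. \<Sum>z\<in>V. \<Sum>y'\<in>V. (p a y * h y z) * (p a y' * h y' z) * h x z)"
    by (intro sum.cong refl sum.swap)
  also have "\<dots> = (\<Sum>z\<in>V. \<Sum>y\<in>V. \<Sum>y'\<in>V. (p a y * h y z) * (p a y' * h y' z) * h x z)"
    by (rule sum.swap)
  also have "\<dots> = (\<Sum>z\<in>V. (ph a z)\<^sup>2 * h x z)"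
    unfolding ph_def power2_eq_square sum_product by (simp only: sum_distrib_right)
  finally have d: "(\<Sum>y\<in>?I. \<Sum>y'\<in>?I - {y}. measure_pmf.prob \<mu> (E y \<inter> E y')) \<le> (\<Sum>z\<in>V. (ph a z)\<^sup>2 * h x z)" .
  have "(\<Sum>z\<in>V. ph a z * h a z * h x z) = (\<Sum>z\<in>V. \<Sum>y\<in>V. p a y * (h y z * h a z * h x z))"
    unfolding ph_def by (simp only: sum_distrib_right mult.assoc)
  also have "\<dots> = (\<Sum>y\<in>V. p a y * (\<Sum>z\<in>V. h y z * h a z * h x z))"
    unfolding sum_distrib_left by (rule sum.swap)
  finally have "(\<Sum>y\<in>V. p a y * \<tau> V y x) - (\<Sum>z\<in>V. ph a z * h a z * h x z) =
     (\<Sum>y\<in>V. p a y * \<tau> V y x - p a y * (\<Sum>z\<in>V. h y z * h a z * h x z))"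
    by (simp add: sum_subtractf)
  also have "\<dots> = (\<Sum>y\<in>?I. p a y * \<tau> V y x - p a y * (\<Sum>z\<in>V. h y z * h a z * h x z))"
    using finite_V a by (simp add: sum.remove[of V a] p_def)
  also have "\<dots> \<le> (\<Sum>y\<in>?I. measure_pmf.prob \<mu> (E y))"
    using single by (intro sum_mono) auto
  finally have s: "(\<Sum>y\<in>V. p a y * \<tau> V y x) - (\<Sum>z\<in>V. ph a z * h a z * h x z) \<le> (\<Sum>y\<in>?I. measure_pmf.prob \<mu> (E y))" .
  have "(\<Sum>y\<in>?I. measure_pmf.prob \<mu> (E y)) - (\<Sum>y\<in>?I. \<Sum>y'\<in>?I - {y}. measure_pmf.prob \<mu> (E y \<inter> E y'))
    \<le> measure_pmf.prob \<mu> (\<Union>y\<in>?I. E y)"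
    using finite_V by (intro measure_pmf.measure_UN_ge) auto
  also have "\<dots> \<le> \<tau> V a x" unfolding \<tau>_def using UN by (intro measure_pmf.finite_measure_mono) auto
  finally show ?thesis using s d by linarith
qed

end

section \<open>Constants\<close>

text \<open>Constants are collected in a locale of their own, because they must be chosen before the
volume: they depend on the branching number \<open>q\<close>, the decay \<open>r\<close> per level, and the constants
\<open>A, c\<^sub>1, c\<^sub>2, C\<^sub>2\<close> of the two-sided bounds on edge probabilities and on the rate \<open>t\<close>.\<close>

locale hierarchical_constants =
  fixes q :: nat and r A c\<^sub>1 c\<^sub>2 C\<^sub>2 :: real
  assumes q2: "2 \<le> q"
    and r: "0 < r" "r < 1" "1 < q * r"
    and const_pos: "0 < A" "0 < c\<^sub>1" "0 < c\<^sub>2" "0 < C\<^sub>2"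
begin

abbreviation s :: real where "s \<equiv> real q * r"


lemma s1: "1 < s" using r by simp

definition c :: real where "c = c\<^sub>1 * c\<^sub>2 / 2"

lemma c_pos: "0 < c" using const_pos by (simp add: c_def)

text \<open>At the levels within \<open>top_levels\<close> of the top, the direct-edge
profile \<open>t * r ^ i\<close> is comparable to the inverse volume; there an error is charged to the constant part
of the majorant, below them to the part that decays with the level.\<close>

definition top_levels :: nat where "top_levels = (LEAST k. 1 \<le> k \<and> 2 * A * C\<^sub>2 / ((s - 1) * c) \<le> s ^ k)"

lemma top_levels_bound: "1 \<le> top_levels" "2 * A * C\<^sub>2 / ((s - 1) * c) \<le> s ^ top_levels"
proof -
  obtain k where k: "2 * A * C\<^sub>2 / ((s - 1) * c) < s ^ k" using real_arch_pow[OF s1] by blast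
  have "s ^ k \<le> s ^ Suc k" using s1 by simp
  then have "1 \<le> Suc k \<and> 2 * A * C\<^sub>2 / ((s - 1) * c) \<le> s ^ Suc k" using k by linarith
  then show "1 \<le> top_levels" "2 * A * C\<^sub>2 / ((s - 1) * c) \<le> s ^ top_levels"
    unfolding top_levels_def by (rule LeastI2, simp)+
qed

text \<open>The majorant constructed below has a part decaying with the level, with coefficient
\<open>near_coeff\<close>, and a constant part \<open>B / (N * \<epsilon>)\<close>; \<open>D / N\<close> bounds what the kernel sends back from smaller balls to
points near the top level.\<close>

definition near_coeff :: real where "near_coeff = 2 * A / c"
definition D :: real where "D = A * C\<^sub>2 * (1 / r) ^ top_levels * (C\<^sub>2 / (s - 1))"
definition B :: real where "B = A * C\<^sub>2 + near_coeff * D"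

lemma near_coeff_pos: "0 < near_coeff" using const_pos c_pos by (simp add: near_coeff_def)
lemma D_pos: "0 < D" using const_pos r by (simp add: D_def)
lemma B_pos: "0 < B" using const_pos near_coeff_pos D_pos by (simp add: B_def add_pos_pos)

definition C_sum :: real where "C_sum = near_coeff / (1 - r) * (C\<^sub>2 * (s / (s - 1))) + 2 * B"

lemma C_sum_pos: "0 < C_sum"
  using near_coeff_pos r const_pos B_pos s1 by (simp add: C_sum_def add_nonneg_pos)

definition C_min :: real where "C_min = near_coeff / ((1 - r) * c\<^sub>1) + B"
text \<open>The second entry makes the error in the recursion for the mean cluster size at most \<open>1 / 2\<close>,
the third one makes the error at a minimum of the connection probability at most half of the main term.\<close>

definition err_tol :: real where
  "err_tol = min 1 (min (1 / (2 * (3 + 5 * C_sum))) (c\<^sub>1 * c\<^sub>2 / (4 * (C_min * (5 + 2 * C_min)))))"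
definition c_far :: real where "c_far = c\<^sub>1 * c\<^sub>2 / (4 * (1 + c\<^sub>1 * c\<^sub>2))"

lemma C_min_pos: "0 < C_min"
  using near_coeff_pos r const_pos B_pos by (simp add: C_min_def add_nonneg_pos)

lemma err_tol_pos: "0 < err_tol"
  using C_sum_pos C_min_pos const_pos by (simp add: err_tol_def)

lemma c_far_pos: "0 < c_far"
  using const_pos by (simp add: c_far_def add_pos_pos)

lemma c_far_le_1: "c_far \<le> 1"
proof -
  have "0 < c\<^sub>1 * c\<^sub>2" using const_pos by simp
  then show ?thesis by (simp add: c_far_def)
qed

definition C_bub :: real where "C_bub = 2 * (near_coeff / (1 - r))\<^sup>2 + 4 * B\<^sup>2"
definition \<delta> :: real where "\<delta> = err_tol / (1 + 2 * C_bub)"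

lemma C_bub_nonneg: "0 \<le> C_bub" by (simp add: C_bub_def)

lemma \<delta>_pos: "0 < \<delta>" using C_bub_nonneg err_tol_pos by (simp add: \<delta>_def)

end

section \<open>Percolation with an ultrametric kernel\<close>

text \<open>Vertices form an ultrametric space whose balls of level \<open>j\<close> have \<open>q ^ j\<close> points, and
edge probabilities \<open>P i\<close> depend only on the level \<open>i\<close>, being of order \<open>t * r ^ i\<close> with \<open>t\<close> of order
\<open>(q * r) ^ (- n)\<close>. The mean number of neighbours is \<open>1 - \<epsilon>\<close>.\<close>

locale hierarchical_percolation =
  percolation V pr + hierarchical_constants q r A c\<^sub>1 c\<^sub>2 C\<^sub>2
  for V :: "'v set" and pr :: "'v set \<Rightarrow> real" and q :: nat and r A c\<^sub>1 c\<^sub>2 C\<^sub>2 :: real +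
  fixes lev :: "'v \<Rightarrow> 'v \<Rightarrow> nat" and n :: nat and P :: "nat \<Rightarrow> real" and t \<epsilon> :: real
  assumes lev_le: "a \<in> V \<Longrightarrow> b \<in> V \<Longrightarrow> lev a b \<le> n"
    and lev_0: "a \<in> V \<Longrightarrow> b \<in> V \<Longrightarrow> lev a b = 0 \<longleftrightarrow> a = b"
    and lev_sym: "a \<in> V \<Longrightarrow> b \<in> V \<Longrightarrow> lev a b = lev b a"
    and lev_ultra: "a \<in> V \<Longrightarrow> b \<in> V \<Longrightarrow> x \<in> V \<Longrightarrow> lev a x \<le> max (lev a b) (lev b x)"
    and card_ball: "a \<in> V \<Longrightarrow> j \<le> n \<Longrightarrow> card {y \<in> V. lev a y \<le> j} = q ^ j"
    and pr_lev: "a \<in> V \<Longrightarrow> b \<in> V \<Longrightarrow> a \<noteq> b \<Longrightarrow> pr {a, b} = P (lev a b)"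
    and n1: "1 \<le> n"
    and P_le: "1 \<le> i \<Longrightarrow> i \<le> n \<Longrightarrow> P i \<le> A * (t * r ^ i)"
    and P_ge: "1 \<le> i \<Longrightarrow> i \<le> n \<Longrightarrow> c\<^sub>1 * (t * r ^ i) \<le> P i"
    and t_bounds: "c\<^sub>2 \<le> t * (q * r) ^ n" "t * (q * r) ^ n \<le> C\<^sub>2"
    and total: "(\<Sum>i=1..n. (real q - 1) * real q ^ (i - 1) * P i) = 1 - \<epsilon>"
    and eps: "0 < \<epsilon>" "\<epsilon> \<le> 1"
begin

abbreviation N :: real where "N \<equiv> real q ^ n"

definition w :: "nat \<Rightarrow> real" where "w j = t * r ^ j"

lemma N_pos: "0 < N" using q2 by simp

lemma t_pos: "0 < t"
proof -
  have "0 < t * s ^ n" using t_bounds(1) const_pos by linarith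
  moreover have "0 < s ^ n" using s1 by simp
  ultimately show ?thesis by (rule zero_less_mult_pos2)
qed

lemma w_pos: "0 < w j" using t_pos r by (simp add: w_def)

lemma q_pow_w: "real q ^ j * w j = t * s ^ j"
  by (simp add: w_def power_mult_distrib)

lemma w_n: "w n \<le> C\<^sub>2 / N" "c\<^sub>2 / N \<le> w n"
proof -
  have eq: "w n = t * s ^ n / N" using q_pow_w[of n] N_pos by (simp add: eq_divide_eq mult.commute)
  show "w n \<le> C\<^sub>2 / N" "c\<^sub>2 / N \<le> w n"
    unfolding eq using t_bounds N_pos by (intro divide_right_mono; simp)+
qed

lemma w_antimono: "i \<le> j \<Longrightarrow> w j \<le> w i"
  unfolding w_def using t_pos r by (intro mult_left_mono power_decreasing) auto

lemma t_s_le: "i \<le> n \<Longrightarrow> t * s ^ i * s ^ (n - i) \<le> C\<^sub>2"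
  using t_bounds(2) by (simp add: mult.assoc flip: power_add)

lemma p_eq: "a \<in> V \<Longrightarrow> b \<in> V \<Longrightarrow> a \<noteq> b \<Longrightarrow> p a b = P (lev a b)"
  by (simp add: p_def pr_lev)

lemma p_refl [simp]: "p a a = 0" by (simp add: p_def)

lemma lev_ge_1: "a \<in> V \<Longrightarrow> b \<in> V \<Longrightarrow> a \<noteq> b \<Longrightarrow> 1 \<le> lev a b"
  using lev_0[of a b] by (cases "lev a b") auto

lemma sum_lev_le:
  assumes a: "a \<in> V" and f: "\<And>i. 0 \<le> f i"
  shows "(\<Sum>y\<in>V. f (lev a y)) \<le> (\<Sum>i\<le>n. real q ^ i * f i)"
proof -
  have "(\<Sum>y\<in>V. f (lev a y)) = (\<Sum>i\<le>n. \<Sum>y\<in>{y \<in> V. lev a y = i}. f (lev a y))"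
    using finite_V lev_le[OF a] by (intro sum.group[symmetric]) auto
  also have "\<dots> = (\<Sum>i\<le>n. card {y \<in> V. lev a y = i} * f i)"
    by (intro sum.cong) auto
  also have "\<dots> \<le> (\<Sum>i\<le>n. real q ^ i * f i)"
  proof (intro sum_mono mult_right_mono f)
    fix i assume i: "i \<in> {..n}"
    have "card {y \<in> V. lev a y = i} \<le> card {y \<in> V. lev a y \<le> i}"
      using finite_V by (intro card_mono) auto
    then show "real (card {y \<in> V. lev a y = i}) \<le> real q ^ i"
      using card_ball[OF a, of i] i by (simp flip: of_nat_power)
  qed
  finally show ?thesis .
qed

lemma ball_mass:
  assumes a: "a \<in> V"
  shows "j \<le> n \<Longrightarrow> (\<Sum>y\<in>{y \<in> V. lev a y \<le> j}. p a y) = (\<Sum>i=1..j. (real q - 1) * real q ^ (i - 1) * P i)"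
proof (induction j)
  case 0
  have "{y \<in> V. lev a y \<le> 0} = {a}" using lev_0[OF a] a by auto
  then show ?case by simp
next
  case (Suc j)
  let ?S = "{y \<in> V. lev a y = Suc j}"
  have un: "{y \<in> V. lev a y \<le> Suc j} = {y \<in> V. lev a y \<le> j} \<union> ?S" by auto
  have fin: "finite {y \<in> V. lev a y \<le> j}" "finite ?S" using finite_V by auto
  have "card {y \<in> V. lev a y \<le> Suc j} = card {y \<in> V. lev a y \<le> j} + card ?S"
    unfolding un using fin by (intro card_Un_disjoint) auto
  then have "q ^ Suc j = q ^ j + card ?S" using Suc card_ball[OF a] by simp
  then have c: "real (card ?S) = (real q - 1) * real q ^ j"
    by (simp add: algebra_simps flip: of_nat_power of_nat_mult of_nat_add)
  have "(\<Sum>y\<in>?S. p a y) = (\<Sum>y\<in>?S. P (Suc j))"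
  proof (intro sum.cong refl)
    fix y assume y: "y \<in> ?S"
    then have "a \<noteq> y" using lev_0[OF a a] by auto
    then show "p a y = P (Suc j)" using p_eq[OF a] y by auto
  qed
  also have "\<dots> = (real q - 1) * real q ^ j * P (Suc j)" by (simp add: c)
  finally have S: "(\<Sum>y\<in>?S. p a y) = (real q - 1) * real q ^ j * P (Suc j)" .
  have "(\<Sum>y\<in>{y \<in> V. lev a y \<le> Suc j}. p a y) = (\<Sum>y\<in>{y \<in> V. lev a y \<le> j}. p a y) + (\<Sum>y\<in>?S. p a y)"
    unfolding un using fin by (intro sum.union_disjoint) auto
  then show ?case using Suc S q2 by (simp add: of_nat_diff)
qed

lemma row_sum: "a \<in> V \<Longrightarrow> (\<Sum>y\<in>V. p a y) = 1 - \<epsilon>"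
proof -
  assume a: "a \<in> V"
  have "{y \<in> V. lev a y \<le> n} = V" using lev_le[OF a] by auto
  then show ?thesis using ball_mass[OF a, of n] total by simp
qed

lemma P_nonneg: "1 \<le> i \<Longrightarrow> i \<le> n \<Longrightarrow> 0 \<le> P i"
proof -
  assume i: "1 \<le> i" "i \<le> n"
  have "0 \<le> c\<^sub>1 * (t * r ^ i)" using const_pos t_pos r by simp
  then show ?thesis using P_ge[OF i] by linarith
qed

lemma P_ge_N: "1 \<le> i \<Longrightarrow> i \<le> n \<Longrightarrow> c\<^sub>1 * c\<^sub>2 / N \<le> P i"
proof -
  assume i: "1 \<le> i" "i \<le> n"
  have "c\<^sub>1 * (c\<^sub>2 / N) \<le> c\<^sub>1 * w i"
    using w_n(2) w_antimono[OF i(2)] const_pos by (intro mult_left_mono) auto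
  then show ?thesis using P_ge[OF i] by (simp add: w_def)
qed

text \<open>The top level alone carries a fixed fraction of the mean degree, because each of its
edge probabilities is of order \<open>1 / N\<close>. Hence the walk with kernel \<open>p\<close> stays in a proper ball at each
step with probability at most \<open>1 - c\<close>: near criticality is felt only by functions constant on \<open>V\<close>.\<close>

lemma inner_ball_mass:
  assumes a: "a \<in> V" and j: "j < n"
  shows "(\<Sum>y\<in>{y \<in> V. lev a y \<le> j}. p a y) \<le> 1 - c"
proof -
  have "(\<Sum>i=1..j. (real q - 1) * real q ^ (i - 1) * P i) + (real q - 1) * q ^ (n - 1) * P n
      = (\<Sum>i\<in>insert n {1..j}. (real q - 1) * real q ^ (i - 1) * P i)" using j by simp
  also have "\<dots> \<le> (\<Sum>i=1..n. (real q - 1) * real q ^ (i - 1) * P i)"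
    using j q2 n1 by (intro sum_mono2) (auto intro!: mult_nonneg_nonneg P_nonneg)
  also have "\<dots> = 1 - \<epsilon>" using total q2 by (simp add: of_nat_diff)
  finally have 1: "(\<Sum>i=1..j. (real q - 1) * real q ^ (i - 1) * P i) \<le> 1 - (real q - 1) * q ^ (n - 1) * P n"
    using eps by linarith
  have "c * q ^ n \<le> c\<^sub>1 * c\<^sub>2 * ((real q - 1) * q ^ (n - 1))"
  proof -
    have "real q ^ n = real q * q ^ (n - 1)" using n1 by (cases n) auto
    moreover have "real q * q ^ (n - 1) \<le> 2 * (real q - 1) * q ^ (n - 1)"
      using q2 by (intro mult_right_mono) auto
    ultimately have "real q ^ n / 2 \<le> (real q - 1) * q ^ (n - 1)" by (simp add: algebra_simps)
    then have "c\<^sub>1 * c\<^sub>2 * (real q ^ n / 2) \<le> c\<^sub>1 * c\<^sub>2 * ((real q - 1) * q ^ (n - 1))"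
      using const_pos by (intro mult_left_mono) auto
    then show ?thesis by (simp add: c_def)
  qed
  then have "c \<le> (real q - 1) * q ^ (n - 1) * (c\<^sub>1 * c\<^sub>2 / N)"
    using N_pos by (simp add: field_simps)
  also have "\<dots> \<le> (real q - 1) * q ^ (n - 1) * P n"
    using P_ge_N[of n] n1 q2 by (intro mult_left_mono) auto
  finally show ?thesis using 1 ball_mass[OF a, of j] j q2 by (simp add: of_nat_diff)
qed

text \<open>Comparable to \<open>t * r ^ i\<close> for \<open>i < n\<close>. Written as a combination of indicators of balls, since
the kernel acts on the indicator of a ball in a simple way in an ultrametric space.\<close>

definition near :: "nat \<Rightarrow> real" where "near i = (\<Sum>j\<in>{i..<n}. w j)"

lemma near_nonneg: "0 \<le> near i" unfolding near_def using w_pos by (intro sum_nonneg) (simp add: less_imp_le)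

lemma near_antimono: "i \<le> j \<Longrightarrow> near j \<le> near i"
  unfolding near_def using w_pos by (intro sum_mono2) (auto simp: less_imp_le)

lemma w_le_near: "i < n \<Longrightarrow> w i \<le> near i"
  unfolding near_def using w_pos by (intro member_le_sum) (auto simp: less_imp_le)

lemma near_le: "near i \<le> w i / (1 - r)"
proof (cases "i \<le> n")
  case True
  have "near i = (\<Sum>j<n - i. w i * r ^ j)"
    unfolding near_def w_def using True
    by (intro sum.reindex_bij_witness[of _ "\<lambda>j. j + i" "\<lambda>j. j - i"]) (auto simp: power_add[symmetric])
  also have "\<dots> = w i * ((1 - r ^ (n - i)) / (1 - r))"
    using r by (simp add: sum_distrib_left[symmetric] sum_gp_strict)
  also have "\<dots> \<le> w i * (1 / (1 - r))"
    using r w_pos[of i] by (intro mult_left_mono divide_right_mono) auto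
  finally show ?thesis by simp
next
  case False
  then show ?thesis using r w_pos[of i] by (simp add: near_def)
qed

lemma sum_s_le: "(\<Sum>j<i. s ^ j) \<le> s ^ i / (s - 1)"
proof -
  have "(\<Sum>j<i. s ^ j) = (s ^ i - 1) / (s - 1)" using s1 by (intro geometric_sum) auto
  also have "\<dots> \<le> s ^ i / (s - 1)" using s1 by (intro divide_right_mono) auto
  finally show ?thesis .
qed

text \<open>On the indicator of the ball of level \<open>j\<close> around \<open>x\<close>, the kernel acts inside the ball as
multiplication by the mass of that ball, at most \<open>1 - c\<close>, and outside the ball by \<open>q ^ j * P (lev a x)\<close>,
since all points of the ball have the same distance to \<open>a\<close>.\<close>

lemma sum_p_near_le:
  assumes a: "a \<in> V" and x: "x \<in> V"
  shows "(\<Sum>y\<in>V. p a y * near (lev y x)) \<le>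
    (1 - c) * near (lev a x) + (if a = x then 0 else P (lev a x) * (t * s ^ lev a x / (s - 1)))"
proof -
  let ?i = "lev a x"
  define G where "G j = (\<Sum>y\<in>{y \<in> V. lev y x \<le> j}. p a y)" for j
  have near': "near i = (\<Sum>j<n. if i \<le> j then w j else 0)" for i
    unfolding near_def by (simp add: sum.If_cases) (intro sum.cong, auto)
  have "(\<Sum>y\<in>V. p a y * near (lev y x)) = (\<Sum>y\<in>V. \<Sum>j<n. if lev y x \<le> j then p a y * w j else 0)"
    unfolding near' by (simp add: sum_distrib_left if_distrib cong: if_cong)
  also have "\<dots> = (\<Sum>j<n. \<Sum>y\<in>V. if lev y x \<le> j then p a y * w j else 0)"
    by (rule sum.swap)
  also have "\<dots> = (\<Sum>j<n. G j * w j)"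
    unfolding G_def sum_distrib_right using finite_V
    by (intro sum.cong refl sum.inter_filter[symmetric])
  also have "\<dots> \<le> (\<Sum>j<n. (if ?i \<le> j then (1 - c) * w j else 0) + (if j < ?i then P ?i * (t * s ^ j) else 0))"
  proof (intro sum_mono)
    fix j assume j: "j \<in> {..<n}"
    show "G j * w j \<le> (if ?i \<le> j then (1 - c) * w j else 0) + (if j < ?i then P ?i * (t * s ^ j) else 0)"
    proof (cases "?i \<le> j")
      case True
      have "{y \<in> V. lev y x \<le> j} = {y \<in> V. lev a y \<le> j}"
      proof (intro Collect_cong conj_cong refl)
        fix y assume y: "y \<in> V"
        show "lev y x \<le> j \<longleftrightarrow> lev a y \<le> j"
          using lev_ultra[of a x y] lev_ultra[of y a x] lev_sym[of x y] lev_sym[of a y] True a x y by auto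
      qed
      then have "G j \<le> 1 - c" using inner_ball_mass[OF a, of j] j by (simp add: G_def)
      then show ?thesis using True w_pos[of j] by (simp add: mult_right_mono)
    next
      case False
      have "G j = (\<Sum>y\<in>{y \<in> V. lev y x \<le> j}. P ?i)"
        unfolding G_def
      proof (intro sum.cong refl)
        fix y assume y: "y \<in> {y \<in> V. lev y x \<le> j}"
        have "lev a y = ?i"
          using lev_ultra[of a y x] lev_ultra[of a x y] lev_sym[of x y] False a x y by auto
        moreover have "a \<noteq> y" using False y by auto
        ultimately show "p a y = P ?i" using p_eq[of a y] a y by simp
      qed
      moreover have "{y \<in> V. lev y x \<le> j} = {y \<in> V. lev x y \<le> j}" using lev_sym x by auto
      ultimately have "G j = real q ^ j * P ?i" using card_ball[OF x, of j] j by simp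
      then have "G j * w j = P ?i * (t * s ^ j)" by (simp flip: q_pow_w)
      then show ?thesis using False by simp
    qed
  qed
  also have "\<dots> = (1 - c) * near ?i + P ?i * (t * (\<Sum>j<?i. s ^ j))"
  proof -
    have 1: "(\<Sum>j<n. if ?i \<le> j then (1 - c) * w j else 0) = (1 - c) * near ?i"
      unfolding near' by (simp add: sum_distrib_left if_distrib cong: if_cong)
    have "{..<n} \<inter> {j. j < ?i} = {..<?i}" using lev_le[OF a x] by auto
    then have 2: "(\<Sum>j<n. if j < ?i then P ?i * (t * s ^ j) else 0) = P ?i * (t * (\<Sum>j<?i. s ^ j))"
      by (simp add: sum.If_cases sum_distrib_left)
    show ?thesis by (simp add: sum.distrib 1 2)
  qed
  also have "P ?i * (t * (\<Sum>j<?i. s ^ j)) \<le> (if a = x then 0 else P ?i * (t * s ^ ?i / (s - 1)))"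
  proof (cases "a = x")
    case True then show ?thesis using lev_0[of a x] a x by simp
  next
    case False
    have "t * (\<Sum>j<?i. s ^ j) \<le> t * (s ^ ?i / (s - 1))"
      by (intro mult_left_mono sum_s_le less_imp_le t_pos)
    from mult_left_mono[OF this P_nonneg[of ?i]] show ?thesis
      using False lev_ge_1[OF a x] lev_le[OF a x] by simp
  qed
  finally show ?thesis by simp
qed

text \<open>The factor \<open>t * s ^ i\<close> decays geometrically in \<open>n - i\<close>, so away from the top it is at most
a small multiple of \<open>near i\<close>; near the top the whole expression is of order \<open>1 / N\<close>.\<close>

lemma returning_mass_le:
  assumes i: "1 \<le> i" "i \<le> n"
  shows "P i * (t * s ^ i / (s - 1)) \<le> c / 2 * near i + D / N"
proof (cases "n - i < top_levels")
  case True
  have "w i * r ^ (n - i) = w n" using i by (simp add: w_def mult.assoc flip: power_add)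
  then have wi: "w i = w n * (1 / r) ^ (n - i)" using r by (simp add: field_simps)
  also have "\<dots> \<le> C\<^sub>2 / N * (1 / r) ^ top_levels"
    using True w_n(1) r const_pos by (intro mult_mono power_increasing) auto
  finally have "P i \<le> A * (C\<^sub>2 / N * (1 / r) ^ top_levels)"
    using P_le[OF i] const_pos mult_left_mono[of "w i" "C\<^sub>2 / N * (1 / r) ^ top_levels" A] by (simp add: w_def)
  moreover have "t * s ^ i / (s - 1) \<le> C\<^sub>2 / (s - 1)"
  proof (intro divide_right_mono)
    have "t * s ^ i * 1 \<le> t * s ^ i * s ^ (n - i)"
      using t_pos s1 by (intro mult_left_mono) (auto intro: one_le_power)
    then show "t * s ^ i \<le> C\<^sub>2" using t_s_le[OF i(2)] by simp
  qed (use s1 in simp)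
  ultimately have "P i * (t * s ^ i / (s - 1)) \<le> A * (C\<^sub>2 / N * (1 / r) ^ top_levels) * (C\<^sub>2 / (s - 1))"
    using t_pos s1 r const_pos by (intro mult_mono) auto
  also have "\<dots> = D / N" by (simp add: D_def mult_ac)
  also have "\<dots> \<le> c / 2 * near i + D / N" using c_pos near_nonneg[of i] by simp
  finally show ?thesis .
next
  case False
  then have k: "top_levels \<le> n - i" "i < n" using top_levels_bound(1) by auto
  have "t * s ^ i * s ^ top_levels \<le> t * s ^ i * s ^ (n - i)"
    using t_pos s1 k by (intro mult_left_mono power_increasing) auto
  then have "t * s ^ i * s ^ top_levels \<le> C\<^sub>2" using t_s_le[OF i(2)] by simp
  moreover have "t * s ^ i * (2 * A * C\<^sub>2 / ((s - 1) * c)) \<le> t * s ^ i * s ^ top_levels"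
    using t_pos s1 top_levels_bound(2) by (intro mult_left_mono) auto
  ultimately have "t * s ^ i * (2 * A * C\<^sub>2 / ((s - 1) * c)) \<le> C\<^sub>2" by linarith
  then have "(t * s ^ i * (2 * A / ((s - 1) * c))) * C\<^sub>2 \<le> 1 * C\<^sub>2" by (simp add: mult_ac)
  then have "t * s ^ i * (2 * A / ((s - 1) * c)) \<le> 1"
    using const_pos(4) by (rule mult_right_le_imp_le)
  then have "(t * s ^ i * (2 * A / ((s - 1) * c))) * (c / 2) \<le> 1 * (c / 2)"
    using c_pos by (intro mult_right_mono) auto
  then have 1: "A * (t * s ^ i / (s - 1)) \<le> c / 2"
    using c_pos by (simp add: mult_ac)
  have "P i * (t * s ^ i / (s - 1)) \<le> A * w i * (t * s ^ i / (s - 1))"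
    using P_le[OF i] t_pos s1 by (intro mult_right_mono) (auto simp: w_def)
  also have "\<dots> = A * (t * s ^ i / (s - 1)) * w i" by simp
  also have "\<dots> \<le> c / 2 * w i" using 1 w_pos[of i] by (intro mult_right_mono) auto
  also have "\<dots> \<le> c / 2 * near i" using c_pos w_le_near[OF k(2)] by (intro mult_left_mono) auto
  finally show ?thesis using D_pos N_pos divide_nonneg_pos[of D N] by linarith
qed

text \<open>The majorant: the identity, a multiple of the direct-edge profile, and a constant of the order
of the mean cluster size \<open>1 / \<epsilon>\<close> spread evenly over \<open>N\<close> vertices.\<close>

definition b :: real where "b = B / (N * \<epsilon>)"
definition maj :: "nat \<Rightarrow> real" where "maj i = near_coeff * near i + b"
definition h :: "'v \<Rightarrow> 'v \<Rightarrow> real" where "h a x = (if a = x then 1 else 0) + maj (lev a x)"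

lemma b_pos: "0 < b" using B_pos N_pos eps by (simp add: b_def)
lemma maj_pos: "0 < maj i" using b_pos near_coeff_pos near_nonneg[of i] by (simp add: maj_def add_nonneg_pos)
lemma maj_antimono: "i \<le> j \<Longrightarrow> maj j \<le> maj i"
  unfolding maj_def using near_coeff_pos near_antimono by simp

text \<open>The decaying part of the majorant loses the factor \<open>1 - c / 2\<close>, which pays for the direct edges;
the constant part loses \<open>b * \<epsilon>\<close>, of order \<open>1 / N\<close>, which pays for everything that happens near the top
level.\<close>

lemma sum_p_h_le:
  assumes a: "a \<in> V" and x: "x \<in> V"
  shows "(\<Sum>y\<in>V. p a y * h y x) \<le> maj (lev a x)"
proof -
  let ?i = "lev a x"
  have "(\<Sum>y\<in>V. p a y * h y x) = (\<Sum>y\<in>V. (if y = x then p a y else 0) + near_coeff * (p a y * near (lev y x)) + b * p a y)"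
    by (intro sum.cong) (auto simp: h_def maj_def algebra_simps)
  also have "\<dots> = p a x + near_coeff * (\<Sum>y\<in>V. p a y * near (lev y x)) + b * (1 - \<epsilon>)"
    using finite_V x row_sum[OF a] by (simp add: sum.distrib sum_distrib_left[symmetric])
  also have "\<dots> \<le> p a x + near_coeff * ((1 - c) * near ?i + (if a = x then 0 else P ?i * (t * s ^ ?i / (s - 1)))) + b * (1 - \<epsilon>)"
    using sum_p_near_le[OF a x] near_coeff_pos by (intro add_right_mono add_left_mono mult_left_mono) auto
  also have "\<dots> \<le> near_coeff * near ?i + b"
  proof (cases "a = x")
    case True
    have "0 \<le> near_coeff * (c * near ?i)" "0 \<le> b * \<epsilon>" using near_coeff_pos c_pos near_nonneg[of ?i] b_pos eps by auto
    then show ?thesis using True by (simp add: algebra_simps)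
  next
    case False
    have i: "1 \<le> ?i" "?i \<le> n" using lev_ge_1[OF a x False] lev_le[OF a x] by auto
    have p: "p a x \<le> A * near ?i + A * C\<^sub>2 / N"
    proof (cases "?i = n")
      case True
      have "p a x \<le> A * w n" using P_le[OF i] p_eq[OF a x False] True by (simp add: w_def)
      also have "\<dots> \<le> A * (C\<^sub>2 / N)" using w_n const_pos by (intro mult_left_mono) auto
      finally have "p a x \<le> A * C\<^sub>2 / N" by simp
      then show ?thesis
        using mult_nonneg_nonneg[OF less_imp_le[OF const_pos(1)] near_nonneg, of ?i] by linarith
    next
      case F: False
      have "p a x \<le> A * w ?i" using P_le[OF i] p_eq[OF a x False] by (simp add: w_def)
      also have "\<dots> \<le> A * near ?i" using w_le_near[of ?i] F i const_pos by (intro mult_left_mono) auto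
      finally have "p a x \<le> A * near ?i" .
      moreover have "0 < A * C\<^sub>2 / N" using const_pos N_pos by (intro divide_pos_pos mult_pos_pos)
      ultimately show ?thesis by linarith
    qed
    let ?F = "P ?i * (t * s ^ ?i / (s - 1))"
    have "near_coeff * ?F \<le> near_coeff * (c / 2 * near ?i + D / N)"
      using returning_mass_le[OF i] near_coeff_pos by (intro mult_left_mono) auto
    also have "\<dots> = A * near ?i + near_coeff * (D / N)" using c_pos by (simp add: near_coeff_def distrib_left)
    finally have F: "near_coeff * ?F \<le> A * near ?i + near_coeff * (D / N)" .
    have "b * \<epsilon> = B / N" using eps by (simp add: b_def)
    also have "\<dots> = A * C\<^sub>2 / N + near_coeff * (D / N)" by (simp add: B_def add_divide_distrib)
    finally have b: "b * (1 - \<epsilon>) = b - (A * C\<^sub>2 / N + near_coeff * (D / N))" by (simp add: algebra_simps)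
    have "near_coeff * ((1 - c) * near ?i + ?F) = near_coeff * near ?i - (near_coeff * c) * near ?i + near_coeff * ?F"
      by (simp only: algebra_simps)
    moreover have "near_coeff * c = 2 * A" using c_pos by (simp add: near_coeff_def)
    ultimately have "near_coeff * ((1 - c) * near ?i + ?F) = near_coeff * near ?i - 2 * (A * near ?i) + near_coeff * ?F" by simp
    then show ?thesis using p F b False by simp
  qed
  finally show ?thesis by (simp add: maj_def)
qed

sublocale percolation_majorant V pr h
proof
  fix a x assume a: "a \<in> V" and x: "x \<in> V"
  show "0 \<le> h a x" using maj_pos[of "lev a x"] by (simp add: h_def)
  show "h a x = h x a" using lev_sym[OF a x] by (simp add: h_def)
  show "(if a = x then 1 else 0) + (\<Sum>y\<in>V. p a y * h y x) \<le> h a x"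
    using sum_p_h_le[OF a x] by (simp add: h_def)
qed

lemma maj_le: "maj i \<le> near_coeff / (1 - r) * w i + b"
  using near_le[of i] near_coeff_pos mult_left_mono[of "near i" "w i / (1 - r)" "near_coeff"] by (simp add: maj_def)

theorem \<tau>_upper:
  assumes "a \<in> V" "x \<in> V" "a \<noteq> x"
  shows "\<tau> V a x \<le> near_coeff / (1 - r) * (t * r ^ lev a x) + B / (N * \<epsilon>)"
  using \<tau>_le_h[of V a x] maj_le[of "lev a x"] assms by (simp add: h_def w_def b_def)

lemma ph_le_maj: "a \<in> V \<Longrightarrow> x \<in> V \<Longrightarrow> ph a x \<le> maj (lev a x)"
  using sum_p_h_le by (simp add: ph_def)

lemma p_le_maj: 
  assumes a: "a \<in> V" and x: "x \<in> V" shows "p a x \<le> maj (lev a x)"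
proof -
  have "p a x * 1 \<le> p a x * h x x" using h_diag[OF x] p_nonneg[OF a x] by (intro mult_left_mono) auto
  also have "\<dots> \<le> ph a x" unfolding ph_def using a x finite_V
    by (intro member_le_sum[of x V "\<lambda>y. p a y * h y x"]) (auto intro!: mult_nonneg_nonneg p_nonneg h_nonneg)
  finally show ?thesis using ph_le_maj[OF a x] by simp
qed

text \<open>A bound for the bubble \<open>\<Sum>z. maj (lev a z) ^ 2\<close>. It measures how far the percolation clusters
are from being trees, and has to be small compared to \<open>\<epsilon>\<close>.\<close>

definition S :: real where "S = (\<Sum>i\<le>n. real q ^ i * (maj i)\<^sup>2)"

lemma S_nonneg: "0 \<le> S" unfolding S_def by (intro sum_nonneg) auto

lemma sum_maj_sq_le: "a \<in> V \<Longrightarrow> (\<Sum>z\<in>V. (maj (lev a z))\<^sup>2) \<le> S"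
  unfolding S_def by (rule sum_lev_le) auto

lemma ph_refl_le: 
  assumes a: "a \<in> V" shows "ph a a \<le> S"
proof -
  have "ph a a \<le> (\<Sum>y\<in>V. (maj (lev a y))\<^sup>2)"
    unfolding ph_def
  proof (intro sum_mono)
    fix y assume y: "y \<in> V"
    show "p a y * h y a \<le> (maj (lev a y))\<^sup>2"
    proof (cases "y = a")
      case False
      then have "p a y * h y a = p a y * maj (lev a y)" using lev_sym[OF a y] by (simp add: h_def)
      also have "\<dots> \<le> maj (lev a y) * maj (lev a y)"
        using p_le_maj[OF a y] maj_pos[of "lev a y"] by (intro mult_right_mono) auto
      finally show ?thesis by (simp add: power2_eq_square)
    qed simp
  qed
  then show ?thesis using sum_maj_sq_le[OF a] by simp
qed

text \<open>By the ultrametric inequality, \<open>z\<close> is at least as far from \<open>a\<close> or from \<open>x\<close> as these are from each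
other, so one factor can be replaced by its value at \<open>lev a x\<close>.\<close>

lemma sum_maj_cube_le:
  assumes a: "a \<in> V" and x: "x \<in> V"
  shows "(\<Sum>z\<in>V. (maj (lev a z))\<^sup>2 * maj (lev x z)) \<le> 2 * S * maj (lev a x)"
proof -
  have "(\<Sum>z\<in>V. (maj (lev a z))\<^sup>2 * maj (lev x z)) \<le>
      (\<Sum>z\<in>V. maj (lev a x) * ((maj (lev a z))\<^sup>2 + (maj (lev x z))\<^sup>2))"
  proof (intro sum_mono)
    fix z assume z: "z \<in> V"
    let ?A = "maj (lev a z)" and ?X = "maj (lev x z)" and ?R = "maj (lev a x)"
    have pos: "0 < ?A" "0 < ?X" "0 < ?R" by (rule maj_pos)+
    have "lev a x \<le> lev a z \<or> lev a x \<le> lev x z"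
      using lev_ultra[OF a z x] lev_sym[OF z x] by auto
    then show "?A\<^sup>2 * ?X \<le> ?R * (?A\<^sup>2 + ?X\<^sup>2)"
    proof
      assume "lev a x \<le> lev a z"
      then have "?A * (?A * ?X) \<le> ?R * (?A * ?X)"
        using maj_antimono pos by (intro mult_right_mono) auto
      also have "?A * ?X \<le> ?A\<^sup>2 + ?X\<^sup>2"
        using sum_squares_bound[of ?A ?X] mult_pos_pos[OF pos(1,2)] by simp
      finally show ?thesis using pos by (simp add: power2_eq_square mult.assoc)
    next
      assume "lev a x \<le> lev x z"
      then have "?X * ?A\<^sup>2 \<le> ?R * ?A\<^sup>2"
        using maj_antimono by (intro mult_right_mono) auto
      also have "\<dots> \<le> ?R * (?A\<^sup>2 + ?X\<^sup>2)" using pos by (intro mult_left_mono) auto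
      finally show ?thesis by (simp add: mult.commute)
    qed
  qed
  also have "\<dots> = maj (lev a x) * ((\<Sum>z\<in>V. (maj (lev a z))\<^sup>2) + (\<Sum>z\<in>V. (maj (lev x z))\<^sup>2))"
    by (simp add: sum.distrib distrib_left sum_distrib_left)
  also have "\<dots> \<le> maj (lev a x) * (S + S)"
    using sum_maj_sq_le a x maj_pos[of "lev a x"] by (intro mult_left_mono add_mono) auto
  finally show ?thesis by (simp add: mult_ac)
qed

text \<open>Separating the coincidences \<open>z = a\<close> and \<open>z = x\<close> in the correction terms is essential:
at \<open>z = a\<close> the factor \<open>ph a a\<close> is of the order of the bubble, whereas \<open>maj 0\<close>, at least of order \<open>t\<close>, may be
much larger than \<open>\<epsilon>\<close>.\<close>

lemma \<tau>_recursion: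
  assumes a: "a \<in> V" and x: "x \<in> V" and ax: "a \<noteq> x"
  shows "(\<Sum>y\<in>V. p a y * \<tau> V y x) - maj (lev a x) * (5 * S + 2 * maj (lev a x)) \<le> \<tau> V a x"
proof -
  let ?k = "maj (lev a x)"
  let ?Q = "\<Sum>z\<in>V. (maj (lev a z))\<^sup>2 * maj (lev x z)"
  have "(\<Sum>z\<in>V. ph a z * h a z * h x z) \<le>
      (\<Sum>z\<in>V. (if z = a then ph a z * maj (lev x z) else 0) + (if z = x then (maj (lev a z))\<^sup>2 else 0) +
        (maj (lev a z))\<^sup>2 * maj (lev x z))"
  proof (intro sum_mono)
    fix z assume z: "z \<in> V"
    have 1: "ph a z * maj (lev a z) \<le> (maj (lev a z))\<^sup>2"
      using ph_le_maj[OF a z] maj_pos[of "lev a z"] by (simp add: power2_eq_square mult_right_mono)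
    have 2: "ph a z * maj (lev a z) * maj (lev x z) \<le> (maj (lev a z))\<^sup>2 * maj (lev x z)"
      using 1 maj_pos[of "lev x z"] by (intro mult_right_mono) auto
    show "ph a z * h a z * h x z \<le> (if z = a then ph a z * maj (lev x z) else 0) +
        (if z = x then (maj (lev a z))\<^sup>2 else 0) + (maj (lev a z))\<^sup>2 * maj (lev x z)"
      using 1 2 ax by (auto simp: h_def algebra_simps)
  qed
  also have "\<dots> = ph a a * ?k + ?k\<^sup>2 + ?Q"
    using finite_V a x lev_sym[OF a x] by (simp add: sum.distrib)
  also have "\<dots> \<le> S * ?k + ?k\<^sup>2 + ?Q"
    using ph_refl_le[OF a] maj_pos[of "lev a x"] by (intro add_right_mono mult_right_mono) auto
  finally have 1: "(\<Sum>z\<in>V. ph a z * h a z * h x z) \<le> S * ?k + ?k\<^sup>2 + ?Q" .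
  have "(\<Sum>z\<in>V. (ph a z)\<^sup>2 * h x z) \<le>
      (\<Sum>z\<in>V. (if z = x then (maj (lev a z))\<^sup>2 else 0) + (maj (lev a z))\<^sup>2 * maj (lev x z))"
  proof (intro sum_mono)
    fix z assume z: "z \<in> V"
    have "(ph a z)\<^sup>2 * h x z \<le> (maj (lev a z))\<^sup>2 * h x z"
      using ph_le_maj[OF a z] ph_nonneg[OF a z] h_nonneg[OF x z] by (intro mult_right_mono power_mono) auto
    then show "(ph a z)\<^sup>2 * h x z \<le> (if z = x then (maj (lev a z))\<^sup>2 else 0) + (maj (lev a z))\<^sup>2 * maj (lev x z)"
      by (auto simp: h_def algebra_simps)
  qed
  also have "\<dots> = ?k\<^sup>2 + ?Q" using finite_V x by (simp add: sum.distrib)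
  finally have 2: "(\<Sum>z\<in>V. (ph a z)\<^sup>2 * h x z) \<le> ?k\<^sup>2 + ?Q" .
  show ?thesis
    using \<tau>_ge[OF a x ax] 1 2 sum_maj_cube_le[OF a x] by (simp add: algebra_simps power2_eq_square)
qed

lemma sum_q_le: "(\<Sum>i\<le>n. real q ^ i) \<le> 2 * N"
proof -
  have "(\<Sum>i\<le>n. real q ^ i) = (real q ^ Suc n - 1) / (real q - 1)"
    using q2 by (subst sum_gp0) (auto simp: field_simps)
  also have "\<dots> \<le> (real q * N) / (real q - 1)" using q2 by (intro divide_right_mono) auto
  also have "\<dots> \<le> 2 * N" using q2 by (simp add: field_simps)
  finally show ?thesis .
qed

lemma sum_maj_le:
  assumes a: "a \<in> V" shows "(\<Sum>y\<in>V. maj (lev a y)) \<le> C_sum / \<epsilon>"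
proof -
  have "(\<Sum>y\<in>V. maj (lev a y)) \<le> (\<Sum>i\<le>n. real q ^ i * maj i)"
    using a maj_pos by (intro sum_lev_le) (auto simp: less_imp_le)
  also have "\<dots> \<le> (\<Sum>i\<le>n. real q ^ i * (near_coeff / (1 - r) * w i + b))"
    using maj_le by (intro sum_mono mult_left_mono) auto
  also have "\<dots> = (\<Sum>i\<le>n. near_coeff / (1 - r) * (real q ^ i * w i) + b * real q ^ i)"
    by (simp add: algebra_simps)
  also have "\<dots> = near_coeff / (1 - r) * (t * (\<Sum>i<Suc n. s ^ i)) + b * (\<Sum>i\<le>n. real q ^ i)"
    unfolding q_pow_w lessThan_Suc_atMost by (simp only: sum.distrib sum_distrib_left)
  also have "\<dots> \<le> near_coeff / (1 - r) * (C\<^sub>2 * (s / (s - 1))) + b * (2 * N)"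
  proof (intro add_mono mult_left_mono sum_q_le)
    have "t * (\<Sum>i<Suc n. s ^ i) \<le> t * (s ^ Suc n / (s - 1))"
      by (intro mult_left_mono sum_s_le less_imp_le t_pos)
    also have "\<dots> = t * s ^ n * (s / (s - 1))" by simp
    also have "\<dots> \<le> C\<^sub>2 * (s / (s - 1))" using t_bounds s1 by (intro mult_right_mono) auto
    finally show "t * (\<Sum>i<Suc n. s ^ i) \<le> C\<^sub>2 * (s / (s - 1))" .
  qed (use near_coeff_pos r b_pos in auto)
  also have "b * (2 * N) = 2 * B / \<epsilon>" using q2 by (simp add: b_def)
  also have "near_coeff / (1 - r) * (C\<^sub>2 * (s / (s - 1))) + 2 * B / \<epsilon> \<le> C_sum / \<epsilon>"
  proof -
    have "K \<le> K / \<epsilon>" if "0 \<le> K" for K using that eps by (simp add: pos_le_divide_eq mult_left_le)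
    moreover have "0 \<le> near_coeff / (1 - r) * (C\<^sub>2 * (s / (s - 1)))" using near_coeff_pos r const_pos s1 by simp
    ultimately have "near_coeff / (1 - r) * (C\<^sub>2 * (s / (s - 1))) \<le> near_coeff / (1 - r) * (C\<^sub>2 * (s / (s - 1))) / \<epsilon>"
      by blast
    then show ?thesis by (simp add: C_sum_def add_divide_distrib)
  qed
  finally show ?thesis .
qed

text \<open>Summing the recursion over all starting points gives \<open>X \<ge> 1 + (1 - \<epsilon>) * X - error\<close> for the
mean cluster size \<open>X\<close>, and a bubble much smaller than \<open>\<epsilon>\<close> makes the error at most one half.\<close>

lemma susceptibility_ge:
  assumes x: "x \<in> V" and small: "S \<le> \<epsilon> / (2 * (3 + 5 * C_sum))"
  shows "1 / (2 * \<epsilon>) \<le> (\<Sum>a\<in>V. \<tau> V a x)"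
proof -
  let ?u = "\<lambda>a. \<tau> V a x" and ?k = "\<lambda>a. maj (lev x a)"
  define X where "X = (\<Sum>a\<in>V. ?u a)"
  have "(\<Sum>a\<in>V - {x}. (\<Sum>y\<in>V. p a y * ?u y) - ?k a * (5 * S + 2 * ?k a)) \<le> (\<Sum>a\<in>V - {x}. ?u a)"
    using \<tau>_recursion[OF _ x] lev_sym[OF x] by (intro sum_mono) auto
  moreover have "X = 1 + (\<Sum>a\<in>V - {x}. ?u a)"
    unfolding X_def using finite_V x by (subst sum.remove[OF _ x]) (auto simp: \<tau>_refl)
  moreover have "(\<Sum>a\<in>V - {x}. \<Sum>y\<in>V. p a y * ?u y) = (1 - \<epsilon>) * X - (\<Sum>y\<in>V. p x y * ?u y)"
  proof -
    have "(\<Sum>a\<in>V. \<Sum>y\<in>V. p a y * ?u y) = (\<Sum>y\<in>V. \<Sum>a\<in>V. p a y * ?u y)" by (rule sum.swap)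
    also have "\<dots> = (\<Sum>y\<in>V. (1 - \<epsilon>) * ?u y)"
      using row_sum by (intro sum.cong refl) (simp add: p_sym[of _ y for y] sum_distrib_right[symmetric])
    also have "\<dots> = (1 - \<epsilon>) * X" by (simp add: X_def sum_distrib_left)
    finally show ?thesis using finite_V x by (simp add: sum.remove[of V x])
  qed
  moreover have "(\<Sum>y\<in>V. p x y * ?u y) \<le> S"
  proof -
    have "(\<Sum>y\<in>V. p x y * ?u y) \<le> ph x x"
      unfolding ph_def using x by (intro sum_mono mult_left_mono \<tau>_le_h p_nonneg) auto
    then show ?thesis using ph_refl_le[OF x] by simp
  qed
  moreover have "(\<Sum>a\<in>V - {x}. ?k a * (5 * S + 2 * ?k a)) \<le> 5 * S * (C_sum / \<epsilon>) + 2 * S"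
  proof -
    have "(\<Sum>a\<in>V - {x}. ?k a * (5 * S + 2 * ?k a)) \<le> (\<Sum>a\<in>V. ?k a * (5 * S + 2 * ?k a))"
      using finite_V maj_pos S_nonneg
      by (intro sum_mono2) (auto intro!: mult_nonneg_nonneg add_nonneg_nonneg simp: less_imp_le)
    also have "\<dots> = 5 * S * (\<Sum>a\<in>V. ?k a) + 2 * (\<Sum>a\<in>V. (?k a)\<^sup>2)"
      by (simp add: distrib_left sum.distrib sum_distrib_left power2_eq_square mult_ac)
    also have "\<dots> \<le> 5 * S * (C_sum / \<epsilon>) + 2 * S"
      using sum_maj_le[OF x] sum_maj_sq_le[OF x] S_nonneg by (intro add_mono mult_left_mono) auto
    finally show ?thesis .
  qed
  ultimately have "1 - (3 * S + 5 * S * (C_sum / \<epsilon>)) \<le> \<epsilon> * X"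
    by (simp add: sum_subtractf algebra_simps)
  moreover have "3 * S + 5 * S * (C_sum / \<epsilon>) \<le> 1 / 2"
  proof -
    have "3 * S \<le> 3 * S / \<epsilon>" using S_nonneg eps by (simp add: pos_le_divide_eq mult_left_le)
    then have "3 * S + 5 * S * (C_sum / \<epsilon>) \<le> S * (3 + 5 * C_sum) / \<epsilon>"
      by (simp add: add_divide_distrib algebra_simps)
    also have "\<dots> \<le> 1 / 2" using small eps C_sum_pos by (simp add: field_simps)
    finally show ?thesis .
  qed
  ultimately have "1 / 2 \<le> \<epsilon> * X" by linarith
  then show ?thesis using eps by (simp add: X_def[symmetric] field_simps)
qed

text \<open>Apply the recursion at a point \<open>m\<close> where the connection probability is minimal. Every
edge probability is at least of order \<open>1 / N\<close>, so the minimum is at least of order \<open>X / N\<close> with \<open>X\<close> the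
mean cluster size, up to the error. The error is negligible: if the minimum is below \<open>1 / (N * \<epsilon>)\<close>, then
so is the direct edge probability, and the majorant at \<open>m\<close> is itself of order \<open>1 / (N * \<epsilon>)\<close>.\<close>

lemma \<tau>_lower_aux:
  assumes x: "x \<in> V" and a: "a \<in> V" 
    and S: "S \<le> err_tol * \<epsilon>" and Ne: "1 / (N * \<epsilon>) \<le> err_tol"
  shows "c_far / (N * \<epsilon>) \<le> \<tau> V a x"
proof -
  let ?u = "\<lambda>y. \<tau> V y x" and ?c = "c\<^sub>1 * c\<^sub>2"
  define M where "M = Min (?u ` V)"
  define X where "X = (\<Sum>y\<in>V. ?u y)"
  have "V \<noteq> {}" using x by auto
  then have "M \<in> ?u ` V" unfolding M_def using finite_V by (intro Min_in) auto
  then obtain m where m: "m \<in> V" "M = ?u m" by auto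
  have M_le: "M \<le> ?u y" if "y \<in> V" for y
    unfolding M_def using finite_V that by (intro Min_le) auto
  have NE: "0 < N * \<epsilon>" using N_pos eps by simp
  have c: "0 < ?c" using const_pos by simp
  have "c_far / (N * \<epsilon>) \<le> M"
  proof (cases "m = x \<or> 1 / (N * \<epsilon>) \<le> M")
    case True
    moreover have "?u x = 1" using x by (rule \<tau>_refl)
    moreover have "err_tol \<le> 1" by (simp add: err_tol_def)
    ultimately have "1 / (N * \<epsilon>) \<le> M" using Ne m by auto
    moreover have "c_far / (N * \<epsilon>) \<le> 1 / (N * \<epsilon>)"
      using c_far_le_1 NE by (intro divide_right_mono) auto
    ultimately show ?thesis by linarith
  next
    case False
    then have mx: "m \<noteq> x" and small: "M < 1 / (N * \<epsilon>)" by auto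
    let ?i = "lev m x"
    have i: "1 \<le> ?i" "?i \<le> n" using lev_ge_1[OF m(1) x mx] lev_le[OF m(1) x] by auto
    have "c\<^sub>1 * w ?i \<le> M"
      using P_ge[OF i] p_eq[OF m(1) x mx] \<tau>_edge[OF m(1) x] m(2) by (simp add: w_def)
    then have "w ?i * c\<^sub>1 \<le> 1 / (N * \<epsilon>)" using small by (simp only: mult.commute)
    then have "w ?i \<le> 1 / (N * \<epsilon>) / c\<^sub>1" by (rule pos_le_divide_eq[THEN iffD2, OF const_pos(2)])
    then have "near_coeff / (1 - r) * w ?i \<le> near_coeff / (1 - r) * (1 / (N * \<epsilon>) / c\<^sub>1)"
      using near_coeff_pos r by (intro mult_left_mono) auto
    then have k: "maj ?i \<le> C_min * (1 / (N * \<epsilon>))"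
      using maj_le[of ?i] by (simp add: C_min_def b_def algebra_simps)
    have "maj ?i * (5 * S + 2 * maj ?i) \<le> ?c / (4 * (N * \<epsilon>))"
    proof -
      have "S \<le> err_tol * \<epsilon>" by (rule S)
      also have "\<dots> \<le> err_tol" using err_tol_pos eps by (simp add: mult_left_le)
      finally have 1: "S \<le> err_tol" .
      have 2: "maj ?i \<le> C_min * err_tol"
        using k mult_left_mono[OF Ne, of "C_min"] C_min_pos by simp
      have "maj ?i * (5 * S + 2 * maj ?i) \<le> (C_min * (1 / (N * \<epsilon>))) * (5 * err_tol + 2 * (C_min * err_tol))"
        using k 1 2 maj_pos[of ?i] S_nonneg C_min_pos NE by (intro mult_mono) auto
      also have "\<dots> = (C_min * (5 + 2 * C_min)) * err_tol / (N * \<epsilon>)" by (simp add: algebra_simps add_divide_distrib)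
      also have "\<dots> \<le> ?c / 4 / (N * \<epsilon>)"
      proof (rule divide_right_mono)
        have "C_min * (5 + 2 * C_min) * err_tol \<le> C_min * (5 + 2 * C_min) * (?c / (4 * (C_min * (5 + 2 * C_min))))"
          using C_min_pos by (intro mult_left_mono) (auto simp: err_tol_def)
        also have "\<dots> = ?c / 4"
        proof -
          have "K * (?c / (4 * K)) = ?c / 4" if "0 < K" for K using that by simp
          moreover have "0 < C_min * (5 + 2 * C_min)" using C_min_pos by simp
          ultimately show ?thesis by blast
        qed
        finally show "C_min * (5 + 2 * C_min) * err_tol \<le> ?c / 4" .
      qed (use NE in simp)
      finally show ?thesis by simp
    qed
    then have rec: "(\<Sum>y\<in>V. p m y * ?u y) - ?c / (4 * (N * \<epsilon>)) \<le> M"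
      using \<tau>_recursion[OF m(1) x mx] m(2) by linarith
    \<comment> \<open>The term \<open>y = m\<close> vanishes, so the lower bound on \<open>p m y\<close> is used for distinct points.\<close>
    have "0 \<le> (\<Sum>y\<in>V. (p m y - ?c / N) * (?u y - M))"
    proof (intro sum_nonneg)
      fix y assume y: "y \<in> V"
      show "0 \<le> (p m y - ?c / N) * (?u y - M)"
      proof (cases "y = m")
        case True then show ?thesis using m by simp
      next
        case False
        then have "?c / N \<le> p m y"
          using P_ge_N[of "lev m y"] p_eq[OF m(1) y] lev_ge_1[OF m(1) y] lev_le[OF m(1) y] by auto
        then show ?thesis using M_le[OF y] by simp
      qed
    qed
    also have "(\<Sum>y\<in>V. (p m y - ?c / N) * (?u y - M)) =
       (\<Sum>y\<in>V. p m y * ?u y - M * p m y - ?c / N * ?u y + ?c / N * M)"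
    proof (intro sum.cong refl)
      have "(u - k) * (v - M) = u * v - M * u - k * v + k * M" for u v k
        by (simp add: algebra_simps)
      then show "(p m y - ?c / N) * (?u y - M) = p m y * ?u y - M * p m y - ?c / N * ?u y + ?c / N * M" for y .
    qed
    also have "\<dots> = (\<Sum>y\<in>V. p m y * ?u y) - M * (1 - \<epsilon>) - ?c / N * X + card V * (?c / N * M)"
      by (simp only: sum.distrib sum_subtractf sum_distrib_left[symmetric] X_def sum_constant row_sum[OF m(1)])
        (simp only: mult_ac)
    also have "card V * (?c / N * M) = ?c * M"
    proof -
      have "{y \<in> V. lev x y \<le> n} = V" using lev_le[OF x] by auto
      then have "real (card V) = N" using card_ball[OF x, of n] by simp
      then show ?thesis using q2 by simp
    qed
    finally have "M * (1 - \<epsilon>) + ?c / N * X - ?c * M \<le> (\<Sum>y\<in>V. p m y * ?u y)" by linarith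
    then have "?c / N * X - ?c / (4 * (N * \<epsilon>)) \<le> M * \<epsilon> + ?c * M"
      using rec by (simp add: algebra_simps)
    also have "\<dots> \<le> M * (1 + ?c)"
    proof -
      have "0 \<le> M" using m \<tau>_nonneg by simp
      then show ?thesis using eps by (simp add: algebra_simps mult_left_le)
    qed
    finally have 1: "?c / N * X - ?c / (4 * (N * \<epsilon>)) \<le> M * (1 + ?c)" .
    have "S \<le> \<epsilon> / (2 * (3 + 5 * C_sum))"
    proof -
      have "err_tol * \<epsilon> \<le> 1 / (2 * (3 + 5 * C_sum)) * \<epsilon>"
        using eps by (intro mult_right_mono) (auto simp: err_tol_def)
      then show ?thesis using S by simp
    qed
    then have "1 / (2 * \<epsilon>) \<le> X" unfolding X_def using x by (rule susceptibility_ge[rotated])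
    then have "?c / N * (1 / (2 * \<epsilon>)) \<le> ?c / N * X" using c N_pos by (intro mult_left_mono) auto
    moreover have "?c / N * (1 / (2 * \<epsilon>)) - ?c / (4 * (N * \<epsilon>)) = ?c / (4 * (N * \<epsilon>))"
      using N_pos eps by (simp add: field_simps)
    ultimately have "?c / (4 * (N * \<epsilon>)) \<le> M * (1 + ?c)" using 1 by linarith
    then have "?c / (4 * (N * \<epsilon>)) / (1 + ?c) \<le> M" using c by (subst pos_divide_le_eq) auto
    moreover have "?c / (4 * (N * \<epsilon>)) / (1 + ?c) = c_far / (N * \<epsilon>)" by (simp add: c_far_def mult_ac)
    ultimately show ?thesis by simp
  qed
  then show ?thesis using M_le[OF a] by linarith
qed

lemma S_le: "S \<le> C_bub * ((\<Sum>i\<le>n. real q ^ i * (t * r ^ i)\<^sup>2) + 1 / (N * \<epsilon>\<^sup>2))"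
proof -
  let ?a = "2 * (near_coeff / (1 - r))\<^sup>2" and ?S = "\<Sum>i\<le>n. real q ^ i * (w i)\<^sup>2"
  have "(maj i)\<^sup>2 \<le> ?a * (w i)\<^sup>2 + 2 * b\<^sup>2" for i
  proof -
    have "(maj i)\<^sup>2 \<le> (near_coeff / (1 - r) * w i + b)\<^sup>2"
      using maj_le maj_pos[of i] by (intro power_mono) auto
    also have "\<dots> \<le> 2 * (near_coeff / (1 - r) * w i)\<^sup>2 + 2 * b\<^sup>2"
      using sum_squares_bound[of "near_coeff / (1 - r) * w i" b] by (simp add: power2_sum)
    finally show ?thesis by (simp only: power_mult_distrib mult.assoc)
  qed
  then have "S \<le> (\<Sum>i\<le>n. real q ^ i * (?a * (w i)\<^sup>2 + 2 * b\<^sup>2))"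
    unfolding S_def by (intro sum_mono mult_left_mono) auto
  also have "\<dots> = (\<Sum>i\<le>n. ?a * (real q ^ i * (w i)\<^sup>2) + 2 * b\<^sup>2 * real q ^ i)"
    by (simp add: algebra_simps)
  also have "\<dots> = ?a * ?S + 2 * b\<^sup>2 * (\<Sum>i\<le>n. real q ^ i)"
    by (simp only: sum.distrib sum_distrib_left)
  also have "\<dots> \<le> ?a * ?S + 2 * b\<^sup>2 * (2 * N)"
    using sum_q_le by (intro add_left_mono mult_left_mono) auto
  also have "2 * b\<^sup>2 * (2 * N) = 4 * B\<^sup>2 * (1 / (N * \<epsilon>\<^sup>2))"
    using q2 by (simp add: b_def power2_eq_square)
  also have "?a * ?S + 4 * B\<^sup>2 * (1 / (N * \<epsilon>\<^sup>2)) \<le> C_bub * ?S + C_bub * (1 / (N * \<epsilon>\<^sup>2))"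
  proof (intro add_mono mult_right_mono)
    show "0 \<le> ?S" by (intro sum_nonneg) auto
  qed (auto simp: C_bub_def)
  finally show ?thesis by (simp add: distrib_left w_def)
qed

text \<open>The two smallness conditions together say that the bubble is much smaller than \<open>\<epsilon>\<close>: the first concerns
short cycles, the second says that \<open>\<epsilon>\<close> is outside the critical window \<open>N powr (- 1 / 3)\<close>.\<close>

theorem \<tau>_lower:
  assumes "x \<in> V" "a \<in> V" 
    and 1: "(\<Sum>i\<le>n. real q ^ i * (t * r ^ i)\<^sup>2) \<le> \<delta> * \<epsilon>"
    and 2: "1 / (N * \<epsilon> ^ 3) \<le> \<delta>"
  shows "c_far / (N * \<epsilon>) \<le> \<tau> V a x"
proof (rule \<tau>_lower_aux)
  have "1 / (N * \<epsilon>\<^sup>2) = 1 / (N * \<epsilon> ^ 3) * \<epsilon>" using eps by (simp add: power3_eq_cube power2_eq_square)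
  also have "\<dots> \<le> \<delta> * \<epsilon>" using 2 eps by (intro mult_right_mono) auto
  finally have "(\<Sum>i\<le>n. real q ^ i * (t * r ^ i)\<^sup>2) + 1 / (N * \<epsilon>\<^sup>2) \<le> 2 * (\<delta> * \<epsilon>)" using 1 by linarith
  then have "S \<le> C_bub * (2 * (\<delta> * \<epsilon>))"
    using S_le mult_left_mono[OF _ C_bub_nonneg] by (meson order_trans)
  also have "\<dots> = (2 * C_bub) * \<delta> * \<epsilon>" by simp
  also have "\<dots> \<le> err_tol * \<epsilon>"
  proof (rule mult_right_mono)
    have "(1 + 2 * C_bub) * \<delta> = err_tol" using C_bub_nonneg by (simp add: \<delta>_def)
    moreover have "0 \<le> \<delta>" using C_bub_nonneg err_tol_pos by (simp add: \<delta>_def)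
    ultimately show "2 * C_bub * \<delta> \<le> err_tol" by (simp add: distrib_right)
  qed (use eps in simp)
  finally show "S \<le> err_tol * \<epsilon>" .
  have "\<epsilon> ^ 3 \<le> \<epsilon>" using eps power_decreasing[of 1 3 \<epsilon>] by simp
  then have "1 / (N * \<epsilon>) \<le> 1 / (N * \<epsilon> ^ 3)" using eps N_pos by (intro divide_left_mono) auto
  also have "\<dots> \<le> \<delta>" by (rule 2)
  also have "\<delta> \<le> err_tol" using C_bub_nonneg err_tol_pos by (simp add: \<delta>_def pos_divide_le_eq mult_left_le)
  finally show "1 / (N * \<epsilon>) \<le> err_tol" .
qed (use assms in auto)


end

section \<open>Boxes of the hierarchical lattice as an ultrametric space\<close>

lemma hbox_iff:
  assumes L: "L \<ge> 2"
  shows "x \<in> hbox L d n \<longleftrightarrow> x 0 = undefined \<and> (\<forall>i\<in>{1..n}. x i \<in> carrier (zmod_power L d)) \<and>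
    (\<forall>i>n. x i = \<one>\<^bsub>zmod_power L d\<^esub>)" (is "_ \<longleftrightarrow> ?R")
proof
  assume x: "x \<in> hbox L d n"
  then have xc: "x \<in> carrier (hier_group L d)" by (simp add: hbox_def)
  then have "x 0 = undefined" "\<forall>i\<in>{1..n}. x i \<in> carrier (zmod_power L d)"
    by (auto simp: carrier_hier_group PiE_iff extensional_def)
  moreover have "\<forall>i>n. x i = \<one>\<^bsub>zmod_power L d\<^esub>"
    using x hnorm_le_iff[OF L xc] by (simp add: hbox_def one_hier_group)
  ultimately show ?R by blast
next
  assume R: ?R
  interpret Z: group "zmod_power L d" by simp
  have "x i \<in> carrier (zmod_power L d)" if "1 \<le> i" for i
    using R that Z.one_closed by (cases "i \<le> n") auto
  moreover have "finite {i \<in> {1..}. x i \<noteq> \<one>\<^bsub>zmod_power L d\<^esub>}"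
  proof (rule finite_subset)
    show "{i \<in> {1..}. x i \<noteq> \<one>\<^bsub>zmod_power L d\<^esub>} \<subseteq> {1..n}" using R leI by auto
  qed simp
  moreover have "x i = undefined" if "\<not> 1 \<le> i" for i using R that by (cases i) auto
  ultimately have xc: "x \<in> carrier (hier_group L d)"
    by (auto simp: carrier_hier_group PiE_iff extensional_def)
  have "hnorm L d x \<le> real L ^ n"
    unfolding hnorm_le_iff[OF L xc] using R by (auto simp: one_hier_group)
  then show "x \<in> hbox L d n" using xc by (simp add: hbox_def)
qed

text \<open>The logarithm to base \<open>L\<close> of the hierarchical distance, for distinct points of a
box. The inserted \<open>0\<close> is the value on the diagonal, where no coordinates differ.\<close>

definition hlevel :: "(nat \<Rightarrow> 'a) \<Rightarrow> (nat \<Rightarrow> 'a) \<Rightarrow> nat"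
  where "hlevel x y = Max (insert 0 {i. x i \<noteq> y i})"

lemma hlevel_sym: "hlevel x y = hlevel y x"
  unfolding hlevel_def by (simp add: eq_commute)

lemma finite_diff_hbox:
  assumes "L \<ge> 2" "x \<in> hbox L d n" "y \<in> hbox L d n"
  shows "finite {i. x i \<noteq> y i}"
proof (rule finite_subset)
  have "x i = y i" if "n < i" for i using assms that by (simp add: hbox_iff)
  then show "{i. x i \<noteq> y i} \<subseteq> {..n}" using leI by auto
qed simp

lemma hlevel_le_iff:
  assumes "L \<ge> 2" "x \<in> hbox L d n" "y \<in> hbox L d n"
  shows "hlevel x y \<le> j \<longleftrightarrow> (\<forall>i>j. x i = y i)"
proof -
  have "hlevel x y \<le> j \<longleftrightarrow> (\<forall>i. x i \<noteq> y i \<longrightarrow> i \<le> j)"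
    unfolding hlevel_def using finite_diff_hbox[OF assms] by simp
  then show ?thesis by (meson leD leI)
qed

lemma hlevel_le:
  assumes "L \<ge> 2" "x \<in> hbox L d n" "y \<in> hbox L d n"
  shows "hlevel x y \<le> n"
  using assms by (simp add: hlevel_le_iff[OF assms] hbox_iff)

lemma hlevel_0_iff:
  assumes "L \<ge> 2" "x \<in> hbox L d n" "y \<in> hbox L d n"
  shows "hlevel x y = 0 \<longleftrightarrow> x = y"
proof -
  have "hlevel x y = 0 \<longleftrightarrow> (\<forall>i>0. x i = y i)"
    using hlevel_le_iff[OF assms, of 0] by simp
  also have "\<dots> \<longleftrightarrow> (\<forall>i. x i = y i)"
    using assms by (simp add: hbox_iff) (metis gr0I)
  finally show ?thesis by auto
qed

lemma hlevel_ultrametric: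
  assumes "L \<ge> 2" "x \<in> hbox L d n" "y \<in> hbox L d n" "z \<in> hbox L d n"
  shows "hlevel x z \<le> max (hlevel x y) (hlevel y z)"
proof -
  let ?m = "max (hlevel x y) (hlevel y z)"
  have "\<forall>i>?m. x i = y i" using hlevel_le_iff[OF assms(1,2,3), of ?m] by simp
  moreover have "\<forall>i>?m. y i = z i" using hlevel_le_iff[OF assms(1,3,4), of ?m] by simp
  ultimately show ?thesis unfolding hlevel_le_iff[OF assms(1,2,4)] by simp
qed

lemma card_hlevel_ball:
  assumes L: "L \<ge> 2" and a: "a \<in> hbox L d n" and j: "j \<le> n"
  shows "card {y \<in> hbox L d n. hlevel a y \<le> j} = (L ^ d) ^ j"
proof -
  let ?f = "\<lambda>y i. if i \<le> j then y i else \<one>\<^bsub>zmod_power L d\<^esub>" and ?g = "\<lambda>y i. if i \<le> j then y i else a i"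
  have B: "{y \<in> hbox L d n. hlevel a y \<le> j} = {y \<in> hbox L d n. \<forall>i>j. a i = y i}"
    using hlevel_le_iff[OF L a] by auto
  have "bij_betw ?f {y \<in> hbox L d n. \<forall>i>j. a i = y i} (hbox L d j)"
  proof (rule bij_betw_byWitness[where f' = ?g])
    show "?f ` {y \<in> hbox L d n. \<forall>i>j. a i = y i} \<subseteq> hbox L d j"
      using L j by (auto simp: hbox_iff)
    show "?g ` hbox L d j \<subseteq> {y \<in> hbox L d n. \<forall>i>j. a i = y i}"
      using L j a by (auto simp: hbox_iff)
  qed (use L in \<open>auto simp: hbox_iff fun_eq_iff\<close>)
  then have "card {y \<in> hbox L d n. hlevel a y \<le> j} = card (hbox L d j)"
    unfolding B by (rule bij_betw_same_card)
  then show ?thesis using card_hbox(1)[OF L] by (simp add: power_mult[symmetric] mult.commute)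
qed

lemma one_in_hbox: "\<one>\<^bsub>hier_group L d\<^esub> \<in> hbox L d n"
  using group.is_monoid[OF group_hier_group, of L d] by (simp add: hbox_def hnorm_def monoid.one_closed)

lemma hdist_eq_hlevel:
  assumes L: "L \<ge> 2" and x: "x \<in> hbox L d n" and y: "y \<in> hbox L d n" and ne: "x \<noteq> y"
  shows "hdist L d x y = real L ^ hlevel x y"
proof -
  interpret G: group "hier_group L d" by simp
  interpret Z: group "zmod_power L d" by simp
  let ?z = "x \<otimes>\<^bsub>hier_group L d\<^esub> inv\<^bsub>hier_group L d\<^esub> y"
  have xy: "x \<in> carrier (hier_group L d)" "y \<in> carrier (hier_group L d)"
    using x y by (auto simp: hbox_def)
  then have c: "x i \<in> carrier (zmod_power L d)" "y i \<in> carrier (zmod_power L d)" if "1 \<le> i" for i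
    using that by (auto simp: carrier_hier_group PiE_iff)
  have iv: "inv\<^bsub>hier_group L d\<^esub> y = (\<lambda>i\<in>{1..}. inv\<^bsub>zmod_power L d\<^esub> y i)"
    using xy by (simp add: hier_group_def)
  have z: "?z = (\<lambda>i\<in>{1..}. x i \<otimes>\<^bsub>zmod_power L d\<^esub> inv\<^bsub>zmod_power L d\<^esub> y i)"
    unfolding iv by (auto simp: hier_group_def fun_eq_iff)
  have z1: "?z i = \<one>\<^bsub>zmod_power L d\<^esub> \<longleftrightarrow> x i = y i" if "1 \<le> i" for i
  proof -
    have "?z i = x i \<otimes>\<^bsub>zmod_power L d\<^esub> inv\<^bsub>zmod_power L d\<^esub> y i" using z that by simp
    then show ?thesis
      using c[OF that] Z.right_cancel[of "inv\<^bsub>zmod_power L d\<^esub> y i" "x i" "y i"] by simp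
  qed
  have x0: "x 0 = y 0" using x y L by (simp add: hbox_iff)
  have S: "{i. 1 \<le> i \<and> ?z i \<noteq> \<one>\<^bsub>zmod_power L d\<^esub>} = {i. x i \<noteq> y i}"
  proof (intro Collect_cong)
    fix i show "(1 \<le> i \<and> ?z i \<noteq> \<one>\<^bsub>zmod_power L d\<^esub>) \<longleftrightarrow> x i \<noteq> y i"
      using z1[of i] x0 by (cases i) auto
  qed
  have ne': "{i. x i \<noteq> y i} \<noteq> {}" using ne by auto
  have "?z \<noteq> \<one>\<^bsub>hier_group L d\<^esub>"
    using ne xy G.right_cancel[of "inv\<^bsub>hier_group L d\<^esub> y" x y] by simp
  then have "hdist L d x y = real L ^ Max {i. x i \<noteq> y i}"
    by (simp add: hdist_def hnorm_def S[simplified])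
  also have "Max {i. x i \<noteq> y i} = hlevel x y"
    unfolding hlevel_def using finite_diff_hbox[OF L x y] ne' by simp
  finally show ?thesis .
qed

lemma hnorm_eq_hlevel:
  assumes L: "L \<ge> 2" and x: "x \<in> hbox L d n" and ne: "x \<noteq> \<one>\<^bsub>hier_group L d\<^esub>"
  shows "hnorm L d x = real L ^ hlevel \<one>\<^bsub>hier_group L d\<^esub> x"
proof -
  interpret G: group "hier_group L d" by simp
  have "hnorm L d x = hdist L d x \<one>\<^bsub>hier_group L d\<^esub>"
    using x by (simp add: hdist_def hbox_def)
  then show ?thesis using hdist_eq_hlevel[OF L x one_in_hbox ne] hlevel_sym by metis
qed

section \<open>The critical rate and the effect of the cutoff\<close>

lemma one_minus_exp_ge:
  fixes y :: real assumes "0 \<le> y" shows "y / (1 + y) \<le> 1 - exp (- y)"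
proof -
  have "exp (- y) \<le> 1 / (1 + y)"
    unfolding exp_minus inverse_eq_divide using assms exp_ge_add_one_self[of y]
    by (intro divide_left_mono) auto
  also have "\<dots> = 1 - y / (1 + y)" using assms by (simp add: field_simps)
  finally show ?thesis by simp
qed

lemma one_minus_exp_ge_half:
  fixes y :: real assumes "0 \<le> y" "y \<le> 1" shows "y / 2 \<le> 1 - exp (- y)"
proof -
  have "y / 2 \<le> y / (1 + y)" using assms by (intro divide_left_mono) auto
  then show ?thesis using one_minus_exp_ge[of y] assms by linarith
qed

lemma one_minus_exp_le: "1 - exp (- y) \<le> (y :: real)"
  using exp_ge_add_one_self[of "- y"] by simp

text \<open>The equation that determines the rate \<open>t\<close>, the inverse of \<open>\<zeta>\<^sub>n\<close>, says that the mean degree is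
exactly \<open>1\<close>; \<open>R i\<close> stands for the kernel at distance \<open>L ^ i\<close>.\<close>

locale critical_rate =
  fixes q n :: nat and R :: "nat \<Rightarrow> real" and t r A\<^sub>1 A\<^sub>2 :: real
  assumes q2: "2 \<le> q" and n1: "1 \<le> n" and N4: "4 \<le> real q ^ n"
    and r: "0 < r" "r < 1" "1 < q * r"
    and A: "0 < A\<^sub>1" "A\<^sub>1 \<le> A\<^sub>2"
    and R_ge: "\<And>i. A\<^sub>1 * r ^ i \<le> R i" and R_le: "\<And>i. R i \<le> A\<^sub>2 * r ^ i"
    and t_pos: "0 < t"
    and critical: "(\<Sum>i=1..n. (real q - 1) * real q ^ (i - 1) * (1 - exp (- (t * R i)))) = 1"
begin

abbreviation s :: real where "s \<equiv> real q * r"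

lemma R_pos: "0 < R i"
proof -
  have "0 < A\<^sub>1 * r ^ i" using A r by simp
  then show ?thesis using R_ge[of i] by linarith
qed

lemma half_N: "real q ^ n / 2 \<le> (real q - 1) * real q ^ (n - 1)"
proof -
  have "real q ^ n = real q * real q ^ (n - 1)" using n1 by (cases n) auto
  moreover have "real q * real q ^ (n - 1) \<le> 2 * (real q - 1) * real q ^ (n - 1)"
    using q2 by (intro mult_right_mono) auto
  ultimately show ?thesis by (simp add: algebra_simps)
qed

text \<open>The top level contributes at most \<open>1\<close> to the mean degree. Since its spheres have at least \<open>N / 2\<close> points,
each top edge has probability at most \<open>2 / N\<close>.\<close>

lemma t_upper: "t * s ^ n \<le> 4 / A\<^sub>1"
proof -
  let ?y = "t * R n"
  have y: "0 < ?y" using t_pos R_pos by simp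
  have "real q ^ n / 2 * (1 - exp (- ?y)) \<le> (real q - 1) * real q ^ (n - 1) * (1 - exp (- ?y))"
    using half_N y by (intro mult_right_mono) auto
  also have "\<dots> \<le> (\<Sum>i=1..n. (real q - 1) * real q ^ (i - 1) * (1 - exp (- (t * R i))))"
    using n1 q2 t_pos R_pos
    by (intro member_le_sum[of n _ "\<lambda>i. (real q - 1) * real q ^ (i - 1) * (1 - exp (- (t * R i)))"])
       (auto simp: less_imp_le)
  also have "\<dots> = 1" by (rule critical)
  finally have "real q ^ n / 2 * (1 - exp (- ?y)) \<le> 1" .
  moreover have "real q ^ n / 2 * (?y / (1 + ?y)) \<le> real q ^ n / 2 * (1 - exp (- ?y))"
    using one_minus_exp_ge[of ?y] y by (intro mult_left_mono) auto
  ultimately have "real q ^ n / 2 * (?y / (1 + ?y)) \<le> 1" by linarith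
  then have 1: "real q ^ n * ?y \<le> 2 * (1 + ?y)" using y by (simp add: field_simps)
  have "4 * ?y \<le> real q ^ n * ?y" using N4 y by (intro mult_right_mono) auto
  then have "?y \<le> 1" using 1 by simp
  then have 2: "real q ^ n * ?y \<le> 4" using 1 by simp
  have "A\<^sub>1 * (t * s ^ n) = real q ^ n * (t * (A\<^sub>1 * r ^ n))" by (simp add: power_mult_distrib)
  also have "\<dots> \<le> real q ^ n * ?y"
    using R_ge[of n] t_pos by (intro mult_left_mono) auto
  finally show ?thesis using 2 A by (simp add: field_simps)
qed

text \<open>The mean degree is at most \<open>t * A\<^sub>2 * (\<Sum>i\<le>n. s ^ i)\<close>, a geometric sum dominated by its last term.\<close>

lemma t_lower: "(s - 1) / (A\<^sub>2 * s) \<le> t * s ^ n"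
proof -
  have "1 = (\<Sum>i=1..n. (real q - 1) * real q ^ (i - 1) * (1 - exp (- (t * R i))))"
    by (rule critical[symmetric])
  also have "\<dots> \<le> (\<Sum>i=1..n. t * A\<^sub>2 * s ^ i)"
  proof (rule sum_mono)
    fix i assume i: "i \<in> {1..n}"
    have "(real q - 1) * real q ^ (i - 1) \<le> real q * real q ^ (i - 1)"
      by (intro mult_right_mono) auto
    also have "\<dots> = real q ^ i" using i by (cases i) auto
    finally have "(real q - 1) * real q ^ (i - 1) * (1 - exp (- (t * R i))) \<le> real q ^ i * (t * (A\<^sub>2 * r ^ i))"
      using t_pos R_pos[of i] R_le[of i] 
      by (intro mult_mono order_trans[OF one_minus_exp_le]) (auto simp: less_imp_le)
    then show "(real q - 1) * real q ^ (i - 1) * (1 - exp (- (t * R i))) \<le> t * A\<^sub>2 * s ^ i"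
      by (simp add: power_mult_distrib mult_ac)
  qed
  also have "\<dots> \<le> (\<Sum>i<Suc n. t * A\<^sub>2 * s ^ i)"
    using t_pos A r by (intro sum_mono2) auto
  also have "\<dots> = t * A\<^sub>2 * ((s ^ Suc n - 1) / (s - 1))"
  proof -
    have "(\<Sum>i<Suc n. s ^ i) = (s ^ Suc n - 1) / (s - 1)" using r by (intro geometric_sum) auto
    then show ?thesis by (simp only: sum_distrib_left[symmetric])
  qed
  also have "\<dots> \<le> t * A\<^sub>2 * (s ^ Suc n / (s - 1))"
    using t_pos A r by (intro mult_left_mono divide_right_mono) auto
  finally have 1: "1 \<le> t * A\<^sub>2 * (s ^ Suc n / (s - 1))" .
  have "0 \<le> (s - 1) / (A\<^sub>2 * s)" using A r by simp
  from mult_left_mono[OF 1 this]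
  have "(s - 1) / (A\<^sub>2 * s) \<le> (s - 1) / (A\<^sub>2 * s) * (t * A\<^sub>2 * (s ^ Suc n / (s - 1)))" by simp
  also have "\<dots> = t * s ^ n" using A r q2 by simp
  finally show ?thesis .
qed

text \<open>Subtracting \<open>r ^ n * \<eta>\<close> from the kernel makes the mean degree drop from \<open>1\<close> to \<open>1 - \<epsilon>\<close>, with \<open>\<epsilon>\<close> of
order \<open>\<eta>\<close>: the top level dominates, where \<open>N\<close> edges lose \<open>t * r ^ n * \<eta>\<close> each, and \<open>N * t * r ^ n\<close> is of order \<open>1\<close>.\<close>

context
  fixes \<eta> :: real
  assumes eta: "0 < \<eta>" "\<eta> \<le> A\<^sub>1 / 2" and t_small: "t * A\<^sub>2 \<le> 1"
begin

definition P :: "nat \<Rightarrow> real" where "P i = 1 - exp (- (t * max (R i - r ^ n * \<eta>) 0))"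

lemma r_pow_le_1: "r ^ i \<le> 1" using r by (intro power_le_one) auto

lemma P_upper: "P i \<le> A\<^sub>2 * (t * r ^ i)"
proof -
  have "P i \<le> t * max (R i - r ^ n * \<eta>) 0" unfolding P_def by (rule one_minus_exp_le)
  also have "\<dots> \<le> t * (A\<^sub>2 * r ^ i)"
    using R_le[of i] R_pos[of i] t_pos eta r by (intro mult_left_mono) (auto intro: order_trans[of _ "R i"])
  finally show ?thesis by (simp add: mult_ac)
qed

lemma R_minus: "i \<le> n \<Longrightarrow> A\<^sub>1 / 2 * r ^ i \<le> R i - r ^ n * \<eta>"
proof -
  assume i: "i \<le> n"
  have "r ^ n * \<eta> \<le> r ^ i * (A\<^sub>1 / 2)"
    using i r eta by (intro mult_mono power_decreasing) auto
  then show ?thesis using R_ge[of i] by (simp add: field_simps)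
qed

lemma P_lower: "i \<le> n \<Longrightarrow> A\<^sub>1 / 4 * (t * r ^ i) \<le> P i"
proof -
  assume i: "i \<le> n"
  let ?y = "t * max (R i - r ^ n * \<eta>) 0"
  have "t * (A\<^sub>1 / 2 * r ^ i) \<le> ?y"
    by (intro mult_left_mono order_trans[OF R_minus[OF i] max.cobounded1]) (use t_pos in auto)
  moreover have "?y / 2 \<le> P i"
  proof -
    have "R i \<le> A\<^sub>2 * 1"
      by (rule order_trans[OF R_le mult_left_mono[OF r_pow_le_1]]) (use A in auto)
    moreover have "0 \<le> r ^ n * \<eta>" using r eta by simp
    ultimately have "?y \<le> t * (A\<^sub>2 * 1)"
      using t_pos A by (intro mult_left_mono) auto
    then have "?y \<le> 1" using t_small by linarith
    then show ?thesis unfolding P_def using t_pos by (intro one_minus_exp_ge_half) auto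
  qed
  ultimately show ?thesis by (simp add: mult_ac)
qed

lemma P_nonneg: "0 \<le> P i" and P_le_1: "P i \<le> 1"
  using t_pos by (simp_all add: P_def)

definition \<epsilon> :: real where "\<epsilon> = 1 - (\<Sum>i=1..n. (real q - 1) * real q ^ (i - 1) * P i)"

lemma eps_eq: "\<epsilon> = (\<Sum>i=1..n. (real q - 1) * real q ^ (i - 1) * (1 - exp (- (t * R i)) - P i))"
proof -
  have "(\<Sum>i=1..n. (real q - 1) * real q ^ (i - 1) * (1 - exp (- (t * R i)) - P i)) =
    (\<Sum>i=1..n. (real q - 1) * real q ^ (i - 1) * (1 - exp (- (t * R i))) - (real q - 1) * real q ^ (i - 1) * P i)"
    by (simp only: right_diff_distrib)
  also have "\<dots> = \<epsilon>" unfolding sum_subtractf critical \<epsilon>_def ..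
  finally show ?thesis ..
qed

lemma eps_le_1: "\<epsilon> \<le> 1"
  using P_nonneg q2 by (simp add: \<epsilon>_def sum_nonneg)

lemma gap: 
  assumes "i \<le> n"
  shows "1 - exp (- (t * R i)) - P i = exp (- (t * R i)) * (exp (t * (r ^ n * \<eta>)) - 1)"
proof -
  have "0 \<le> A\<^sub>1 / 2 * r ^ i" using A r by simp
  then have "P i = 1 - exp (- (t * (R i - r ^ n * \<eta>)))" using R_minus[OF assms] by (simp add: P_def)
  also have "exp (- (t * (R i - r ^ n * \<eta>))) = exp (- (t * R i)) * exp (t * (r ^ n * \<eta>))"
    by (simp add: exp_add[symmetric] algebra_simps)
  finally show ?thesis by (simp add: algebra_simps)
qed

lemma eps_upper: "\<epsilon> \<le> t * s ^ n * \<eta>"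
proof -
  let ?g = "t * (r ^ n * \<eta>)"
  have "\<epsilon> \<le> (\<Sum>i=1..n. (real q - 1) * real q ^ (i - 1) * ?g)"
    unfolding eps_eq
  proof (intro sum_mono mult_left_mono)
    fix i assume i: "i \<in> {1..n}"
    let ?y = "t * (R i - r ^ n * \<eta>)"
    have "0 \<le> A\<^sub>1 / 2 * r ^ i" using A r by simp
    then have "0 \<le> ?y" using R_minus[of i] t_pos i by simp
    have "1 - exp (- (t * R i)) - P i = exp (- ?y) * (1 - exp (- ?g))"
      using gap[of i] i by (simp add: right_diff_distrib exp_add[symmetric] algebra_simps)
    also have "\<dots> \<le> 1 * ?g"
      using \<open>0 \<le> ?y\<close> t_pos eta r by (intro mult_mono one_minus_exp_le) auto
    finally show "1 - exp (- (t * R i)) - P i \<le> ?g" by simp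
  qed (use q2 in auto)
  also have "\<dots> = (\<Sum>i=1..n. (real q - 1) * real q ^ (i - 1)) * ?g" by (simp only: sum_distrib_right)
  also have "\<dots> \<le> real q ^ n * ?g"
  proof (intro mult_right_mono)
    have "(\<Sum>i=1..m. (real q - 1) * real q ^ (i - 1)) = real q ^ m - 1" for m
      by (induction m) (auto simp: algebra_simps)
    then show "(\<Sum>i=1..n. (real q - 1) * real q ^ (i - 1)) \<le> real q ^ n" by simp
  qed (use t_pos eta r in auto)
  finally show ?thesis by (simp add: power_mult_distrib mult_ac)
qed

lemma eps_lower: "t * s ^ n * \<eta> / 6 \<le> \<epsilon>"
proof -
  let ?g = "t * (r ^ n * \<eta>)"
  have g: "0 < ?g" using t_pos r eta by simp
  have "t * R n \<le> t * (A\<^sub>2 * 1)"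
    by (intro mult_left_mono order_trans[OF R_le mult_left_mono[OF r_pow_le_1]]) (use t_pos A in auto)
  then have "exp (- 1) \<le> exp (- (t * R n))" using t_small by simp
  moreover have "(1 / 3 :: real) \<le> exp (- 1)"
    using exp_le by (simp add: exp_minus field_simps)
  ultimately have e: "1 / 3 \<le> exp (- (t * R n))" by linarith
  have "t * s ^ n * \<eta> / 6 = real q ^ n / 2 * (1 / 3 * ?g)" by (simp add: power_mult_distrib)
  also have "\<dots> \<le> (real q - 1) * real q ^ (n - 1) * (exp (- (t * R n)) * (exp ?g - 1))"
  proof -
    have "?g \<le> exp ?g - 1" using exp_ge_add_one_self[of ?g] by linarith
    then show ?thesis using half_N e g q2 by (intro mult_mono) auto
  qed
  also have "\<dots> = (real q - 1) * real q ^ (n - 1) * (1 - exp (- (t * R n)) - P n)"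
    using gap[of n] by simp
  also have "\<dots> \<le> \<epsilon>"
    unfolding eps_eq using n1 q2 g gap
    by (intro member_le_sum[of n _ "\<lambda>i. (real q - 1) * real q ^ (i - 1) * (1 - exp (- (t * R i)) - P i)"])
       (auto simp: less_imp_le)
  finally show ?thesis .
qed

end

end

section \<open>Two-sided bounds for the connection probability\<close>

lemma zeta_critical:
  assumes L: "L \<ge> 2" and d: "d \<ge> 1" and n: "n \<ge> 1" "real L ^ (n * d) > 2"
    and A: "0 < A1" and \<rho>: "\<rho> \<in> kernels A1 A2 \<alpha>"
  shows "0 < inverse (zeta L d \<rho> n)"
    and "(\<Sum>i=1..n. (real (L ^ d) - 1) * real (L ^ d) ^ (i - 1) *
      (1 - exp (- (inverse (zeta L d \<rho> n) * \<rho> (real L ^ i))))) = 1"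
proof -
  let ?t = "inverse (zeta L d \<rho> n)"
  have *: "zeta L d \<rho> n > 0 \<and> (real L ^ d - 1) *
      (\<Sum>i=1..n. real L ^ ((i - 1) * d) * exp (- (?t * \<rho> (real L ^ i)))) = real L ^ (n * d) - 2"
    unfolding zeta_def by (rule theI'[OF zeta_ex1[OF L d n A \<rho>]])
  then show "0 < ?t" by simp
  have geo: "(real L ^ d - 1) * (\<Sum>i=1..m. real L ^ ((i - 1) * d)) = real L ^ (m * d) - 1" for m
    by (induction m) (auto simp: algebra_simps power_add)
  have "(\<Sum>i=1..n. (real (L ^ d) - 1) * real (L ^ d) ^ (i - 1) * (1 - exp (- (?t * \<rho> (real L ^ i))))) =
    (\<Sum>i=1..n. (real L ^ d - 1) * real L ^ ((i - 1) * d) -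
      (real L ^ d - 1) * (real L ^ ((i - 1) * d) * exp (- (?t * \<rho> (real L ^ i)))))"
    by (intro sum.cong refl) (simp add: algebra_simps flip: power_mult)
  also have "\<dots> = 1"
    unfolding sum_subtractf sum_distrib_left[symmetric] using * geo[of n] by simp
  finally show "(\<Sum>i=1..n. (real (L ^ d) - 1) * real (L ^ d) ^ (i - 1) *
      (1 - exp (- (?t * \<rho> (real L ^ i))))) = 1" .
qed

lemma power_powr: "(x ^ i) powr a = (x powr a) ^ i" if "0 < (x :: real)"
  using that by (simp add: powr_realpow[symmetric] powr_powr powr_power mult.commute)

text \<open>The sum is geometric with ratio \<open>q * r\<^sup>2\<close>, which may lie on either side of \<open>1\<close>; in both cases every term is
at most the sum of the first and the last one.\<close>

lemma bubble_le:
  fixes t C s r q :: real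
  assumes q: "0 < q" and r: "0 < r" and t: "0 \<le> t" "t * (q * r) ^ n \<le> C"
  shows "(\<Sum>i\<le>n. q ^ i * (t * r ^ i)\<^sup>2) \<le> C\<^sup>2 * ((real n + 1) * ((1 / (q * r)\<^sup>2) ^ n + (1 / q) ^ n))"
proof -
  let ?x = "q * r\<^sup>2"
  have x: "?x ^ i \<le> 1 + ?x ^ n" if "i \<le> n" for i
  proof (cases "?x \<le> 1")
    case True
    then have "?x ^ i \<le> 1" using q by (intro power_le_one) auto
    then show ?thesis using q by (simp add: add_increasing2)
  next
    case False
    then have "?x ^ i \<le> ?x ^ n" using that by (intro power_increasing) auto
    then show ?thesis by simp
  qed
  have tC: "t \<le> C / (q * r) ^ n" using t q r by (simp add: pos_le_divide_eq)
  have "(\<Sum>i\<le>n. q ^ i * (t * r ^ i)\<^sup>2) = (\<Sum>i\<le>n. t\<^sup>2 * ?x ^ i)"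
    by (intro sum.cong refl) (simp add: power_mult_distrib power_even_eq flip: power_mult)
  also have "\<dots> \<le> (\<Sum>i\<le>n. t\<^sup>2 * (1 + ?x ^ n))"
    using x by (intro sum_mono mult_left_mono) auto
  also have "\<dots> = t\<^sup>2 * ((real n + 1) * (1 + ?x ^ n))" by (simp add: algebra_simps)
  also have "\<dots> \<le> (C / (q * r) ^ n)\<^sup>2 * ((real n + 1) * (1 + ?x ^ n))"
    using tC t q by (intro mult_right_mono power_mono) auto
  also have "\<dots> = C\<^sup>2 * ((real n + 1) * ((1 / (q * r)\<^sup>2) ^ n + (1 / (q * r)\<^sup>2) ^ n * ?x ^ n))"
  proof -
    have "(C / (q * r) ^ n)\<^sup>2 = C\<^sup>2 * (1 / (q * r)\<^sup>2) ^ n"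
      by (simp add: power_divide power_mult[symmetric] mult.commute[of n 2])
    moreover have "(C\<^sup>2 * Y) * (M * (1 + X)) = C\<^sup>2 * (M * (Y + Y * X))" for X Y M :: real
      by (simp add: algebra_simps)
    ultimately show ?thesis by (simp only:)
  qed
  also have "(1 / (q * r)\<^sup>2) ^ n * ?x ^ n = (1 / q) ^ n"
    unfolding power_mult_distrib[symmetric] using q r
    by (simp add: power2_eq_square)
  finally show ?thesis .
qed

text \<open>In a fixed volume satisfying explicit smallness conditions. Here \<open>g\<close> is the probability of a
direct edge up to constants, and \<open>1 / (q * \<eta>) ^ n\<close> is of order \<open>1 / (N * \<epsilon>)\<close>.\<close>

lemma finite_volume_bounds:
  fixes L d n :: nat and A1 A2 \<alpha> \<theta> :: real and \<rho> :: "real \<Rightarrow> real"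
  defines "q \<equiv> L ^ d" and "r \<equiv> real L powr (- \<alpha>)" and "\<eta> \<equiv> real L powr (\<alpha> - \<theta>)"
    and "t \<equiv> inverse (zeta L d \<rho> n)"
  defines "s \<equiv> real q * r"
  defines "c2 \<equiv> (s - 1) / (A2 * s)" and "C2 \<equiv> 4 / A1"
  defines "\<delta> \<equiv> hierarchical_constants.\<delta> q r A2 (A1 / 4) c2 C2"
    and "a0 \<equiv> hierarchical_constants.near_coeff A2 (A1 / 4) c2"
    and "B \<equiv> hierarchical_constants.B q r A2 (A1 / 4) c2 C2"
    and "c_far \<equiv> hierarchical_constants.c_far (A1 / 4) c2"
  assumes d: "d \<ge> 1" and L: "L \<ge> 2" and A: "0 < A1" "A1 \<le> A2" and \<alpha>: "0 < \<alpha>" "\<alpha> < real d"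
    and \<rho>: "\<rho> \<in> kernels A1 A2 \<alpha>" and n: "n \<ge> 1"
    and N4: "4 \<le> real q ^ n" and eta_small: "\<eta> ^ n \<le> A1 / 2" and s_small: "C2 * A2 * (1 / s) ^ n \<le> 1"
    and bubble: "C2\<^sup>2 * ((real n + 1) * ((1 / s\<^sup>2) ^ n + (1 / q) ^ n)) \<le> \<delta> * (c2 / 6) * \<eta> ^ n"
    and window: "(6 / c2) ^ 3 * (1 / (q * \<eta> ^ 3)) ^ n \<le> \<delta>"
    and x: "x \<in> hbox L d n" "x \<noteq> \<one>\<^bsub>hier_group L d\<^esub>"
  defines "u \<equiv> conn_prob L d \<theta> \<rho> n \<one>\<^bsub>hier_group L d\<^esub> x"
    and "g \<equiv> t * hnorm L d x powr (- \<alpha>)"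
  shows "u \<le> a0 / (1 - r) * g + 6 * B / c2 * (1 / (q * \<eta>) ^ n)"
    and "A1 / 4 * g \<le> u"
    and "c_far / C2 * (1 / (q * \<eta>) ^ n) \<le> u"
    and "c2 \<le> t * s ^ n" "t * s ^ n \<le> C2"
proof -
  let ?V = "hbox L d n" and ?pr = "edge_prob L d \<theta> \<rho> n" and ?o = "\<one>\<^bsub>hier_group L d\<^esub>"
  define R where "R i = \<rho> (real L ^ i)" for i
  have q2: "2 \<le> q"
  proof -
    have "L ^ 1 \<le> L ^ d" using L d by (intro power_increasing) auto
    then show ?thesis using L by (simp add: q_def)
  qed
  have L0: "0 < real L" "1 < real L" using L by auto
  have r: "0 < r" "r < 1" using L0 \<alpha> by (auto simp: r_def powr_less_one)
  have s_eq: "s = real L powr (real d - \<alpha>)"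
    using L0 by (simp add: s_def q_def r_def powr_diff powr_minus powr_realpow divide_inverse)
  have s1: "1 < s" unfolding s_eq using powr_less_mono[of 0 "real d - \<alpha>" "real L"] L0 \<alpha> by simp
  have c2: "0 < c2" using s1 A by (simp add: c2_def)
  have C2: "0 < C2" using A by (simp add: C2_def)
  have eta: "0 < \<eta>" using L0 by (simp add: \<eta>_def)
  have N2: "2 < real L ^ (n * d)"
    using N4 by (simp add: q_def power_mult[symmetric] mult.commute)
  have t: "0 < t" "(\<Sum>i=1..n. (real q - 1) * real q ^ (i - 1) * (1 - exp (- (t * R i)))) = 1"
    using zeta_critical[OF L d n N2 A(1) \<rho>] by (simp_all add: t_def q_def R_def)
  have R: "A1 * r ^ i \<le> R i" "R i \<le> A2 * r ^ i" for i
  proof -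
    have "1 \<le> real L ^ i" using L by simp
    then show "A1 * r ^ i \<le> R i" "R i \<le> A2 * r ^ i"
      using \<rho> L0 by (auto simp: kernels_def R_def r_def power_powr[symmetric])
  qed
  interpret C: critical_rate q n R t r A1 A2
    using q2 n N4 r s1 A R t by unfold_locales (auto simp: s_def)
  show t_upper: "t * s ^ n \<le> C2" using C.t_upper by (simp add: s_def C2_def)
  show t_lower: "c2 \<le> t * s ^ n" using C.t_lower by (simp add: s_def c2_def)
  have eta_n: "0 < \<eta> ^ n" using eta by simp
  have tA: "t * A2 \<le> 1"
  proof -
    have "t \<le> C2 * (1 / s) ^ n" using t_upper s1 by (simp add: power_divide pos_le_divide_eq)
    then have "t * A2 \<le> C2 * (1 / s) ^ n * A2" using A by (intro mult_right_mono) auto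
    then show ?thesis using s_small by (simp add: mult_ac)
  qed
  note Cargs = eta_n eta_small tA
  define \<epsilon> where "\<epsilon> = C.\<epsilon> (\<eta> ^ n)"
  have eps_upper: "\<epsilon> \<le> C2 * \<eta> ^ n"
  proof -
    have "\<epsilon> \<le> t * s ^ n * \<eta> ^ n" using C.eps_upper[OF Cargs] by (simp add: \<epsilon>_def s_def)
    also have "\<dots> \<le> C2 * \<eta> ^ n" using t_upper eta_n by (intro mult_right_mono) auto
    finally show ?thesis .
  qed
  have eps_lower: "c2 / 6 * \<eta> ^ n \<le> \<epsilon>"
  proof -
    have "c2 / 6 * \<eta> ^ n \<le> t * s ^ n / 6 * \<eta> ^ n" using t_lower eta_n by (intro mult_right_mono) auto
    also have "\<dots> \<le> \<epsilon>" using C.eps_lower[OF Cargs] by (simp add: \<epsilon>_def s_def)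
    finally show ?thesis .
  qed
  have eps: "0 < \<epsilon>" "\<epsilon> \<le> 1"
  proof -
    have "0 < c2 / 6 * \<eta> ^ n" using c2 eta_n by simp
    then show "0 < \<epsilon>" using eps_lower by linarith
    show "\<epsilon> \<le> 1" using C.eps_le_1[OF Cargs] by (simp add: \<epsilon>_def)
  qed
  have cutoff: "r ^ n * \<eta> ^ n = real L powr (- (real n * \<theta>))"
  proof -
    have "r ^ n * \<eta> ^ n = (real L powr (- \<theta>)) ^ n"
      unfolding power_mult_distrib[symmetric] r_def \<eta>_def by (simp flip: powr_add)
    also have "\<dots> = real L powr (- (real n * \<theta>))" using L0 by (simp add: powr_power mult.commute)
    finally show ?thesis .
  qed
  have prob: "?pr {a, b} = C.P (\<eta> ^ n) (hlevel a b)" if "a \<in> ?V" "b \<in> ?V" "a \<noteq> b" for a b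
    using that hdist_eq_hlevel[OF L that]
    unfolding C.P_def[OF Cargs]
    by (simp add: edge_prob_eq kappa_minus_def rho_minus_def R_def t_def cutoff)
  interpret Perc: percolation ?V ?pr
  proof
    show "finite ?V" using card_hbox[OF L] by simp
    fix e assume "e \<in> pairs ?V"
    then obtain a b where "e = {a, b}" "a \<in> ?V" "b \<in> ?V" "a \<noteq> b" by (auto simp: pairs_def)
    then show "0 \<le> ?pr e \<and> ?pr e \<le> 1"
      using prob C.P_nonneg[OF Cargs] C.P_le_1[OF Cargs] by simp
  qed
  have total: "(\<Sum>i=1..n. (real q - 1) * real q ^ (i - 1) * C.P (\<eta> ^ n) i) = 1 - \<epsilon>"
    unfolding \<epsilon>_def C.\<epsilon>_def[OF Cargs] by simp
  have s1': "1 < real q * r" and A2: "0 < A2" and A4: "0 < A1 / 4"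
    and t_lower': "c2 \<le> t * (real q * r) ^ n" and t_upper': "t * (real q * r) ^ n \<le> C2"
    using s1 A t_lower t_upper by (simp_all add: s_def)
  have ball: "card {y \<in> ?V. hlevel a y \<le> j} = q ^ j" if "a \<in> ?V" "j \<le> n" for a j
    using card_hlevel_ball[OF L that] by (simp add: q_def)
  interpret H: hierarchical_percolation ?V ?pr q r A2 "A1 / 4" c2 C2 hlevel n "C.P (\<eta> ^ n)" t \<epsilon>
    by unfold_locales
      (rule q2 r s1' A2 A4 c2 C2 hlevel_le[OF L] hlevel_0_iff[OF L] hlevel_sym hlevel_ultrametric[OF L]
         ball prob n C.P_upper[OF Cargs] C.P_lower[OF Cargs] t_upper' t_lower' total eps; assumption)+
  have u: "u = Perc.\<tau> ?V ?o x"
    by (simp add: u_def conn_prob_def graph_pmf_def Perc.\<tau>_def Perc.\<mu>_def)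
  let ?i = "hlevel ?o x"
  have g: "g = t * r ^ ?i"
    using hnorm_eq_hlevel[OF L x] L0 by (simp add: g_def r_def power_powr)
  have o: "?o \<in> ?V" by (rule one_in_hbox)
  have "1 / (real q ^ n * \<epsilon>) \<le> 1 / (real q ^ n * (c2 / 6 * \<eta> ^ n))"
    using eps_lower eps c2 eta_n q2 by (intro divide_left_mono mult_left_mono mult_pos_pos) auto
  also have "\<dots> = 6 / c2 * (1 / (real q * \<eta>) ^ n)" by (simp add: power_mult_distrib)
  finally have Neps_upper: "1 / (real q ^ n * \<epsilon>) \<le> 6 / c2 * (1 / (real q * \<eta>) ^ n)" .
  have "u \<le> a0 / (1 - r) * g + B / (real q ^ n * \<epsilon>)"
    using H.\<tau>_upper[OF o x(1) x(2)[symmetric]] by (simp add: u g a0_def B_def)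
  also have "B / (real q ^ n * \<epsilon>) \<le> B * (6 / c2 * (1 / (real q * \<eta>) ^ n))"
    using mult_left_mono[OF Neps_upper, of B] H.B_pos by (simp add: B_def)
  finally show "u \<le> a0 / (1 - r) * g + 6 * B / c2 * (1 / (real q * \<eta>) ^ n)" by (simp add: mult_ac)
  have i: "1 \<le> ?i" "?i \<le> n"
    using H.lev_ge_1[OF o x(1) x(2)[symmetric]] H.lev_le[OF o x(1)] by auto
  have "A1 / 4 * g \<le> Perc.p ?o x"
    using H.P_ge[OF i] H.p_eq[OF o x(1) x(2)[symmetric]] by (simp add: g)
  also have "\<dots> \<le> u" unfolding u by (rule Perc.\<tau>_edge[OF o x(1)])
  finally show "A1 / 4 * g \<le> u" .
  have "c_far / (real q ^ n * \<epsilon>) \<le> u"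
    unfolding u c_far_def
  proof (rule H.\<tau>_lower[OF x(1) o, folded \<delta>_def])
    have "(\<Sum>i\<le>n. real q ^ i * (t * r ^ i)\<^sup>2) \<le> C2\<^sup>2 * ((real n + 1) * ((1 / s\<^sup>2) ^ n + (1 / q) ^ n))"
      unfolding s_def using q2 r t t_upper by (intro bubble_le) (auto simp: s_def)
    also have "\<dots> \<le> \<delta> * (c2 / 6 * \<eta> ^ n)" using bubble by (simp add: mult_ac)
    also have "\<dots> \<le> \<delta> * \<epsilon>" using eps_lower H.\<delta>_pos by (intro mult_left_mono) (auto simp: \<delta>_def)
    finally show "(\<Sum>i\<le>n. real q ^ i * (t * r ^ i)\<^sup>2) \<le> \<delta> * \<epsilon>" .
    have "1 / (real q ^ n * \<epsilon> ^ 3) \<le> 1 / (real q ^ n * (c2 / 6 * \<eta> ^ n) ^ 3)"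
      using eps_lower eps c2 eta_n q2 by (intro divide_left_mono mult_left_mono mult_pos_pos power_mono) auto
    also have "\<dots> = (6 / c2) ^ 3 * (1 / (real q * \<eta> ^ 3)) ^ n"
      by (simp add: power_mult_distrib power_divide power_mult[symmetric] mult.commute[of n 3])
    finally show "1 / (real q ^ n * \<epsilon> ^ 3) \<le> \<delta>" using window by linarith
  qed
  moreover have "c_far / C2 * (1 / (real q * \<eta>) ^ n) \<le> c_far / (real q ^ n * \<epsilon>)"
  proof -
    have "c_far / (real q ^ n * (C2 * \<eta> ^ n)) \<le> c_far / (real q ^ n * \<epsilon>)"
      using eps_upper eps C2 eta_n q2 H.c_far_pos
      by (intro divide_left_mono mult_left_mono mult_pos_pos) (auto simp: c_far_def)
    then show ?thesis by (simp add: power_mult_distrib mult_ac)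
  qed
  ultimately show "c_far / C2 * (1 / (real q * \<eta>) ^ n) \<le> u" by linarith
qed

lemma eventually_geometric_small:
  fixes x :: real
  assumes x: "0 \<le> x" "x < 1" and e: "0 < e"
  shows "\<forall>\<^sub>F n in sequentially. K * ((real n + 1) * x ^ n) < e"
proof -
  have "(\<lambda>n. K * (real n * x ^ n + x ^ n)) \<longlonglongrightarrow> K * (0 + 0)"
    using x by (intro tendsto_intros powser_times_n_limit_0 LIMSEQ_power_zero) auto
  then have "(\<lambda>n. K * ((real n + 1) * x ^ n)) \<longlonglongrightarrow> 0"
    by (simp add: algebra_simps)
  then show ?thesis using e by (intro order_tendstoD(2)) auto
qed

lemma eventually_power_small:
  fixes x :: real
  assumes x: "0 \<le> x" "x < 1" and e: "0 < e"
  shows "\<forall>\<^sub>F n in sequentially. K * x ^ n < e"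
proof -
  have "(\<lambda>n. K * x ^ n) \<longlonglongrightarrow> K * 0"
    using x by (intro tendsto_intros LIMSEQ_power_zero) auto
  then show ?thesis using e by (intro order_tendstoD(2)) auto
qed

lemma far_rate_eq:
  assumes L: "L \<ge> 2" and d: "d \<ge> 1"
  shows "far_rate L d \<alpha> \<theta> n = real L powr (- (real n * (real d + \<alpha> - \<theta>)))"
    and "far_rate L d \<alpha> \<theta> n = 1 / (real (L ^ d) * real L powr (\<alpha> - \<theta>)) ^ n"
proof -
  have L0: "0 < real L" using L by simp
  have "far_rate L d \<alpha> \<theta> n = (real L powr real (n * d)) powr (- ((real d + \<alpha> - \<theta>) / real d))"
    using L0 by (simp only: far_rate_def card_hbox(1)[OF L] of_nat_power powr_realpow)
  also have "\<dots> = real L powr (- (real n * (real d + \<alpha> - \<theta>)))"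
    using d by (simp add: powr_powr)
  finally show 1: "far_rate L d \<alpha> \<theta> n = real L powr (- (real n * (real d + \<alpha> - \<theta>)))" .
  have "real (L ^ d) * real L powr (\<alpha> - \<theta>) = real L powr (real d + \<alpha> - \<theta>)"
    using L0 by (simp add: powr_add powr_diff powr_realpow)
  then have "(real (L ^ d) * real L powr (\<alpha> - \<theta>)) ^ n = real L powr (real n * (real d + \<alpha> - \<theta>))"
    using L0 by (simp add: powr_power mult.commute)
  then show "far_rate L d \<alpha> \<theta> n = 1 / (real (L ^ d) * real L powr (\<alpha> - \<theta>)) ^ n"
    unfolding 1 by (simp add: powr_minus divide_inverse)
qed

text \<open>The smallness conditions hold for large \<open>n\<close>: \<open>s\<^sup>2 * \<eta> > 1\<close> is equivalent to
\<open>\<theta> < 2 * d - \<alpha>\<close>, \<open>q * \<eta> ^ 3 > 1\<close> to \<open>\<theta> < \<alpha> + d / 3\<close>, and \<open>\<eta> < 1\<close> to \<open>\<alpha> < \<theta>\<close>. Only the threshold \<open>n0\<close> depends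
on \<open>\<theta>\<close>.\<close>

lemma connection_bounds:
  fixes L d :: nat and A1 A2 \<alpha> :: real
  assumes d: "d \<ge> 1" and L: "L \<ge> 2" and A: "0 < A1" "A1 \<le> A2" and \<alpha>: "0 < \<alpha>" "\<alpha> < real d"
  shows "\<exists>C>0. \<forall>\<theta>. \<alpha> < \<theta> \<longrightarrow> \<theta> < \<alpha> + real d / 3 \<longrightarrow> \<theta> < 2 * real d - \<alpha> \<longrightarrow>
    (\<exists>n0\<ge>1. \<forall>\<rho>\<in>kernels A1 A2 \<alpha>. \<forall>n\<ge>n0. \<forall>x\<in>hbox L d n - {\<one>\<^bsub>hier_group L d\<^esub>}.
      (let u = conn_prob L d \<theta> \<rho> n \<one>\<^bsub>hier_group L d\<^esub> x; t = inverse (zeta L d \<rho> n);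
         g = t * hnorm L d x powr (- \<alpha>); f = far_rate L d \<alpha> \<theta> n; e = real L powr (- (real n * (real d - \<alpha>)))
       in u \<le> C * (g + f) \<and> g \<le> C * u \<and> f \<le> C * u \<and> e \<le> C * t \<and> t \<le> C * e))"
proof -
  define q where "q = L ^ d"
  define r where "r = real L powr (- \<alpha>)"
  define s where "s = real q * r"
  define c2 where "c2 = (s - 1) / (A2 * s)"
  define C2 where "C2 = 4 / A1"
  have q2: "2 \<le> q"
  proof -
    have "L ^ 1 \<le> L ^ d" using L d by (intro power_increasing) auto
    then show ?thesis using L by (simp add: q_def)
  qed
  have L0: "0 < real L" "1 < real L" using L by auto
  have r: "0 < r" "r < 1" using L0 \<alpha> by (auto simp: r_def powr_less_one)
  have s_eq: "s = real L powr (real d - \<alpha>)"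
    using L0 by (simp add: s_def q_def r_def powr_diff powr_minus powr_realpow divide_inverse)
  have s1: "1 < s" unfolding s_eq using powr_less_mono[of 0 "real d - \<alpha>" "real L"] L0 \<alpha> by simp
  have c2: "0 < c2" using s1 A by (simp add: c2_def)
  have C2: "0 < C2" using A by (simp add: C2_def)
  interpret K: hierarchical_constants q r A2 "A1 / 4" c2 C2
    using q2 r s1 A c2 C2 by unfold_locales (auto simp: s_def)
  let ?\<delta> = "hierarchical_constants.\<delta> q r A2 (A1 / 4) c2 C2"
    and ?a = "hierarchical_constants.near_coeff A2 (A1 / 4) c2"
    and ?B = "hierarchical_constants.B q r A2 (A1 / 4) c2 C2"
    and ?c7 = "hierarchical_constants.c_far (A1 / 4) c2"
  have pos: "0 < ?\<delta>" "0 < ?a / (1 - r)" "0 < 6 * ?B / c2" "0 < ?c7"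
    using K.\<delta>_pos K.near_coeff_pos K.B_pos K.c_far_pos r c2 by auto
  define C where "C = ?a / (1 - r) + 6 * ?B / c2 + 4 / A1 + C2 / ?c7 + 1 / c2 + C2"
  have pos': "0 < 4 / A1" "0 < C2 / ?c7" "0 < 1 / c2" using A C2 c2 pos by auto
  have C_ge: "?a / (1 - r) \<le> C" "6 * ?B / c2 \<le> C" "4 / A1 \<le> C" "C2 / ?c7 \<le> C" "1 / c2 \<le> C" "C2 \<le> C"
    and C: "0 < C"
    using pos pos' C2 unfolding C_def by linarith+
  show ?thesis
  proof (intro exI[of _ C] conjI allI impI C)
    fix \<theta> assume \<theta>: "\<alpha> < \<theta>" "\<theta> < \<alpha> + real d / 3" "\<theta> < 2 * real d - \<alpha>"
    define \<eta> where "\<eta> = real L powr (\<alpha> - \<theta>)"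
    have lt1: "1 / real L powr a < 1" if "0 < a" for a
      using powr_less_mono[of 0 a "real L"] that L0 by simp
    have eta: "0 < \<eta>" "\<eta> < 1" using L0 \<theta> by (auto simp: \<eta>_def powr_less_one)
    have q_eq: "real q = real L powr real d" using L0 by (simp add: q_def powr_realpow)
    have x1: "1 / (s\<^sup>2 * \<eta>) < 1"
    proof -
      have "s\<^sup>2 * \<eta> = real L powr (2 * real d - \<alpha> - \<theta>)"
        unfolding s_eq \<eta>_def power2_eq_square by (simp add: algebra_simps flip: powr_add)
      then show ?thesis using lt1[of "2 * real d - \<alpha> - \<theta>"] \<theta> by simp
    qed
    have x2: "1 / (q * \<eta>) < 1"
    proof -
      have "q * \<eta> = real L powr (real d + \<alpha> - \<theta>)" unfolding q_eq \<eta>_def by (simp add: algebra_simps flip: powr_add)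
      then show ?thesis using lt1[of "real d + \<alpha> - \<theta>"] \<theta> by simp
    qed
    have x3: "1 / (q * \<eta> ^ 3) < 1"
    proof -
      have "q * \<eta> ^ 3 = real L powr (real d + 3 * (\<alpha> - \<theta>))"
        unfolding q_eq \<eta>_def power3_eq_cube by (simp add: algebra_simps flip: powr_add)
      then show ?thesis using lt1[of "real d + 3 * (\<alpha> - \<theta>)"] \<theta> by simp
    qed
    have e: "0 < ?\<delta> * (c2 / 6) / 2" using pos c2 by simp
    have "\<forall>\<^sub>F n in sequentially. 1 \<le> n \<and> 1 * (1 / real q) ^ n < 1 / 4 \<and> 1 * \<eta> ^ n < A1 / 2 \<and>
        C2 * A2 * (1 / s) ^ n < 1 \<and>
        C2\<^sup>2 * ((real n + 1) * (1 / (s\<^sup>2 * \<eta>)) ^ n) < ?\<delta> * (c2 / 6) / 2 \<and>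
        C2\<^sup>2 * ((real n + 1) * (1 / (q * \<eta>)) ^ n) < ?\<delta> * (c2 / 6) / 2 \<and>
        (6 / c2) ^ 3 * (1 / (q * \<eta> ^ 3)) ^ n < ?\<delta>"
      using q2 eta s1 x1 x2 x3 e pos A
      by (intro eventually_conj eventually_ge_at_top eventually_power_small eventually_geometric_small) auto
    then obtain n0 where n0: "\<And>n. n \<ge> n0 \<Longrightarrow> 1 \<le> n \<and> 1 * (1 / real q) ^ n < 1 / 4 \<and> 1 * \<eta> ^ n < A1 / 2 \<and>
        C2 * A2 * (1 / s) ^ n < 1 \<and>
        C2\<^sup>2 * ((real n + 1) * (1 / (s\<^sup>2 * \<eta>)) ^ n) < ?\<delta> * (c2 / 6) / 2 \<and>
        C2\<^sup>2 * ((real n + 1) * (1 / (q * \<eta>)) ^ n) < ?\<delta> * (c2 / 6) / 2 \<and>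
        (6 / c2) ^ 3 * (1 / (q * \<eta> ^ 3)) ^ n < ?\<delta>"
      unfolding eventually_sequentially by blast
    show "\<exists>n0\<ge>1. \<forall>\<rho>\<in>kernels A1 A2 \<alpha>. \<forall>n\<ge>n0. \<forall>x\<in>hbox L d n - {\<one>\<^bsub>hier_group L d\<^esub>}.
      (let u = conn_prob L d \<theta> \<rho> n \<one>\<^bsub>hier_group L d\<^esub> x; t = inverse (zeta L d \<rho> n);
         g = t * hnorm L d x powr (- \<alpha>); f = far_rate L d \<alpha> \<theta> n; e = real L powr (- (real n * (real d - \<alpha>)))
       in u \<le> C * (g + f) \<and> g \<le> C * u \<and> f \<le> C * u \<and> e \<le> C * t \<and> t \<le> C * e)"
    proof (intro exI[of _ "max 1 n0"] conjI ballI allI impI)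
      fix \<rho> n x assume \<rho>: "\<rho> \<in> kernels A1 A2 \<alpha>" and n: "max 1 n0 \<le> n"
        and x: "x \<in> hbox L d n - {\<one>\<^bsub>hier_group L d\<^esub>}"
      define u where "u = conn_prob L d \<theta> \<rho> n \<one>\<^bsub>hier_group L d\<^esub> x"
      define t where "t = inverse (zeta L d \<rho> n)"
      define g where "g = t * hnorm L d x powr (- \<alpha>)"
      define f where "f = far_rate L d \<alpha> \<theta> n"
      have n0': "n0 \<le> n" "1 \<le> n" using n by auto
      note sm = n0[OF n0'(1)]
      have 1: "4 \<le> real q ^ n"
      proof -
        have "1 / real q ^ n < 1 / 4" using sm by (simp add: power_divide)
        then show ?thesis using q2 by (simp add: field_simps)
      qed
      have 2: "C2\<^sup>2 * ((real n + 1) * ((1 / s\<^sup>2) ^ n + (1 / q) ^ n)) \<le> ?\<delta> * (c2 / 6) * \<eta> ^ n"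
      proof -
        have "C2\<^sup>2 * ((real n + 1) * (1 / (s\<^sup>2 * \<eta>)) ^ n) + C2\<^sup>2 * ((real n + 1) * (1 / (q * \<eta>)) ^ n) \<le> ?\<delta> * (c2 / 6)"
          using sm by linarith
        then have "(C2\<^sup>2 * ((real n + 1) * (1 / (s\<^sup>2 * \<eta>)) ^ n) + C2\<^sup>2 * ((real n + 1) * (1 / (q * \<eta>)) ^ n)) * \<eta> ^ n
            \<le> ?\<delta> * (c2 / 6) * \<eta> ^ n" using eta by (intro mult_right_mono) auto
        moreover have "(1 / (s\<^sup>2 * \<eta>)) ^ n * \<eta> ^ n = (1 / s\<^sup>2) ^ n" "(1 / (q * \<eta>)) ^ n * \<eta> ^ n = (1 / q) ^ n"
          unfolding power_mult_distrib[symmetric] using eta by simp_all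
        moreover have "(M * (m * X) + M * (m * Y)) * Z = M * (m * (X * Z + Y * Z))" for M m X Y Z :: real
          by (simp add: algebra_simps)
        ultimately show ?thesis by (simp only:)
      qed
      have 3: "\<eta> ^ n \<le> A1 / 2" "C2 * A2 * (1 / s) ^ n \<le> 1" "(6 / c2) ^ 3 * (1 / (q * \<eta> ^ 3)) ^ n \<le> ?\<delta>"
        using sm by auto
      have x': "x \<in> hbox L d n" "x \<noteq> \<one>\<^bsub>hier_group L d\<^esub>" using x by auto
      note fv = finite_volume_bounds[where \<theta> = \<theta>, OF d L A \<alpha> \<rho> n0'(2), folded q_def r_def \<eta>_def s_def c2_def C2_def,
        folded s_def, folded c2_def, OF 1 3(1,2) 2 3(3) x', folded u_def t_def, folded g_def]
      have f: "f = 1 / (q * \<eta>) ^ n" unfolding f_def far_rate_eq(2)[OF L d] q_def \<eta>_def by simp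
      have f0: "0 \<le> f" using eta by (simp add: f)
      have sn: "s ^ n * real L powr (- (real n * (real d - \<alpha>))) = 1" "0 < s ^ n"
        unfolding s_eq using L0 by (simp_all add: powr_power mult.commute flip: powr_add)
      have t0: "0 < t"
      proof -
        have "0 < t * s ^ n" using fv(4) c2 by linarith
        then show ?thesis using sn(2) by (rule zero_less_mult_pos2)
      qed
      have g0: "0 \<le> g" using t0 by (simp add: g_def)
      have u0: "0 \<le> u" by (simp add: u_def conn_prob_def)
      have "u \<le> ?a / (1 - r) * g + 6 * ?B / c2 * f" using fv(1) by (simp add: f)
      also have "\<dots> \<le> C * g + C * f" using C_ge g0 f0 by (intro add_mono mult_right_mono) auto
      finally have u1: "u \<le> C * (g + f)" by (simp add: distrib_left)
      have "g \<le> 4 / A1 * u" using fv(2) A by (simp add: field_simps)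
      also have "\<dots> \<le> C * u" using C_ge u0 by (intro mult_right_mono) auto
      finally have u2: "g \<le> C * u" .
      have "f = C2 / ?c7 * (?c7 / C2 * f)" using pos C2 by simp
      also have "\<dots> \<le> C2 / ?c7 * u" using fv(3) pos C2 f by (intro mult_left_mono) auto
      also have "\<dots> \<le> C * u" using C_ge u0 by (intro mult_right_mono) auto
      finally have u3: "f \<le> C * u" .
      let ?e = "real L powr (- (real n * (real d - \<alpha>)))"
      have te: "t = t * s ^ n * ?e" using sn(1) by (simp add: mult.assoc)
      have e0: "0 \<le> ?e" by simp
      have "?e \<le> C * t"
      proof -
        have "c2 * ?e \<le> t * s ^ n * ?e" using fv(4) e0 by (rule mult_right_mono)
        then have "c2 * ?e \<le> t" using te by simp
        then have "?e \<le> 1 / c2 * t" using c2 by (simp add: field_simps)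
        also have "\<dots> \<le> C * t" using C_ge t0 by (intro mult_right_mono) auto
        finally show ?thesis .
      qed
      moreover have "t \<le> C * ?e"
      proof -
        have "t * s ^ n * ?e \<le> C * ?e" using fv(5) C_ge e0 by (intro mult_right_mono) auto
        then show ?thesis using te by simp
      qed
      ultimately show "let u = conn_prob L d \<theta> \<rho> n \<one>\<^bsub>hier_group L d\<^esub> x; t = inverse (zeta L d \<rho> n);
         g = t * hnorm L d x powr (- \<alpha>); f = far_rate L d \<alpha> \<theta> n; e = real L powr (- (real n * (real d - \<alpha>)))
       in u \<le> C * (g + f) \<and> g \<le> C * u \<and> f \<le> C * u \<and> e \<le> C * t \<and> t \<le> C * e"
        using u1 u2 u3 unfolding Let_def u_def g_def f_def t_def by blast
    qed simp
  qed
qed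

lemma asymp_unifI:
  assumes "0 < C"
    and "\<And>\<theta>. \<theta> \<in> \<Theta> \<Longrightarrow> \<exists>n0\<ge>1. \<forall>\<rho>\<in>R. \<forall>n\<ge>n0. \<forall>i\<in>I n. a \<theta> \<rho> n i \<le> C * b \<theta> \<rho> n i \<and> b \<theta> \<rho> n i \<le> C * a \<theta> \<rho> n i"
  shows "asymp_unif \<Theta> R I a b"
  unfolding asymp_unif_def lesssim_unif_def using assms by (meson order_refl)

lemma hnorm_ge_1:
  assumes L: "L \<ge> 2" and x: "x \<in> hbox L d n" "x \<noteq> \<one>\<^bsub>hier_group L d\<^esub>"
  shows "1 \<le> hnorm L d x"
  using hnorm_eq_hlevel[OF L x] L by simp

text \<open>Once the connection probability is comparable to the sum of the direct-edge rate and the far rate, it is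
comparable to whichever of the two dominates. The size of \<open>zeta\<close> enters because it decides which one does.\<close>

lemma asymp_unif_conn_prob:
  fixes L d :: nat and A1 A2 \<alpha> :: real
  assumes d: "d \<ge> 1" and L: "L \<ge> 2" and A: "0 < A1" "A1 \<le> A2" and \<alpha>: "0 < \<alpha>" "\<alpha> < real d"
    and \<Theta>: "\<And>\<theta>. \<theta> \<in> \<Theta> \<Longrightarrow> \<alpha> < \<theta> \<and> \<theta> < \<alpha> + real d / 3 \<and> \<theta> < 2 * real d - \<alpha>"
    and rate: "\<And>C \<theta> \<rho> n x. C > 0 \<Longrightarrow> \<theta> \<in> \<Theta> \<Longrightarrow> n \<ge> 1 \<Longrightarrow> x \<in> hbox L d n \<Longrightarrow> x \<noteq> \<one>\<^bsub>hier_group L d\<^esub> \<Longrightarrow>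
      real L powr (- (real n * (real d - \<alpha>))) \<le> C * inverse (zeta L d \<rho> n) \<Longrightarrow>
      inverse (zeta L d \<rho> n) \<le> C * real L powr (- (real n * (real d - \<alpha>))) \<Longrightarrow>
      (b \<theta> \<rho> n x = inverse (zeta L d \<rho> n) * hnorm L d x powr (- \<alpha>) \<and>
         far_rate L d \<alpha> \<theta> n \<le> C * b \<theta> \<rho> n x) \<or>
      (b \<theta> \<rho> n x = far_rate L d \<alpha> \<theta> n \<and>
         inverse (zeta L d \<rho> n) * hnorm L d x powr (- \<alpha>) \<le> C * b \<theta> \<rho> n x)"
  shows "asymp_unif \<Theta> (kernels A1 A2 \<alpha>) (\<lambda>n. hbox L d n - {\<one>\<^bsub>hier_group L d\<^esub>})
      (\<lambda>\<theta> \<rho> n x. conn_prob L d \<theta> \<rho> n \<one>\<^bsub>hier_group L d\<^esub> x) b"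
proof -
  obtain C where C: "0 < C" and bd: "\<And>\<theta>. \<alpha> < \<theta> \<Longrightarrow> \<theta> < \<alpha> + real d / 3 \<Longrightarrow> \<theta> < 2 * real d - \<alpha> \<Longrightarrow>
    (\<exists>n0\<ge>1. \<forall>\<rho>\<in>kernels A1 A2 \<alpha>. \<forall>n\<ge>n0. \<forall>x\<in>hbox L d n - {\<one>\<^bsub>hier_group L d\<^esub>}.
      (let u = conn_prob L d \<theta> \<rho> n \<one>\<^bsub>hier_group L d\<^esub> x; t = inverse (zeta L d \<rho> n);
         g = t * hnorm L d x powr (- \<alpha>); f = far_rate L d \<alpha> \<theta> n; e = real L powr (- (real n * (real d - \<alpha>)))
       in u \<le> C * (g + f) \<and> g \<le> C * u \<and> f \<le> C * u \<and> e \<le> C * t \<and> t \<le> C * e))"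
    using connection_bounds[OF d L A \<alpha>] by blast
  show ?thesis
  proof (rule asymp_unifI[where C = "C * (1 + C)"])
    show "0 < C * (1 + C)" using C by simp
    fix \<theta> assume \<theta>: "\<theta> \<in> \<Theta>"
    obtain n0 where n0: "n0 \<ge> 1" and bd': "\<And>\<rho> n x. \<rho> \<in> kernels A1 A2 \<alpha> \<Longrightarrow> n \<ge> n0 \<Longrightarrow>
      x \<in> hbox L d n - {\<one>\<^bsub>hier_group L d\<^esub>} \<Longrightarrow>
      (let u = conn_prob L d \<theta> \<rho> n \<one>\<^bsub>hier_group L d\<^esub> x; t = inverse (zeta L d \<rho> n);
         g = t * hnorm L d x powr (- \<alpha>); f = far_rate L d \<alpha> \<theta> n; e = real L powr (- (real n * (real d - \<alpha>)))
       in u \<le> C * (g + f) \<and> g \<le> C * u \<and> f \<le> C * u \<and> e \<le> C * t \<and> t \<le> C * e)"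
      using bd[of \<theta>] \<Theta>[OF \<theta>] by blast
    show "\<exists>n0\<ge>1. \<forall>\<rho>\<in>kernels A1 A2 \<alpha>. \<forall>n\<ge>n0. \<forall>x\<in>hbox L d n - {\<one>\<^bsub>hier_group L d\<^esub>}.
      conn_prob L d \<theta> \<rho> n \<one>\<^bsub>hier_group L d\<^esub> x \<le> C * (1 + C) * b \<theta> \<rho> n x \<and>
      b \<theta> \<rho> n x \<le> C * (1 + C) * conn_prob L d \<theta> \<rho> n \<one>\<^bsub>hier_group L d\<^esub> x"
    proof (intro exI[of _ n0] conjI[OF n0] ballI allI impI)
      fix \<rho> n x assume a: "\<rho> \<in> kernels A1 A2 \<alpha>" "n \<ge> n0" "x \<in> hbox L d n - {\<one>\<^bsub>hier_group L d\<^esub>}"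
      define u where "u = conn_prob L d \<theta> \<rho> n \<one>\<^bsub>hier_group L d\<^esub> x"
      define t where "t = inverse (zeta L d \<rho> n)"
      define g where "g = t * hnorm L d x powr (- \<alpha>)"
      define f where "f = far_rate L d \<alpha> \<theta> n"
      have B: "u \<le> C * (g + f)" "g \<le> C * u" "f \<le> C * u"
        and T: "real L powr (- (real n * (real d - \<alpha>))) \<le> C * t" "t \<le> C * real L powr (- (real n * (real d - \<alpha>)))"
        using bd'[OF a] unfolding Let_def u_def g_def f_def t_def by blast+
      have u0: "0 \<le> u" by (simp add: u_def conn_prob_def)
      have n: "n \<ge> 1" and x: "x \<in> hbox L d n" "x \<noteq> \<one>\<^bsub>hier_group L d\<^esub>" using a n0 by auto
      have "b \<theta> \<rho> n x \<le> C * u \<and> u \<le> C * (b \<theta> \<rho> n x + C * b \<theta> \<rho> n x)"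
        using rate[OF C \<theta> n x, of \<rho>, folded t_def, OF T, folded g_def f_def]
      proof
        assume h: "b \<theta> \<rho> n x = g \<and> f \<le> C * b \<theta> \<rho> n x"
        then have "C * (g + f) \<le> C * (b \<theta> \<rho> n x + C * b \<theta> \<rho> n x)"
          using C by (intro mult_left_mono add_mono) auto
        then show ?thesis using B h by simp
      next
        assume h: "b \<theta> \<rho> n x = f \<and> g \<le> C * b \<theta> \<rho> n x"
        then have "C * (f + g) \<le> C * (b \<theta> \<rho> n x + C * b \<theta> \<rho> n x)"
          using C by (intro mult_left_mono add_mono) auto
        then show ?thesis using B h by (simp add: add.commute)
      qed
      moreover have "C * u \<le> C * (1 + C) * u" using C u0 by (intro mult_right_mono) (auto simp: algebra_simps)
      ultimately show "conn_prob L d \<theta> \<rho> n \<one>\<^bsub>hier_group L d\<^esub> x \<le> C * (1 + C) * b \<theta> \<rho> n x \<and>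
        b \<theta> \<rho> n x \<le> C * (1 + C) * conn_prob L d \<theta> \<rho> n \<one>\<^bsub>hier_group L d\<^esub> x"
        unfolding u_def[symmetric] by (simp add: algebra_simps)
    qed
  qed
qed

text \<open>With \<open>zeta\<close> of order \<open>L powr (n * (d - \<alpha>))\<close>, the two rates cross exactly
at distance \<open>L powr (n * (2 - \<theta> / \<alpha>))\<close>.\<close>

lemma star_estimateI:
  fixes L d :: nat and A1 A2 \<alpha> :: real
  assumes d: "d \<ge> 1" and L: "L \<ge> 2" and A: "0 < A1" "A1 \<le> A2" and \<alpha>: "0 < \<alpha>" "\<alpha> < real d"
    and \<Theta>: "\<And>\<theta>. \<theta> \<in> \<Theta> \<Longrightarrow> \<alpha> < \<theta> \<and> \<theta> < \<alpha> + real d / 3 \<and> \<theta> < 2 * real d - \<alpha>"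
  shows "star_estimate L d A1 A2 \<alpha> \<Theta>"
  unfolding star_estimate_def
proof (rule asymp_unif_conn_prob[OF d L A \<alpha> \<Theta>])
  fix C \<theta> \<rho> and n :: nat and x
  assume C: "0 < C" and n: "1 \<le> n" and x: "x \<in> hbox L d n" "x \<noteq> \<one>\<^bsub>hier_group L d\<^esub>"
    and T: "real L powr (- (real n * (real d - \<alpha>))) \<le> C * inverse (zeta L d \<rho> n)"
      "inverse (zeta L d \<rho> n) \<le> C * real L powr (- (real n * (real d - \<alpha>)))"
  let ?t = "inverse (zeta L d \<rho> n)" and ?e = "real L powr (- (real n * (real d - \<alpha>)))"
  let ?D = "real L powr (real n * (2 - \<theta> * inverse \<alpha>))"
  have L0: "0 < real L" using L by simp
  have D: "hdiam L d (hbox L d n) powr (2 - \<theta> * inverse \<alpha>) = ?D"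
    using L0 by (simp add: hdiam_hbox[OF L d n] powr_realpow[symmetric] powr_powr)
  have nx: "0 < hnorm L d x" using hnorm_ge_1[OF L x] by simp
  have eD: "?e * ?D powr (- \<alpha>) = far_rate L d \<alpha> \<theta> n"
  proof -
    have "real n * (2 - \<theta> * inverse \<alpha>) * - \<alpha> = - (real n * (2 * \<alpha> - \<theta>))"
      using \<alpha> by (simp add: field_simps)
    then have "?D powr (- \<alpha>) = real L powr (- (real n * (2 * \<alpha> - \<theta>)))" by (simp only: powr_powr)
    then have "?e * ?D powr (- \<alpha>) =
        real L powr (- (real n * (real d - \<alpha>)) + - (real n * (2 * \<alpha> - \<theta>)))"
      by (simp only: powr_add)
    also have "- (real n * (real d - \<alpha>)) + - (real n * (2 * \<alpha> - \<theta>)) = - (real n * (real d + \<alpha> - \<theta>))"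
      by (simp add: algebra_simps)
    finally show ?thesis unfolding far_rate_eq(1)[OF L d] .
  qed
  show "(star_rate L d \<alpha> \<theta> \<rho> n x = ?t * hnorm L d x powr (- \<alpha>) \<and> far_rate L d \<alpha> \<theta> n \<le> C * star_rate L d \<alpha> \<theta> \<rho> n x) \<or>
    (star_rate L d \<alpha> \<theta> \<rho> n x = far_rate L d \<alpha> \<theta> n \<and> ?t * hnorm L d x powr (- \<alpha>) \<le> C * star_rate L d \<alpha> \<theta> \<rho> n x)"
  proof (cases "hnorm L d x \<le> ?D")
    case True
    then have "?D powr (- \<alpha>) \<le> hnorm L d x powr (- \<alpha>)" using nx \<alpha> by (intro powr_mono2') auto
    then have "?e * ?D powr (- \<alpha>) \<le> (C * ?t) * hnorm L d x powr (- \<alpha>)"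
      using T(1) order_trans[OF powr_ge_zero T(1)] by (intro mult_mono) auto
    then show ?thesis using True eD by (simp add: star_rate_def D mult.assoc)
  next
    case False
    then have "hnorm L d x powr (- \<alpha>) \<le> ?D powr (- \<alpha>)" using L0 \<alpha> by (intro powr_mono2') auto
    then have "?t * hnorm L d x powr (- \<alpha>) \<le> (C * ?e) * ?D powr (- \<alpha>)"
      using T(2) C by (intro mult_mono) auto
    then show ?thesis using False eD by (simp add: star_rate_def D mult.assoc)
  qed
qed

text \<open>If \<open>\<theta> \<ge> 2 * \<alpha>\<close>, the crossover distance is at most \<open>1\<close>, so the far rate dominates everywhere.\<close>

lemma far_rate_estimateI:
  fixes L d :: nat and A1 A2 \<alpha> :: real
  assumes d: "d \<ge> 1" and L: "L \<ge> 2" and A: "0 < A1" "A1 \<le> A2" and \<alpha>: "0 < \<alpha>" "\<alpha> < real d"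
    and \<Theta>: "\<And>\<theta>. \<theta> \<in> \<Theta> \<Longrightarrow> 2 * \<alpha> \<le> \<theta> \<and> \<theta> < \<alpha> + real d / 3 \<and> \<theta> < 2 * real d - \<alpha>"
  shows "asymp_unif \<Theta> (kernels A1 A2 \<alpha>) (\<lambda>n. hbox L d n - {\<one>\<^bsub>hier_group L d\<^esub>})
          (\<lambda>\<theta> \<rho> n x. conn_prob L d \<theta> \<rho> n \<one>\<^bsub>hier_group L d\<^esub> x)
          (\<lambda>\<theta> \<rho> n x. far_rate L d \<alpha> \<theta> n)"
proof (rule asymp_unif_conn_prob[OF d L A \<alpha>])
  show "\<alpha> < \<theta> \<and> \<theta> < \<alpha> + real d / 3 \<and> \<theta> < 2 * real d - \<alpha>" if "\<theta> \<in> \<Theta>" for \<theta>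
    using \<Theta>[OF that] \<alpha> by auto
  fix C \<theta> \<rho> and n :: nat and x
  assume C: "0 < C" and \<theta>: "\<theta> \<in> \<Theta>" and x: "x \<in> hbox L d n" "x \<noteq> \<one>\<^bsub>hier_group L d\<^esub>"
    and T: "inverse (zeta L d \<rho> n) \<le> C * real L powr (- (real n * (real d - \<alpha>)))"
  let ?t = "inverse (zeta L d \<rho> n)" and ?e = "real L powr (- (real n * (real d - \<alpha>)))"
  have L1: "1 \<le> real L" using L by simp
  have "hnorm L d x powr (- \<alpha>) \<le> 1 powr (- \<alpha>)"
    using hnorm_ge_1[OF L x] \<alpha> by (intro powr_mono2') auto
  then have "?t * hnorm L d x powr (- \<alpha>) \<le> (C * ?e) * 1"
    using T C by (intro mult_mono) auto
  also have "\<dots> \<le> C * far_rate L d \<alpha> \<theta> n"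
  proof -
    have "real n * (real d + \<alpha> - \<theta>) \<le> real n * (real d - \<alpha>)"
      using \<Theta>[OF \<theta>] by (intro mult_left_mono) auto
    then have "?e \<le> far_rate L d \<alpha> \<theta> n"
      unfolding far_rate_eq(1)[OF L d] using L1 by (intro powr_mono) auto
    then show ?thesis using C by simp
  qed
  finally show "(far_rate L d \<alpha> \<theta> n = ?t * hnorm L d x powr (- \<alpha>) \<and> far_rate L d \<alpha> \<theta> n \<le> C * far_rate L d \<alpha> \<theta> n) \<or>
    (far_rate L d \<alpha> \<theta> n = far_rate L d \<alpha> \<theta> n \<and> ?t * hnorm L d x powr (- \<alpha>) \<le> C * far_rate L d \<alpha> \<theta> n)"
    by simp
qed

theorem theorem2p2:
  fixes L d :: nat and A1 A2 \<alpha> :: real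
  assumes "d \<ge> 1" and "L \<ge> 2"
    and "0 < A1" and "A1 \<le> A2"
    and "0 < \<alpha>" and "\<alpha> < real d"
  shows
    "(\<alpha> < real d / 3 \<longrightarrow>
        star_estimate L d A1 A2 \<alpha> {\<theta>. \<alpha> < \<theta> \<and> \<theta> < \<alpha> + real d / 3 \<and> \<theta> < 2 * \<alpha>}) \<and>
     (\<alpha> < real d / 3 \<longrightarrow>
        asymp_unif {\<theta>. 2 * \<alpha> \<le> \<theta> \<and> \<theta> < \<alpha> + real d / 3} (kernels A1 A2 \<alpha>)
          (\<lambda>n. hbox L d n - {\<one>\<^bsub>hier_group L d\<^esub>})
          (\<lambda>\<theta> \<rho> n x. conn_prob L d \<theta> \<rho> n \<one>\<^bsub>hier_group L d\<^esub> x)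
          (\<lambda>\<theta> \<rho> n x. far_rate L d \<alpha> \<theta> n)) \<and>
     (real d / 3 \<le> \<alpha> \<and> \<alpha> \<le> 5 * real d / 6 \<longrightarrow>
        star_estimate L d A1 A2 \<alpha> {\<theta>. \<alpha> < \<theta> \<and> \<theta> < \<alpha> + real d / 3}) \<and>
     (5 * real d / 6 < \<alpha> \<longrightarrow>
        star_estimate L d A1 A2 \<alpha>
          {\<theta>. \<alpha> < \<theta> \<and> \<theta> < \<alpha> + real d / 3 \<and> \<theta> < 2 * real d - \<alpha>})"
  by (intro conjI impI star_estimateI[OF assms] far_rate_estimateI[OF assms]) auto

end
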